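(* Let $A$ be a unital $C^*$-algebra. Let $\mathcal{L}$ be the collection of all pairs $(B,E)$ where $B$ is a unital $C^*$-algebra containing $A$ as a $C^*$-subalgebra with a common unit and $E$ is a conditional expectation of $B$ onto $A$ with $\mathrm{Index}\,E=2$, and let $\mathcal{M}$ be the collection of all involutive $A$-$A$-equivalence bimodules. Let $\mathcal{F}:\mathcal{L}/\!\sim\;\to\mathcal{M}/\!\sim$ be the map $\mathcal{F}([B,E])=[X_B]$ and $\mathcal{G}:\mathcal{M}/\!\sim\;\to\mathcal{L}/\!\sim$ the map $\mathcal{G}([X])=[B_X,E_X]$. Then $\mathcal{G}\circ\mathcal{F}=\mathrm{id}_{\mathcal{L}/\sim}$.
   Context: Index: A quasi-basis for a conditional expectation $E:B\to A$ is a finite family $\{(u_i,v_i)\}\subset B\times B$ with $x=\sum_i u_iE(v_ix)=\sum_i E(xu_i)v_i$ for all $x\in B$; then $\mathrm{Index}\,E=\sum_i u_iv_i$. "$\mathrm{Index}\,E=2$" means a quasi-basis exists and $\mathrm{Index}\,E=2\cdot1$. Equivalence bimodules: An $A$-$A$-equivalence bimodule $X$ is an $A$-$A$-bimodule with left and right $A$-valued inner products ${}_A\langle\cdot,\cdot\rangle$, $\langle\cdot,\cdot\rangle_A$ making it a full left and a full right Hilbert $A$-module, each action being adjointable for the inner product on the other side, with ${}_A\langle x,y\rangle\cdot z=x\cdot\langle y,z\rangle_A$. It is involutive if equipped with a conjugate linear map $x\mapsto x^\sharp$ with $(x^\sharp)^\sharp=x$, $(a\cdot x\cdot b)^\sharp=b^*\cdot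 x^\sharp\cdot a^*$, ${}_A\langle x,y^\sharp\rangle=\langle x^\sharp,y\rangle_A$. Equivalence relations: $(B,E)\sim(B_1,E_1)$ iff there is a $*$-isomorphism $\pi:B\to B_1$ with $\pi|_A=\mathrm{id}$ and $E_1\circ\pi=E$. $X\sim Y$ iff there is a bijective bimodule map $\rho:X\to Y$ preserving both inner products with $\rho(x^\sharp)=\rho(x)^\sharp$. Classes are denoted $[B,E]$ and $[X]$. Construction of $X_B$: For $(B,E)\in\mathcal{L}$, let $B$ act by left multiplication on the right Hilbert $A$-module $B$ with $\langle x,y\rangle=E(x^*y)$, let $e_A$ be the operator $e_A(x)=E(x)$, and let $C^*\langle B,e_A\rangle$ be the $C^*$-algebra generated by $B$ and $e_A$ (it is the linear span of $\{be_Ac:b,c\in B\}$). There is a unique automorphism $\widehat\beta$ of $C^*\langle B,e_A\rangle$ with $\widehat\beta(b)=b$ for $b\in B$ and $\widehat\beta(e_A)=1-e_A$. The maps $a\mapsto ae_A$, $a\mapsto a(1-e_A)$ are isomorphisms of $A$ onto $e_AC^*\langle B,e_A\rangle e_A$ and $(1-e_A)C^*\langle B,e_A\rangle(1-e_A)$. Put $X_B=e_AC^*\langle B,e_A\rangle(1-e_A)$ with $a\cdot x\cdot b=axb$, ${}_A\langle x,y\rangle$ the unique $c\in A$ with $ce_A=xy^*$, $\langle x,y\rangle_A$ the unique $c\in A$ with $c(1-e_A)=x^*y$, and $x^\sharp=\widehat\beta(x^* )$. Then $X_B\in\mathcal{M}$. Construction of $(B_X,E_X)$: For $X\in\mathcal{M}$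 let $\widetilde X=\{\widetilde x:x\in X\}$ be the dual bimodule ($\widetilde x+\widetilde y=\widetilde{x+y}$, $\lambda\widetilde x=\widetilde{\bar\lambda x}$, $b\cdot\widetilde x\cdot a=\widetilde{a^*\cdot x\cdot b^*}$). The linking algebra $L$ consists of the matrices $\begin{bmatrix}a&x\\ \widetilde y&b\end{bmatrix}$ ($a,b\in A$, $x,y\in X$) with product $\begin{bmatrix}a&x\\ \widetilde y&b\end{bmatrix}\begin{bmatrix}a'&x'\\ \widetilde{y'}&b'\end{bmatrix}=\begin{bmatrix}aa'+{}_A\langle x,y'\rangle&a\cdot x'+x\cdot b'\\ \widetilde y\cdot a'+b\cdot\widetilde{y'}&\langle y,x'\rangle_A+bb'\end{bmatrix}$, adjoint $\begin{bmatrix}a&x\\ \widetilde y&b\end{bmatrix}^*=\begin{bmatrix}a^*&y\\ \widetilde x&b^*\end{bmatrix}$, and the operator norm from its action on the right Hilbert $A$-module $X\oplus A$; it is a $C^*$-algebra. Put $B_X=\left\{\begin{bmatrix}a&x\\ \widetilde{x^\sharp}&a\end{bmatrix}:a\in A,\ x\in X\right\}$, a $C^*$-subalgebra of $L$, identify $a\in A$ with $\begin{bmatrix}a&0\\0&a\end{bmatrix}$, and let $E_X\left(\begin{bmatrix}a&x\\ \widetilde{x^\sharp}&a\end{bmatrix}\right)=\begin{bmatrix}a&0\\0&a\end{bmatrix}$. Then $(B_X,E_X)\in\mathcal{L}$. The maps $\mathcal{F}$ and $\mathcal{G}$ are well-defined. *)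

theory Defs
  imports Complex_Main "HOL-Algebra.Module" "HOL-Algebra.QuotRing"
begin

section \<open>Unital $C^*$-algebras\<close>

text \<open>
  Complex vector spaces are \<^term>\<open>module\<close>s over the complex numbers, viewed as a ring record.
  As usual in HOL-Algebra, the multiplication and the unit that a module record inherits from
  the ring record carry no meaning for structures that are only modules.
\<close>

definition complex_ring :: "complex ring" where
  "complex_ring = \<lparr>carrier = UNIV, mult = (*), one = 1, zero = 0, add = (+)\<rparr>"

record 'b cstar = "(complex, 'b) module" +
  star :: "'b \<Rightarrow> 'b"
  cnorm :: "'b \<Rightarrow> real"

definition cauchy_complete :: "'v set \<Rightarrow> ('v \<Rightarrow> 'v \<Rightarrow> real) \<Rightarrow> bool" where
  "cauchy_complete S d \<longleftrightarrow>
     (\<forall>f :: nat \<Rightarrow> 'v. (\<forall>n. f n \<in> S) \<and> (\<forall>\<epsilon>>0. \<exists>N. \<forall>m\<ge>N. \<forall>n\<ge>N. d (f m) (f n) < \<epsilon>)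
        \<longrightarrow> (\<exists>l\<in>S. (\<lambda>n. d (f n) l) \<longlonglongrightarrow> 0))"

locale unital_cstar_algebra =
  fixes A :: "('a, 'm) cstar_scheme" (structure)
  assumes is_ring: "ring A"
    and is_vector_space: "module complex_ring A"
    and smult_mult_left:
      "\<lbrakk>x \<in> carrier A; y \<in> carrier A\<rbrakk> \<Longrightarrow> (c \<odot> x) \<otimes> y = c \<odot> (x \<otimes> y)"
    and smult_mult_right:
      "\<lbrakk>x \<in> carrier A; y \<in> carrier A\<rbrakk> \<Longrightarrow> x \<otimes> (c \<odot> y) = c \<odot> (x \<otimes> y)"
    and star_closed: "x \<in> carrier A \<Longrightarrow> star A x \<in> carrier A"
    and star_star: "x \<in> carrier A \<Longrightarrow> star A (star A x) = x"
    and star_add: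
      "\<lbrakk>x \<in> carrier A; y \<in> carrier A\<rbrakk> \<Longrightarrow> star A (x \<oplus> y) = star A x \<oplus> star A y"
    and star_smult: "x \<in> carrier A \<Longrightarrow> star A (c \<odot> x) = cnj c \<odot> star A x"
    and star_mult:
      "\<lbrakk>x \<in> carrier A; y \<in> carrier A\<rbrakk> \<Longrightarrow> star A (x \<otimes> y) = star A y \<otimes> star A x"
    and norm_nonneg: "x \<in> carrier A \<Longrightarrow> 0 \<le> cnorm A x"
    and norm_eq_0: "x \<in> carrier A \<Longrightarrow> cnorm A x = 0 \<longleftrightarrow> x = \<zero>"
    and norm_triangle:
      "\<lbrakk>x \<in> carrier A; y \<in> carrier A\<rbrakk> \<Longrightarrow> cnorm A (x \<oplus> y) \<le> cnorm A x + cnorm A y"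
    and norm_smult: "x \<in> carrier A \<Longrightarrow> cnorm A (c \<odot> x) = cmod c * cnorm A x"
    and norm_mult:
      "\<lbrakk>x \<in> carrier A; y \<in> carrier A\<rbrakk> \<Longrightarrow> cnorm A (x \<otimes> y) \<le> cnorm A x * cnorm A y"
    and norm_cstar: "x \<in> carrier A \<Longrightarrow> cnorm A (star A x \<otimes> x) = (cnorm A x)\<^sup>2"
    and complete: "cauchy_complete (carrier A) (\<lambda>x y. cnorm A (x \<ominus> y))"

definition cpositive :: "('a, 'm) cstar_scheme \<Rightarrow> 'a \<Rightarrow> bool" where
  "cpositive A a \<longleftrightarrow> (\<exists>b\<in>carrier A. a = star A b \<otimes>\<^bsub>A\<^esub> b)"

definition star_hom :: "('a, 'm) cstar_scheme \<Rightarrow> ('b, 'n) cstar_scheme \<Rightarrow> ('a \<Rightarrow> 'b) \<Rightarrow> bool" where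
  "star_hom A B h \<longleftrightarrow> h \<in> ring_hom A B
     \<and> (\<forall>c. \<forall>x\<in>carrier A. h (c \<odot>\<^bsub>A\<^esub> x) = c \<odot>\<^bsub>B\<^esub> h x)
     \<and> (\<forall>x\<in>carrier A. h (star A x) = star B (h x))"

definition star_iso :: "('a, 'm) cstar_scheme \<Rightarrow> ('b, 'n) cstar_scheme \<Rightarrow> ('a \<Rightarrow> 'b) \<Rightarrow> bool" where
  "star_iso A B h \<longleftrightarrow> star_hom A B h \<and> bij_betw h (carrier A) (carrier B)"

definition complex_span :: "(complex, 'v, 'm) module_scheme \<Rightarrow> 'v set \<Rightarrow> 'v set" where
  "complex_span V S = \<Inter>{H. submodule H complex_ring V \<and> S \<subseteq> H}"

definition cstar_subalgebra :: "'b set \<Rightarrow> ('b, 'm) cstar_scheme \<Rightarrow> bool" where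
  "cstar_subalgebra H B \<longleftrightarrow> submodule H complex_ring B
     \<and> (\<forall>x\<in>H. \<forall>y\<in>H. x \<otimes>\<^bsub>B\<^esub> y \<in> H)
     \<and> (\<forall>x\<in>H. star B x \<in> H)
     \<and> (\<forall>x\<in>carrier B. (\<forall>\<epsilon>>0. \<exists>y\<in>H. cnorm B (x \<ominus>\<^bsub>B\<^esub> y) < \<epsilon>) \<longrightarrow> x \<in> H)"

definition generated_cstar :: "'b cstar \<Rightarrow> 'b set \<Rightarrow> 'b cstar" where
  "generated_cstar B S = B\<lparr>carrier := \<Inter>{H. cstar_subalgebra H B \<and> S \<subseteq> H}\<rparr>"


section \<open>Hilbert modules and their adjointable operators\<close>

record ('a, 'x) right_inner_module = "(complex, 'x) module" +
  ract :: "'x \<Rightarrow> 'a \<Rightarrow> 'x"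
  rinner :: "'x \<Rightarrow> 'x \<Rightarrow> 'a"

definition hnorm :: "'a cstar \<Rightarrow> ('a, 'x, 'm) right_inner_module_scheme \<Rightarrow> 'x \<Rightarrow> real" where
  "hnorm A Y x = sqrt (cnorm A (rinner Y x x))"

locale right_hilbert_module =
  fixes A :: "'a cstar" (structure) and Y :: "('a, 'x, 'm) right_inner_module_scheme"
  assumes is_vector_space: "module complex_ring Y"
    and ract_closed: "\<lbrakk>x \<in> carrier Y; a \<in> carrier A\<rbrakk> \<Longrightarrow> ract Y x a \<in> carrier Y"
    and ract_add_left: "\<lbrakk>x \<in> carrier Y; y \<in> carrier Y; a \<in> carrier A\<rbrakk>
      \<Longrightarrow> ract Y (x \<oplus>\<^bsub>Y\<^esub> y) a = ract Y x a \<oplus>\<^bsub>Y\<^esub> ract Y y a"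
    and ract_add_right: "\<lbrakk>x \<in> carrier Y; a \<in> carrier A; b \<in> carrier A\<rbrakk>
      \<Longrightarrow> ract Y x (a \<oplus> b) = ract Y x a \<oplus>\<^bsub>Y\<^esub> ract Y x b"
    and ract_smult_left: "\<lbrakk>x \<in> carrier Y; a \<in> carrier A\<rbrakk>
      \<Longrightarrow> ract Y (c \<odot>\<^bsub>Y\<^esub> x) a = c \<odot>\<^bsub>Y\<^esub> ract Y x a"
    and ract_smult_right: "\<lbrakk>x \<in> carrier Y; a \<in> carrier A\<rbrakk>
      \<Longrightarrow> ract Y x (c \<odot> a) = c \<odot>\<^bsub>Y\<^esub> ract Y x a"
    and ract_mult: "\<lbrakk>x \<in> carrier Y; a \<in> carrier A; b \<in> carrier A\<rbrakk>
      \<Longrightarrow> ract Y x (a \<otimes> b) = ract Y (ract Y x a) b"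
    and ract_one: "x \<in> carrier Y \<Longrightarrow> ract Y x \<one> = x"
    and rinner_closed: "\<lbrakk>x \<in> carrier Y; y \<in> carrier Y\<rbrakk> \<Longrightarrow> rinner Y x y \<in> carrier A"
    and rinner_add: "\<lbrakk>x \<in> carrier Y; y \<in> carrier Y; z \<in> carrier Y\<rbrakk>
      \<Longrightarrow> rinner Y x (y \<oplus>\<^bsub>Y\<^esub> z) = rinner Y x y \<oplus> rinner Y x z"
    and rinner_smult: "\<lbrakk>x \<in> carrier Y; y \<in> carrier Y\<rbrakk>
      \<Longrightarrow> rinner Y x (c \<odot>\<^bsub>Y\<^esub> y) = c \<odot> rinner Y x y"
    and rinner_ract: "\<lbrakk>x \<in> carrier Y; y \<in> carrier Y; a \<in> carrier A\<rbrakk>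
      \<Longrightarrow> rinner Y x (ract Y y a) = rinner Y x y \<otimes> a"
    and rinner_star: "\<lbrakk>x \<in> carrier Y; y \<in> carrier Y\<rbrakk>
      \<Longrightarrow> star A (rinner Y x y) = rinner Y y x"
    and rinner_positive: "x \<in> carrier Y \<Longrightarrow> cpositive A (rinner Y x x)"
    and rinner_definite: "x \<in> carrier Y \<Longrightarrow> rinner Y x x = \<zero> \<Longrightarrow> x = \<zero>\<^bsub>Y\<^esub>"
    and rcomplete: "cauchy_complete (carrier Y) (\<lambda>x y. hnorm A Y (x \<ominus>\<^bsub>Y\<^esub> y))"

definition op_norm ::
    "'a cstar \<Rightarrow> ('a, 'x, 'm) right_inner_module_scheme \<Rightarrow> ('x \<Rightarrow> 'x) \<Rightarrow> real" where
  "op_norm A Y T = Sup {hnorm A Y (T x) |x. x \<in> carrier Y \<and> hnorm A Y x \<le> 1}"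

definition is_adjoint ::
    "('a, 'x, 'm) right_inner_module_scheme \<Rightarrow> ('x \<Rightarrow> 'x) \<Rightarrow> ('x \<Rightarrow> 'x) \<Rightarrow> bool" where
  "is_adjoint Y T S \<longleftrightarrow> S \<in> carrier Y \<rightarrow>\<^sub>E carrier Y
     \<and> (\<forall>x\<in>carrier Y. \<forall>y\<in>carrier Y. rinner Y (T x) y = rinner Y x (S y))"

text \<open>
  Operators are extensional functions (equal to
  \<^term>\<open>undefined\<close> outside the module), so that equality of operators is equality of functions.
  Linearity over the complex numbers and over \<open>A\<close> follows from adjointability.
\<close>

definition adjointable_algebra ::
    "'a cstar \<Rightarrow> ('a, 'x, 'm) right_inner_module_scheme \<Rightarrow> ('x \<Rightarrow> 'x) cstar" where
  "adjointable_algebra A Y =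
     \<lparr>carrier = {T \<in> carrier Y \<rightarrow>\<^sub>E carrier Y. \<exists>S. is_adjoint Y T S},
      mult = compose (carrier Y),
      one = (\<lambda>x\<in>carrier Y. x),
      zero = (\<lambda>x\<in>carrier Y. \<zero>\<^bsub>Y\<^esub>),
      add = (\<lambda>S T. \<lambda>x\<in>carrier Y. S x \<oplus>\<^bsub>Y\<^esub> T x),
      smult = (\<lambda>c T. \<lambda>x\<in>carrier Y. c \<odot>\<^bsub>Y\<^esub> T x),
      star = (\<lambda>T. THE S. is_adjoint Y T S),
      cnorm = op_norm A Y\<rparr>"


section \<open>Involutive equivalence bimodules\<close>

record ('a, 'x) inv_bimodule = "('a, 'x) right_inner_module" +
  lact :: "'a \<Rightarrow> 'x \<Rightarrow> 'x"
  linner :: "'x \<Rightarrow> 'x \<Rightarrow> 'a"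
  sharp :: "'x \<Rightarrow> 'x"

locale left_hilbert_module =
  fixes A :: "'a cstar" (structure) and X :: "('a, 'x, 'm) inv_bimodule_scheme"
  assumes is_vector_space: "module complex_ring X"
    and lact_closed: "\<lbrakk>a \<in> carrier A; x \<in> carrier X\<rbrakk> \<Longrightarrow> lact X a x \<in> carrier X"
    and lact_add_right: "\<lbrakk>a \<in> carrier A; x \<in> carrier X; y \<in> carrier X\<rbrakk>
      \<Longrightarrow> lact X a (x \<oplus>\<^bsub>X\<^esub> y) = lact X a x \<oplus>\<^bsub>X\<^esub> lact X a y"
    and lact_add_left: "\<lbrakk>a \<in> carrier A; b \<in> carrier A; x \<in> carrier X\<rbrakk>
      \<Longrightarrow> lact X (a \<oplus> b) x = lact X a x \<oplus>\<^bsub>X\<^esub> lact X b x"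
    and lact_smult_right: "\<lbrakk>a \<in> carrier A; x \<in> carrier X\<rbrakk>
      \<Longrightarrow> lact X a (c \<odot>\<^bsub>X\<^esub> x) = c \<odot>\<^bsub>X\<^esub> lact X a x"
    and lact_smult_left: "\<lbrakk>a \<in> carrier A; x \<in> carrier X\<rbrakk>
      \<Longrightarrow> lact X (c \<odot> a) x = c \<odot>\<^bsub>X\<^esub> lact X a x"
    and lact_mult: "\<lbrakk>a \<in> carrier A; b \<in> carrier A; x \<in> carrier X\<rbrakk>
      \<Longrightarrow> lact X (a \<otimes> b) x = lact X a (lact X b x)"
    and lact_one: "x \<in> carrier X \<Longrightarrow> lact X \<one> x = x"
    and linner_closed: "\<lbrakk>x \<in> carrier X; y \<in> carrier X\<rbrakk> \<Longrightarrow> linner X x y \<in> carrier A"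
    and linner_add: "\<lbrakk>x \<in> carrier X; y \<in> carrier X; z \<in> carrier X\<rbrakk>
      \<Longrightarrow> linner X (x \<oplus>\<^bsub>X\<^esub> y) z = linner X x z \<oplus> linner X y z"
    and linner_smult: "\<lbrakk>x \<in> carrier X; y \<in> carrier X\<rbrakk>
      \<Longrightarrow> linner X (c \<odot>\<^bsub>X\<^esub> x) y = c \<odot> linner X x y"
    and linner_lact: "\<lbrakk>a \<in> carrier A; x \<in> carrier X; y \<in> carrier X\<rbrakk>
      \<Longrightarrow> linner X (lact X a x) y = a \<otimes> linner X x y"
    and linner_star: "\<lbrakk>x \<in> carrier X; y \<in> carrier X\<rbrakk>
      \<Longrightarrow> star A (linner X x y) = linner X y x"
    and linner_positive: "x \<in> carrier X \<Longrightarrow> cpositive A (linner X x x)"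
    and linner_definite: "x \<in> carrier X \<Longrightarrow> linner X x x = \<zero> \<Longrightarrow> x = \<zero>\<^bsub>X\<^esub>"
    and lcomplete: "cauchy_complete (carrier X)
      (\<lambda>x y. sqrt (cnorm A (linner X (x \<ominus>\<^bsub>X\<^esub> y) (x \<ominus>\<^bsub>X\<^esub> y))))"

definition dense_span :: "'a cstar \<Rightarrow> 'a set \<Rightarrow> bool" where
  "dense_span A S \<longleftrightarrow>
     (\<forall>a\<in>carrier A. \<forall>\<epsilon>>0. \<exists>s\<in>complex_span A S. cnorm A (a \<ominus>\<^bsub>A\<^esub> s) < \<epsilon>)"

locale equivalence_bimodule =
  left_hilbert_module A X + right_hilbert_module A X
  for A :: "'a cstar" (structure) and X :: "('a, 'x, 'm) inv_bimodule_scheme" +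
  assumes lact_ract: "\<lbrakk>a \<in> carrier A; x \<in> carrier X; b \<in> carrier A\<rbrakk>
      \<Longrightarrow> ract X (lact X a x) b = lact X a (ract X x b)"
    and left_full: "dense_span A {linner X x y |x y. x \<in> carrier X \<and> y \<in> carrier X}"
    and right_full: "dense_span A {rinner X x y |x y. x \<in> carrier X \<and> y \<in> carrier X}"
    and lact_adjoint: "\<lbrakk>a \<in> carrier A; x \<in> carrier X; y \<in> carrier X\<rbrakk>
      \<Longrightarrow> rinner X (lact X a x) y = rinner X x (lact X (star A a) y)"
    and ract_adjoint: "\<lbrakk>a \<in> carrier A; x \<in> carrier X; y \<in> carrier X\<rbrakk>
      \<Longrightarrow> linner X (ract X x a) y = linner X x (ract X y (star A a))"
    and imprimitivity: "\<lbrakk>x \<in> carrier X; y \<in> carrier X; z \<in> carrier X\<rbrakk>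
      \<Longrightarrow> lact X (linner X x y) z = ract X x (rinner X y z)"

locale involutive_equivalence_bimodule = equivalence_bimodule A X
  for A :: "'a cstar" (structure) and X :: "('a, 'x, 'm) inv_bimodule_scheme" +
  assumes sharp_closed: "x \<in> carrier X \<Longrightarrow> sharp X x \<in> carrier X"
    and sharp_add: "\<lbrakk>x \<in> carrier X; y \<in> carrier X\<rbrakk>
      \<Longrightarrow> sharp X (x \<oplus>\<^bsub>X\<^esub> y) = sharp X x \<oplus>\<^bsub>X\<^esub> sharp X y"
    and sharp_smult: "x \<in> carrier X \<Longrightarrow> sharp X (c \<odot>\<^bsub>X\<^esub> x) = cnj c \<odot>\<^bsub>X\<^esub> sharp X x"
    and sharp_sharp: "x \<in> carrier X \<Longrightarrow> sharp X (sharp X x) = x"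
    and sharp_act: "\<lbrakk>a \<in> carrier A; x \<in> carrier X; b \<in> carrier A\<rbrakk>
      \<Longrightarrow> sharp X (ract X (lact X a x) b) = ract X (lact X (star A b) (sharp X x)) (star A a)"
    and sharp_inner: "\<lbrakk>x \<in> carrier X; y \<in> carrier X\<rbrakk>
      \<Longrightarrow> linner X x (sharp X y) = rinner X (sharp X x) y"

definition bimodule_equiv :: "'a cstar \<Rightarrow> ('a, 'x) inv_bimodule \<Rightarrow> ('a, 'y) inv_bimodule \<Rightarrow> bool" where
  "bimodule_equiv A X Y \<longleftrightarrow>
     (\<exists>\<rho>. bij_betw \<rho> (carrier X) (carrier Y)
       \<and> (\<forall>x\<in>carrier X. \<forall>y\<in>carrier X. \<rho> (x \<oplus>\<^bsub>X\<^esub> y) = \<rho> x \<oplus>\<^bsub>Y\<^esub> \<rho> y)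
       \<and> (\<forall>c. \<forall>x\<in>carrier X. \<rho> (c \<odot>\<^bsub>X\<^esub> x) = c \<odot>\<^bsub>Y\<^esub> \<rho> x)
       \<and> (\<forall>a\<in>carrier A. \<forall>x\<in>carrier X. \<rho> (lact X a x) = lact Y a (\<rho> x))
       \<and> (\<forall>a\<in>carrier A. \<forall>x\<in>carrier X. \<rho> (ract X x a) = ract Y (\<rho> x) a)
       \<and> (\<forall>x\<in>carrier X. \<forall>y\<in>carrier X. linner Y (\<rho> x) (\<rho> y) = linner X x y)
       \<and> (\<forall>x\<in>carrier X. \<forall>y\<in>carrier X. rinner Y (\<rho> x) (\<rho> y) = rinner X x y)
       \<and> (\<forall>x\<in>carrier X. \<rho> (sharp X x) = sharp Y (\<rho> x)))"


section \<open>Extensions with a conditional expectation of index 2\<close>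

text \<open>
  The inclusion of \<open>A\<close> into \<open>B\<close> is recorded as an isometric unital embedding \<^term>\<open>incl\<close>, and the
  expectation as a map \<^term>\<open>expec\<close> from \<open>B\<close> to \<open>A\<close> itself; the conditional expectation as a
  map of \<open>B\<close> onto the copy of \<open>A\<close> in it is
  \<open>incl P \<circ> expec P\<close>.
\<close>

record ('a, 'b) extension =
  alg :: "'b cstar"
  incl :: "'a \<Rightarrow> 'b"
  expec :: "'b \<Rightarrow> 'a"

definition cond_expectation :: "'a cstar \<Rightarrow> ('a, 'b) extension \<Rightarrow> bool" where
  "cond_expectation A P \<longleftrightarrow> (let B = alg P; \<iota> = incl P; E = expec P in
       E \<in> carrier B \<rightarrow> carrier A
     \<and> (\<forall>x\<in>carrier B. \<forall>y\<in>carrier B. E (x \<oplus>\<^bsub>B\<^esub> y) = E x \<oplus>\<^bsub>A\<^esub> E y)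
     \<and> (\<forall>c. \<forall>x\<in>carrier B. E (c \<odot>\<^bsub>B\<^esub> x) = c \<odot>\<^bsub>A\<^esub> E x)
     \<and> (\<forall>a\<in>carrier A. E (\<iota> a) = a)
     \<and> (\<forall>a\<in>carrier A. \<forall>x\<in>carrier B. E (\<iota> a \<otimes>\<^bsub>B\<^esub> x) = a \<otimes>\<^bsub>A\<^esub> E x)
     \<and> (\<forall>a\<in>carrier A. \<forall>x\<in>carrier B. E (x \<otimes>\<^bsub>B\<^esub> \<iota> a) = E x \<otimes>\<^bsub>A\<^esub> a)
     \<and> (\<forall>x\<in>carrier B. cpositive B x \<longrightarrow> cpositive A (E x)))"

definition quasi_basis ::
    "('a, 'b) extension \<Rightarrow> nat \<Rightarrow> (nat \<Rightarrow> 'b) \<Rightarrow> (nat \<Rightarrow> 'b) \<Rightarrow> bool" where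
  "quasi_basis P n u v \<longleftrightarrow> (let B = alg P; E = incl P \<circ> expec P in
       u \<in> {..<n} \<rightarrow> carrier B \<and> v \<in> {..<n} \<rightarrow> carrier B
     \<and> (\<forall>x\<in>carrier B.
           x = (\<Oplus>\<^bsub>B\<^esub>i\<in>{..<n}. u i \<otimes>\<^bsub>B\<^esub> E (v i \<otimes>\<^bsub>B\<^esub> x))
         \<and> x = (\<Oplus>\<^bsub>B\<^esub>i\<in>{..<n}. E (x \<otimes>\<^bsub>B\<^esub> u i) \<otimes>\<^bsub>B\<^esub> v i)))"

definition has_index :: "('a, 'b) extension \<Rightarrow> 'b \<Rightarrow> bool" where
  "has_index P z \<longleftrightarrow>
     (\<exists>n u v. quasi_basis P n u v \<and> z = (\<Oplus>\<^bsub>alg P\<^esub>i\<in>{..<n}. u i \<otimes>\<^bsub>alg P\<^esub> v i))"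

definition index2_extensions :: "'a cstar \<Rightarrow> ('a, 'b) extension set" where
  "index2_extensions A =
     {P. unital_cstar_algebra (alg P)
       \<and> star_hom A (alg P) (incl P) \<and> inj_on (incl P) (carrier A)
       \<and> (\<forall>a\<in>carrier A. cnorm (alg P) (incl P a) = cnorm A a)
       \<and> cond_expectation A P
       \<and> has_index P (2 \<odot>\<^bsub>alg P\<^esub> \<one>\<^bsub>alg P\<^esub>)}"

definition inv_equiv_bimodules :: "'a cstar \<Rightarrow> ('a, 'x) inv_bimodule set" where
  "inv_equiv_bimodules A = {X. involutive_equivalence_bimodule A X}"

definition extension_equiv :: "'a cstar \<Rightarrow> ('a, 'b) extension \<Rightarrow> ('a, 'c) extension \<Rightarrow> bool" where
  "extension_equiv A P Q \<longleftrightarrow>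
     (\<exists>\<pi>. star_iso (alg P) (alg Q) \<pi>
       \<and> (\<forall>a\<in>carrier A. \<pi> (incl P a) = incl Q a)
       \<and> (\<forall>b\<in>carrier (alg P). expec Q (\<pi> b) = expec P b))"

definition extension_rel :: "'a cstar \<Rightarrow> (('a, 'b) extension \<times> ('a, 'b) extension) set" where
  "extension_rel A =
     {(P, Q). P \<in> index2_extensions A \<and> Q \<in> index2_extensions A \<and> extension_equiv A P Q}"


section \<open>The bimodule of an extension\<close>

definition extension_module :: "('a, 'b) extension \<Rightarrow> ('a, 'b) right_inner_module" where
  "extension_module P = (let B = alg P in
     \<lparr>carrier = carrier B, mult = mult B, one = \<one>\<^bsub>B\<^esub>, zero = \<zero>\<^bsub>B\<^esub>, add = add B,
      smult = smult B,
      ract = (\<lambda>x a. x \<otimes>\<^bsub>B\<^esub> incl P a),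
      rinner = (\<lambda>x y. expec P (star B x \<otimes>\<^bsub>B\<^esub> y))\<rparr>)"

definition left_mult :: "('a, 'b) extension \<Rightarrow> 'b \<Rightarrow> ('b \<Rightarrow> 'b)" where
  "left_mult P b = (\<lambda>x\<in>carrier (alg P). b \<otimes>\<^bsub>alg P\<^esub> x)"

definition jones_proj :: "('a, 'b) extension \<Rightarrow> ('b \<Rightarrow> 'b)" where
  "jones_proj P = (\<lambda>x\<in>carrier (alg P). incl P (expec P x))"

definition basic_construction :: "'a cstar \<Rightarrow> ('a, 'b) extension \<Rightarrow> ('b \<Rightarrow> 'b) cstar" where
  "basic_construction A P =
     generated_cstar (adjointable_algebra A (extension_module P))
       (insert (jones_proj P) (left_mult P ` carrier (alg P)))"

definition dual_auto :: "'a cstar \<Rightarrow> ('a, 'b) extension \<Rightarrow> ('b \<Rightarrow> 'b) \<Rightarrow> ('b \<Rightarrow> 'b)" where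
  "dual_auto A P = (let C = basic_construction A P; e = jones_proj P in
     (THE \<beta>. \<beta> \<in> extensional (carrier C) \<and> star_iso C C \<beta>
        \<and> (\<forall>b\<in>carrier (alg P). \<beta> (left_mult P b) = left_mult P b)
        \<and> \<beta> e = \<one>\<^bsub>C\<^esub> \<ominus>\<^bsub>C\<^esub> e))"

definition bimodule_of :: "'a cstar \<Rightarrow> ('a, 'b) extension \<Rightarrow> ('a, 'b \<Rightarrow> 'b) inv_bimodule" where
  "bimodule_of A P =
     (let C = basic_construction A P; e = jones_proj P; f = \<one>\<^bsub>C\<^esub> \<ominus>\<^bsub>C\<^esub> e;
          emb = (\<lambda>a. left_mult P (incl P a)) in
     \<lparr>carrier = {e \<otimes>\<^bsub>C\<^esub> T \<otimes>\<^bsub>C\<^esub> f |T. T \<in> carrier C},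
      mult = mult C, one = \<one>\<^bsub>C\<^esub>, zero = \<zero>\<^bsub>C\<^esub>, add = add C, smult = smult C,
      ract = (\<lambda>x a. x \<otimes>\<^bsub>C\<^esub> emb a),
      rinner = (\<lambda>x y. THE c. c \<in> carrier A \<and> emb c \<otimes>\<^bsub>C\<^esub> f = star C x \<otimes>\<^bsub>C\<^esub> y),
      lact = (\<lambda>a x. emb a \<otimes>\<^bsub>C\<^esub> x),
      linner = (\<lambda>x y. THE c. c \<in> carrier A \<and> emb c \<otimes>\<^bsub>C\<^esub> e = x \<otimes>\<^bsub>C\<^esub> star C y),
      sharp = (\<lambda>x. dual_auto A P (star C x))\<rparr>)"


section \<open>The extension of a bimodule\<close>

datatype 'x dual = Tilde (untilde: 'x)

definition dual_add :: "('a, 'x) inv_bimodule \<Rightarrow> 'x dual \<Rightarrow> 'x dual \<Rightarrow> 'x dual" where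
  "dual_add X p q = Tilde (untilde p \<oplus>\<^bsub>X\<^esub> untilde q)"

definition dual_smult :: "('a, 'x) inv_bimodule \<Rightarrow> complex \<Rightarrow> 'x dual \<Rightarrow> 'x dual" where
  "dual_smult X c p = Tilde (cnj c \<odot>\<^bsub>X\<^esub> untilde p)"

definition dual_lact :: "'a cstar \<Rightarrow> ('a, 'x) inv_bimodule \<Rightarrow> 'a \<Rightarrow> 'x dual \<Rightarrow> 'x dual" where
  "dual_lact A X b p = Tilde (ract X (untilde p) (star A b))"

definition dual_ract :: "'a cstar \<Rightarrow> ('a, 'x) inv_bimodule \<Rightarrow> 'x dual \<Rightarrow> 'a \<Rightarrow> 'x dual" where
  "dual_ract A X p a = Tilde (lact X (star A a) (untilde p))"

datatype ('a, 'x) link = Link (ent11: 'a) (ent12: 'x) (ent21: "'x dual") (ent22: 'a)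

text \<open>The right module \<open>X \<oplus> A\<close> of columns, on which the linking algebra acts.\<close>

definition column_module :: "'a cstar \<Rightarrow> ('a, 'x) inv_bimodule \<Rightarrow> ('a, 'x \<times> 'a) right_inner_module" where
  "column_module A X =
     \<lparr>carrier = carrier X \<times> carrier A, mult = undefined, one = undefined,
      zero = (\<zero>\<^bsub>X\<^esub>, \<zero>\<^bsub>A\<^esub>),
      add = (\<lambda>(x, a) (y, b). (x \<oplus>\<^bsub>X\<^esub> y, a \<oplus>\<^bsub>A\<^esub> b)),
      smult = (\<lambda>c (x, a). (c \<odot>\<^bsub>X\<^esub> x, c \<odot>\<^bsub>A\<^esub> a)),
      ract = (\<lambda>(x, a) b. (ract X x b, a \<otimes>\<^bsub>A\<^esub> b)),
      rinner = (\<lambda>(x, a) (y, b). rinner X x y \<oplus>\<^bsub>A\<^esub> star A a \<otimes>\<^bsub>A\<^esub> b)\<rparr>"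

fun link_action :: "'a cstar \<Rightarrow> ('a, 'x) inv_bimodule \<Rightarrow> ('a, 'x) link \<Rightarrow> 'x \<times> 'a \<Rightarrow> 'x \<times> 'a" where
  "link_action A X (Link a x p b) (z, c) =
     (lact X a z \<oplus>\<^bsub>X\<^esub> ract X x c, rinner X (untilde p) z \<oplus>\<^bsub>A\<^esub> b \<otimes>\<^bsub>A\<^esub> c)"

fun link_mult :: "'a cstar \<Rightarrow> ('a, 'x) inv_bimodule \<Rightarrow> ('a, 'x) link \<Rightarrow> ('a, 'x) link \<Rightarrow> ('a, 'x) link" where
  "link_mult A X (Link a x p b) (Link a' x' p' b') =
     Link (a \<otimes>\<^bsub>A\<^esub> a' \<oplus>\<^bsub>A\<^esub> linner X x (untilde p'))
          (lact X a x' \<oplus>\<^bsub>X\<^esub> ract X x b')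
          (dual_add X (dual_ract A X p a') (dual_lact A X b p'))
          (rinner X (untilde p) x' \<oplus>\<^bsub>A\<^esub> b \<otimes>\<^bsub>A\<^esub> b')"

fun link_add :: "'a cstar \<Rightarrow> ('a, 'x) inv_bimodule \<Rightarrow> ('a, 'x) link \<Rightarrow> ('a, 'x) link \<Rightarrow> ('a, 'x) link" where
  "link_add A X (Link a x p b) (Link a' x' p' b') =
     Link (a \<oplus>\<^bsub>A\<^esub> a') (x \<oplus>\<^bsub>X\<^esub> x') (dual_add X p p') (b \<oplus>\<^bsub>A\<^esub> b')"

fun link_smult :: "'a cstar \<Rightarrow> ('a, 'x) inv_bimodule \<Rightarrow> complex \<Rightarrow> ('a, 'x) link \<Rightarrow> ('a, 'x) link" where
  "link_smult A X c (Link a x p b) =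
     Link (c \<odot>\<^bsub>A\<^esub> a) (c \<odot>\<^bsub>X\<^esub> x) (dual_smult X c p) (c \<odot>\<^bsub>A\<^esub> b)"

fun link_star :: "'a cstar \<Rightarrow> ('a, 'x) link \<Rightarrow> ('a, 'x) link" where
  "link_star A (Link a x p b) = Link (star A a) (untilde p) (Tilde x) (star A b)"

definition linking_algebra :: "'a cstar \<Rightarrow> ('a, 'x) inv_bimodule \<Rightarrow> ('a, 'x) link cstar" where
  "linking_algebra A X =
     \<lparr>carrier = {Link a x (Tilde y) b |a x y b.
                   a \<in> carrier A \<and> x \<in> carrier X \<and> y \<in> carrier X \<and> b \<in> carrier A},
      mult = link_mult A X,
      one = Link \<one>\<^bsub>A\<^esub> \<zero>\<^bsub>X\<^esub> (Tilde \<zero>\<^bsub>X\<^esub>) \<one>\<^bsub>A\<^esub>,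
      zero = Link \<zero>\<^bsub>A\<^esub> \<zero>\<^bsub>X\<^esub> (Tilde \<zero>\<^bsub>X\<^esub>) \<zero>\<^bsub>A\<^esub>,
      add = link_add A X,
      smult = link_smult A X,
      star = link_star A,
      cnorm = (\<lambda>M. op_norm A (column_module A X) (link_action A X M))\<rparr>"

definition extension_of :: "'a cstar \<Rightarrow> ('a, 'x) inv_bimodule \<Rightarrow> ('a, ('a, 'x) link) extension" where
  "extension_of A X =
     \<lparr>alg = (linking_algebra A X)
        \<lparr>carrier := {Link a x (Tilde (sharp X x)) a |a x. a \<in> carrier A \<and> x \<in> carrier X}\<rparr>,
      incl = (\<lambda>a. Link a \<zero>\<^bsub>X\<^esub> (Tilde \<zero>\<^bsub>X\<^esub>) a),
      expec = ent11\<rparr>"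


section \<open>The maps between equivalence classes\<close>

text \<open>
  A class is the set of all its members whose carrier lives in a given type. The algebra underlying
  \<^term>\<open>extension_of A X\<close> lives in a type of matrices, so its class is formed in an arbitrary type
  \<open>'b\<close> with \<^term>\<open>extension_equiv\<close>, which relates extensions over different types.
\<close>

definition extension_class :: "'a cstar \<Rightarrow> ('a, 'c) extension \<Rightarrow> ('a, 'b) extension set" where
  "extension_class A Q = {P \<in> index2_extensions A. extension_equiv A Q P}"

definition bimodule_class :: "'a cstar \<Rightarrow> ('a, 'y) inv_bimodule \<Rightarrow> ('a, 'x) inv_bimodule set" where
  "bimodule_class A Y = {X \<in> inv_equiv_bimodules A. bimodule_equiv A Y X}"

definition map_F :: "'a cstar \<Rightarrow> ('a, 'b) extension set \<Rightarrow> ('a, 'b \<Rightarrow> 'b) inv_bimodule set" where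
  "map_F A c = (\<Union>P\<in>c. bimodule_class A (bimodule_of A P))"

definition map_G :: "'a cstar \<Rightarrow> ('a, 'x) inv_bimodule set \<Rightarrow> ('a, 'b) extension set" where
  "map_G A k = (\<Union>X\<in>k. extension_class A (extension_of A X))"

end

theory Submission
  imports Defs
begin

text \<open>
  Let \<open>N\<close> be the kernel of \<open>E\<close>. Since the index is \<open>2\<close>, for \<open>b \<in> N\<close> the element
  \<open>E (b\<^sup>* b) - b\<^sup>* b\<close> equals \<open>\<Sum>i. R\<^sup>* R (u\<^sub>i) v\<^sub>i\<close> with \<open>R = (1 - e) b (1 - e)\<close>, which is positive
  because \<open>E\<close> is completely positive; as \<open>E\<close> is faithful and kills it, it vanishes. So \<open>N N \<subseteq> A\<close>,
  that is, \<open>B = A \<oplus> N\<close> is graded by the group of order two. The index gives moreover \<open>p\<^sub>i, q\<^sub>i \<in> N\<close>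
  with \<open>\<Sum>i. p\<^sub>i q\<^sub>i = 1\<close>, and \<open>T \<mapsto> (y \<mapsto> \<Sum>i. T (y p\<^sub>i) q\<^sub>i)\<close> is the dual automorphism.
  Through \<open>b \<mapsto> e b (1 - e)\<close> the bimodule \<open>X\<^sub>B\<close> becomes \<open>N\<close> with inner products \<open>E (b c\<^sup>*)\<close> and
  \<open>E (b\<^sup>* c)\<close> and involution \<open>b \<mapsto> b\<^sup>*\<close>, so sending \<open>a + b\<close> with \<open>a \<in> A\<close> and \<open>b \<in> N\<close> to the matrix
  with diagonal \<open>a\<close> and upper corner \<open>b\<close> is an isomorphism of \<open>B\<close> onto the extension of \<open>X\<^sub>B\<close>.
\<close>

text \<open>\<open>N N \<subseteq> A\<close> says that left multiplication by
  \<open>b \<in> N\<close> carries \<open>N\<close> into \<open>A\<close>, i.e. that its compression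
  \<open>R\<close> to \<open>1 - e\<close> is zero; this is why \<open>R\<close> is the operator to
  test. The map taking \<open>T\<close> to \<open>\<Sum>i. T (u\<^sub>i) v\<^sub>i\<close> is the
  dual weight \<open>b e c \<mapsto> b c\<close>, and for index \<open>k\<close> its value at
  \<open>R\<^sup>* R\<close> is \<open>(k - 3) b\<^sup>* b + E (b\<^sup>* b)\<close>. So
  \<open>k = 2\<close> is the one value for which \<open>E\<close> annihilates it whatever
  \<open>b\<close> is. The obstacle is positivity. \<open>E\<close> is only assumed to send elements
  \<open>b\<^sup>* b\<close> to elements of that form, while sums, limits, the Schwarz inequality
  and complete positivity need an order theory. It is built from norm estimates alone, with the
  growth of powers in place of the spectrum and square roots of \<open>h + \<epsilon>\<close> in
  place of those of \<open>h\<close>. This theory is phrased for a type with global operations,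
  whereas \<open>B\<close> is a carrier set; \<open>B\<close> is therefore viewed as one factor of a
  large product, in which a central projection \<open>z\<close> stands for the unit of
  \<open>B\<close>.\<close>

section \<open>Typed unital $C^*$-algebras and their positive elements\<close>

text \<open>Scalars are real; the central skew-adjoint element \<open>imag\<close> plays the
  imaginary unit, so complex linearity of a real-linear map becomes compatibility with
  \<open>imag\<close>.\<close>

class ucstar = real_normed_algebra_1 + banach +
  fixes adj :: "'a \<Rightarrow> 'a"
    and imag :: 'a
  assumes adj_adj [simp]: "adj (adj x) = x"
    and adj_add: "adj (x + y) = adj x + adj y"
    and adj_mult: "adj (x * y) = adj y * adj x"
    and adj_scaleR: "adj (r *\<^sub>R x) = r *\<^sub>R adj x"
    and norm_adj_mult: "norm (adj x * x) = (norm x)\<^sup>2"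
    and imag_central: "imag * x = x * imag"
    and imag_imag: "imag * imag = - 1"
    and adj_imag: "adj imag = - imag"

lemma adj_zero [simp]: "adj (0::'a::ucstar) = 0"
  using adj_scaleR[of 0 "0::'a"] by simp

lemma adj_minus: "adj (- x) = - adj (x::'a::ucstar)"
  using adj_scaleR[of "-1" x] by simp

lemma adj_diff: "adj (x - y :: 'a::ucstar) = adj x - adj y"
  using adj_add[of x "- y"] by (simp add: adj_minus)

lemma adj_one [simp]: "adj (1::'a::ucstar) = 1"
  by (metis adj_adj adj_mult mult_1_left mult_1_right)

lemma adj_of_real [simp]: "adj (of_real r :: 'a::ucstar) = of_real r"
  by (simp add: of_real_def adj_scaleR)

lemma adj_sum: "adj (sum f S :: 'a::ucstar) = (\<Sum>i\<in>S. adj (f i))"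
  by (induction S rule: infinite_finite_induct) (auto simp: adj_add)

lemma norm_adj [simp]: "norm (adj x) = norm (x::'a::ucstar)"
proof -
  have le: "norm y \<le> norm (adj y)" for y :: 'a
  proof (cases "norm y = 0")
    case False
    have "(norm y)\<^sup>2 \<le> norm (adj y) * norm y"
      using norm_mult_ineq[of "adj y" y] by (simp add: norm_adj_mult)
    then show ?thesis using False by (simp add: power2_eq_square mult_le_cancel_right)
  qed simp
  show ?thesis using le[of x] le[of "adj x"] by simp
qed

lemma continuous_adj: "(f \<longlongrightarrow> l) F \<Longrightarrow> ((\<lambda>x. adj (f x :: 'a::ucstar)) \<longlongrightarrow> adj l) F"
proof -
  assume "(f \<longlongrightarrow> l) F"
  then have "((\<lambda>x. f x - l) \<longlongrightarrow> 0) F" by (simp add: LIM_zero)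
  then have "((\<lambda>x. norm (f x - l)) \<longlongrightarrow> 0) F" by (rule tendsto_norm_zero)
  then have "((\<lambda>x. norm (adj (f x) - adj l)) \<longlongrightarrow> 0) F"
    by (simp flip: adj_diff)
  then show ?thesis by (metis LIM_zero_cancel tendsto_norm_zero_cancel)
qed

section \<open>Order structure defined by the norm\<close>

definition sa :: "'a::ucstar \<Rightarrow> bool" where
  "sa h \<longleftrightarrow> adj h = h"

text \<open>Positivity without a spectrum: a self-adjoint \<open>h\<close> has nonnegative spectrum
  exactly when it lies in the ball of some radius \<open>t\<close> around \<open>t\<close>. Sums of
  positive elements are then handled by the triangle inequality.\<close>

definition pos :: "'a::ucstar \<Rightarrow> bool" where
  "pos h \<longleftrightarrow> sa h \<and> (\<exists>t\<ge>0. norm (of_real t - h) \<le> t)"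

lemma sa_add: "sa x \<Longrightarrow> sa y \<Longrightarrow> sa (x + y)"
  and sa_diff: "sa x \<Longrightarrow> sa y \<Longrightarrow> sa (x - y)"
  and sa_minus: "sa x \<Longrightarrow> sa (- x)"
  and sa_scaleR: "sa x \<Longrightarrow> sa (r *\<^sub>R x)"
  and sa_of_real: "sa (of_real r)"
  and sa_one: "sa 1" and sa_zero: "sa 0"
  and sa_comm: "sa x \<Longrightarrow> sa y \<Longrightarrow> x * y = y * x \<Longrightarrow> sa (x * y)"
  and sa_square: "sa x \<Longrightarrow> sa (x * x)"
  and sa_adj_mult: "sa (adj z * z)" and sa_mult_adj: "sa (z * adj z)"
  by (simp_all add: sa_def adj_add adj_diff adj_minus adj_scaleR adj_mult)

lemma sa_power: "sa (x::'a::ucstar) \<Longrightarrow> sa (x ^ n)"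
proof (induction n)
  case (Suc n)
  then show ?case by (simp add: sa_def adj_mult power_commutes)
qed (simp add: sa_one)

lemmas sa_intros = sa_add sa_diff sa_minus sa_scaleR sa_of_real sa_one sa_zero sa_square
  sa_adj_mult sa_mult_adj sa_power

lemma norm_sa_square: "sa h \<Longrightarrow> norm (h * h) = (norm h)\<^sup>2"
  using norm_adj_mult[of h] by (simp add: sa_def)

text \<open>The $C^*$-identity gives equality at the exponents \<open>2 ^ k\<close> by repeated
  squaring. A general \<open>n\<close> is filled up to \<open>2 ^ n = n + m\<close>, and
  submultiplicativity on the factor \<open>h ^ m\<close> forces equality for \<open>h ^ n\<close>.
  Growth of powers thereby detects the norm, as the spectral radius would.\<close>

lemma norm_sa_power:
  assumes "sa (h::'a::ucstar)"
  shows "norm (h ^ n) = norm h ^ n"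
proof (rule antisym)
  show "norm (h ^ n) \<le> norm h ^ n" by (rule norm_power_ineq)
  have two: "norm (h ^ (2 ^ k)) = norm h ^ (2 ^ k)" for k
  proof (induction k)
    case (Suc k)
    have "h ^ 2 ^ Suc k = h ^ 2 ^ k * h ^ 2 ^ k"
      by (simp only: power_Suc mult_2 power_add)
    then have "norm (h ^ 2 ^ Suc k) = (norm h ^ 2 ^ k)\<^sup>2"
      using norm_sa_square[OF sa_power[OF assms]] Suc by simp
    then show ?case by (simp only: power_Suc mult_2 power_add power2_eq_square)
  qed simp
  show "norm h ^ n \<le> norm (h ^ n)"
  proof (cases "h = 0")
    case False
    define m where "m = 2 ^ n - n"
    have nm: "2 ^ n = n + m" unfolding m_def
      by (metis le_add_diff_inverse less_exp less_imp_le_nat)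
    have "norm h ^ n * norm h ^ m = norm (h ^ n * h ^ m)"
      using two[of n] by (simp add: nm power_add)
    also have "\<dots> \<le> norm (h ^ n) * norm h ^ m"
      by (rule order_trans[OF norm_mult_ineq]) (simp add: mult_left_mono norm_power_ineq)
    finally show ?thesis using False by simp
  qed (cases n; simp)
qed

text \<open>The square root is \<open>1 - y\<close> for the fixed point \<open>y\<close> of \<open>y \<mapsto> (k + y\<^sup>2) / 2\<close>, which is a
  contraction of the ball of radius \<^term>\<open>norm k\<close>.\<close>

lemma sqrt_one_minus:
  fixes k :: "'a::ucstar"
  assumes k: "sa k" and r: "norm k < 1"
  obtains s where "sa s" "s * s = 1 - k" "\<forall>c. c * k = k * c \<longrightarrow> c * s = s * c"
proof -
  define r where "r = norm k"
  have r01: "0 \<le> r" "r < 1" using r by (auto simp: r_def)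
  define y where "y = rec_nat (0::'a) (\<lambda>_ z. (1/2) *\<^sub>R (k + z * z))"
  have y0: "y 0 = 0" and yS: "\<And>n. y (Suc n) = (1/2) *\<^sub>R (k + y n * y n)"
    by (simp_all add: y_def)
  have yb: "norm (y n) \<le> r" for n
  proof (induction n)
    case (Suc n)
    have "norm (k + y n * y n) \<le> r + r * r"
      using norm_triangle_ineq[of k "y n * y n"] norm_mult_ineq[of "y n" "y n"]
        mult_mono[OF Suc Suc] by (simp add: r_def)
    also have "\<dots> \<le> 2 * r" using r01 mult_left_mono[of r 1 r] by simp
    finally show ?case by (simp add: yS)
  qed (simp add: y0 r01)
  have ysa: "sa (y n)" for n
    by (induction n) (auto simp: y0 yS intro!: sa_intros k)
  have ycom: "c * y n = y n * c" if "c * k = k * c" for c n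
  proof (induction n)
    case (Suc n)
    have "c * (y n * y n) = (y n * y n) * c"
      using Suc by (simp only: mult.assoc[symmetric]) (simp only: mult.assoc)
    then show ?case using that by (simp add: yS distrib_left distrib_right)
  qed (simp add: y0)
  have step: "norm (y (Suc n) - y n) \<le> r ^ n * r" for n
  proof (induction n)
    case 0 show ?case using yb[of 1] by (simp add: y0)
  next
    case (Suc n)
    have "y (Suc (Suc n)) - y (Suc n)
      = (1/2) *\<^sub>R (y (Suc n) * (y (Suc n) - y n) + (y (Suc n) - y n) * y n)"
    proof -
      have "y (Suc (Suc n)) - y (Suc n) = (1/2) *\<^sub>R (k + y (Suc n) * y (Suc n)) - (1/2) *\<^sub>R (k + y n * y n)"
        by (simp only: yS[of "Suc n"] yS[of n, symmetric])
      then show ?thesis by (simp add: algebra_simps)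
    qed
    also have "norm \<dots> \<le> (1/2) * (norm (y (Suc n)) * norm (y (Suc n) - y n)
         + norm (y (Suc n) - y n) * norm (y n))"
      by (simp, rule order_trans[OF norm_triangle_ineq], intro add_mono norm_mult_ineq)
    also have "\<dots> \<le> (1/2) * (r * norm (y (Suc n) - y n) + norm (y (Suc n) - y n) * r)"
      by (intro mult_left_mono add_mono mult_right_mono yb) auto
    also have "\<dots> = r * norm (y (Suc n) - y n)" by simp
    also have "\<dots> \<le> r * (r ^ n * r)" by (intro mult_left_mono Suc r01)
    finally show ?case by (simp add: mult_ac)
  qed
  have "summable (\<lambda>n. r ^ n * r)"
    using r01 by (intro summable_mult2 summable_geometric) simp
  then have "summable (\<lambda>n. y (Suc n) - y n)"
    by (rule summable_comparison_test'[of _ 0]) (use step in simp)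
  then obtain L where "(\<lambda>n. \<Sum>i<n. y (Suc i) - y i) \<longlonglongrightarrow> L"
    by (auto simp: summable_def sums_def)
  then have lim: "y \<longlonglongrightarrow> L"
    by (simp add: sum_lessThan_telescope y0)
  have "(\<lambda>n. y (Suc n)) \<longlonglongrightarrow> (1/2) *\<^sub>R (k + L * L)"
    unfolding yS by (intro tendsto_intros lim)
  then have fixp: "L = (1/2) *\<^sub>R (k + L * L)"
    using LIMSEQ_Suc[OF lim] LIMSEQ_unique by blast
  have Lsa: "sa L"
  proof -
    have "(\<lambda>n. adj (y n)) \<longlonglongrightarrow> adj L" by (rule continuous_adj[OF lim])
    then have "y \<longlonglongrightarrow> adj L" using ysa by (simp add: sa_def)
    then show ?thesis unfolding sa_def using lim by (rule LIMSEQ_unique)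
  qed
  have Lcom: "c * L = L * c" if "c * k = k * c" for c
  proof -
    have "(\<lambda>n. c * y n) \<longlonglongrightarrow> c * L" by (intro tendsto_intros lim)
    moreover have "(\<lambda>n. y n * c) \<longlonglongrightarrow> L * c" by (intro tendsto_intros lim)
    ultimately show ?thesis unfolding ycom[OF that] by (rule LIMSEQ_unique)
  qed
  have "L + L = 2 *\<^sub>R L" by (simp add: scaleR_2)
  also have "\<dots> = 2 *\<^sub>R ((1/2) *\<^sub>R (k + L * L))" using fixp by (rule arg_cong)
  finally have "k = L + L - L * L" by simp
  show ?thesis
  proof (rule that)
    show "sa (1 - L)" by (intro sa_intros Lsa)
    show "(1 - L) * (1 - L) = 1 - k" unfolding \<open>k = L + L - L * L\<close> by (simp add: algebra_simps)
    show "\<forall>c. c * k = k * c \<longrightarrow> c * (1 - L) = (1 - L) * c"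
      using Lcom by (auto simp only: ring_distribs mult_1_left mult_1_right)
  qed
qed

text \<open>If \<open>h\<^sup>2 + s\<^sup>2 = t\<^sup>2\<close> with commuting self-adjoint \<open>h\<close> and \<open>s\<close>, then \<open>(h + i s) / t\<close> is
  an isometry, and \<open>h\<close> is its real part.\<close>

lemma norm_le_of_sum_squares:
  fixes h s :: "'a::ucstar"
  assumes "sa h" "sa s" "h * s = s * h" "h * h + s * s = of_real t * of_real t" "0 \<le> t"
  shows "norm h \<le> t"
proof -
  define u where "u = h + imag * s"
  have au: "adj u = h - imag * s"
    using assms by (simp add: u_def adj_add adj_mult sa_def adj_imag imag_central)
  have "imag * s * (imag * s) = imag * (s * imag) * s" by (simp add: mult.assoc)
  also have "s * imag = imag * s" by (rule imag_central[symmetric])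
  also have "imag * (imag * s) * s = (imag * imag) * (s * s)" by (simp add: mult.assoc)
  finally have "imag * s * (imag * s) = (imag * imag) * (s * s)" .
  then have i1: "imag * s * (imag * s) = - (s * s)" by (simp add: imag_imag)
  have "h * (imag * s) = imag * s * h" using assms(3) by (metis imag_central mult.assoc)
  then have "adj u * u = of_real t * of_real t"
    using assms(4) i1 unfolding au unfolding u_def by (simp add: ring_distribs)
  then have "norm (adj u * u) = norm (of_real (t * t) :: 'a)" by simp
  then have "(norm u)\<^sup>2 = t\<^sup>2"
    by (simp only: norm_adj_mult norm_of_real abs_mult_self_eq abs_mult power2_eq_square)
  then have nu: "norm u = t" using assms(5) power2_eq_iff_nonneg[OF norm_ge_zero] by blast
  have "2 *\<^sub>R h = u + adj u" by (simp add: au) (simp add: u_def scaleR_2)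
  then have "2 * norm h = norm (u + adj u)" by (metis norm_scaleR abs_numeral)
  also have "\<dots> \<le> t + t" using norm_triangle_ineq[of u "adj u"] nu by simp
  finally show ?thesis by simp
qed

lemma sqrt_of_less:
  fixes h :: "'a::ucstar"
  assumes "sa h" "norm (of_real t - h) < t"
  obtains s where "sa s" "s * s = h" "\<forall>c. c * h = h * c \<longrightarrow> c * s = s * c"
proof -
  have t: "t > 0" using assms(2) norm_ge_zero[of "of_real t - h"] by linarith
  define k where "k = 1 - (1/t) *\<^sub>R h"
  have "k = (1/t) *\<^sub>R (of_real t - h)"
    using t by (simp add: k_def of_real_def scaleR_diff_right)
  then have nk: "norm k < 1" using t assms(2) by simp
  have "sa k" unfolding k_def by (intro sa_intros assms)
  from sqrt_one_minus[OF this nk] obtain s where s: "sa s" "s * s = 1 - k"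
    "\<forall>c. c * k = k * c \<longrightarrow> c * s = s * c" by blast
  show ?thesis
  proof (rule that[of "sqrt t *\<^sub>R s"])
    show "sa (sqrt t *\<^sub>R s)" by (intro sa_intros s)
    show "sqrt t *\<^sub>R s * sqrt t *\<^sub>R s = h" using t s(2) by (simp add: k_def)
    have "c * sqrt t *\<^sub>R s = sqrt t *\<^sub>R s * c" if "c * h = h * c" for c
    proof -
      have "c * k = k * c" using that by (simp add: k_def ring_distribs)
      then have "c * s = s * c" using s(3) by blast
      then show ?thesis by simp
    qed
    then show "\<forall>c. c * h = h * c \<longrightarrow> c * sqrt t *\<^sub>R s = sqrt t *\<^sub>R s * c" by blast
  qed
qed

lemma pos_sa: "pos h \<Longrightarrow> sa h" by (simp add: pos_def)

text \<open>The shift by \<open>\<epsilon>\<close> turns the bound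
  \<open>norm (t - h) \<le> t\<close> into a strict one, as the contraction behind the square root
  requires; users let \<open>\<epsilon>\<close> tend to zero. The commutation clause makes roots of
  commuting elements commute.\<close>

lemma pos_sqrt:
  fixes h :: "'a::ucstar"
  assumes "pos h" "\<epsilon> > 0"
  obtains s where "sa s" "s * s = h + of_real \<epsilon>" "\<forall>c. c * h = h * c \<longrightarrow> c * s = s * c"
proof -
  from assms obtain t where t: "t \<ge> 0" "norm (of_real t - h) \<le> t" "sa h" by (auto simp: pos_def)
  have "norm (of_real (t + \<epsilon>) - (h + of_real \<epsilon>)) < t + \<epsilon>" using t assms by simp
  from sqrt_of_less[OF sa_add[OF t(3) sa_of_real] this] obtain s where s: "sa s" "s * s = h + of_real \<epsilon>"
    "\<forall>c. c * (h + of_real \<epsilon>) = (h + of_real \<epsilon>) * c \<longrightarrow> c * s = s * c"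
    by blast
  show ?thesis
  proof (rule that[OF s(1,2)])
    have "c * (h + of_real \<epsilon>) = (h + of_real \<epsilon>) * c" if "c * h = h * c" for c
      using that by (simp add: ring_distribs of_real_def)
    then show "\<forall>c. c * h = h * c \<longrightarrow> c * s = s * c" using s(3) by blast
  qed
qed

text \<open>A root \<open>r\<close> of \<open>t - s * s\<close> commutes with \<open>s\<close> and
  satisfies \<open>r * r + s * s = t\<close>, so \<open>norm r \<le> sqrt t\<close> by
  \<open>norm_le_of_sum_squares\<close>.\<close>

lemma norm_minus_square_le:
  fixes s :: "'a::ucstar"
  assumes "sa s" "norm (s * s) < t"
  shows "norm (of_real t - s * s) \<le> t"
proof -
  have t: "t > 0" using assms(2) norm_ge_zero[of "s * s"] by linarith
  have "sa (of_real t - s * s)" by (intro sa_intros assms)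
  moreover have "norm (of_real t - (of_real t - s * s)) < t" using assms by simp
  note sqrt_of_less[OF calculation this]
  then obtain r where r: "sa r" "r * r = of_real t - s * s"
    "\<forall>c. c * (of_real t - s * s) = (of_real t - s * s) * c \<longrightarrow> c * r = r * c"
    by blast
  have "s * r = r * s" by (rule r(3)[rule_format]) (simp add: algebra_simps of_real_def)
  then have "norm r \<le> sqrt t"
    by (intro norm_le_of_sum_squares[of r s])
      (use r(1,2) assms(1) t in \<open>simp_all flip: of_real_mult\<close>)
  then have "(norm r)\<^sup>2 \<le> t" using t by (metis norm_ge_zero power_mono real_sqrt_pow2 less_imp_le)
  then show ?thesis using norm_sa_square[OF r(1)] r(2) by simp
qed

lemma pos_square: "sa s \<Longrightarrow> pos (s * s)"
  unfolding pos_def using norm_minus_square_le[of s "norm (s * s) + 1"]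
  by (auto intro!: sa_square exI[of _ "norm (s * s) + 1"])

text \<open>The definition of \<open>pos\<close> grants one radius; this grants every radius from
  \<open>norm h\<close> on, by applying \<open>norm_minus_square_le\<close> to a root of
  \<open>h + d\<close>. The slack \<open>d = e / 3\<close> is spent twice on the radius and once on
  removing the shift.\<close>

lemma pos_normD:
  fixes h :: "'a::ucstar"
  assumes "pos h" "norm h \<le> t"
  shows "norm (of_real t - h) \<le> t"
proof (rule field_le_epsilon)
  fix e :: real assume e: "e > 0"
  define d where "d = e / 3"
  have d: "d > 0" using e by (simp add: d_def)
  obtain s where s: "sa s" "s * s = h + of_real d" using pos_sqrt[OF assms(1) d] by blast
  have "norm (s * s) < t + 2 * d"
    using s assms(2) d norm_triangle_ineq[of h "of_real d"] by simp
  from norm_minus_square_le[OF s(1) this]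
  have 1: "norm (of_real (t + 2 * d) - (h + of_real d)) \<le> t + 2 * d" by (simp add: s)
  have "of_real t - h = (of_real (t + 2 * d) - (h + of_real d)) - of_real d"
    by (simp add: of_real_def scaleR_add_left scaleR_2 flip: scaleR_scaleR)
  then have "norm (of_real t - h) \<le> (t + 2 * d) + d"
    using norm_triangle_ineq4[of "of_real (t + 2 * d) - (h + of_real d)" "of_real d"] 1 d
    by (simp only: norm_of_real abs_of_pos)
  then show "norm (of_real t - h) \<le> t + e" by (simp add: d_def)
qed

lemma pos_add: "pos a \<Longrightarrow> pos b \<Longrightarrow> pos (a + b)"
proof -
  assume "pos a" "pos b"
  then obtain s t where *: "s \<ge> 0" "t \<ge> 0" "norm (of_real s - a) \<le> s" "norm (of_real t - b) \<le> t"
    "sa a" "sa b" by (auto simp: pos_def)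
  have "of_real (s + t) - (a + b) = (of_real s - a) + (of_real t - b)" by simp
  then have "norm (of_real (s + t) - (a + b)) \<le> norm (of_real s - a) + norm (of_real t - b)"
    by (metis norm_triangle_ineq)
  also have "\<dots> \<le> s + t" using * by simp
  finally have "norm (of_real (s + t) - (a + b)) \<le> s + t" .
  with * show ?thesis unfolding pos_def by (intro conjI exI[of _ "s + t"] sa_add) auto
qed

lemma pos_scaleR: "pos a \<Longrightarrow> r \<ge> 0 \<Longrightarrow> pos (r *\<^sub>R a)"
proof -
  assume "pos a" and r: "r \<ge> 0"
  then obtain t where *: "t \<ge> 0" "norm (of_real t - a) \<le> t" "sa a" by (auto simp: pos_def)
  have "of_real (r * t) - r *\<^sub>R a = r *\<^sub>R (of_real t - a)"
    by (simp add: of_real_def scaleR_diff_right)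
  then have "norm (of_real (r * t) - r *\<^sub>R a) \<le> r * t" using * r by (simp add: mult_left_mono del: of_real_mult)
  then show ?thesis using * r by (auto simp: pos_def simp del: of_real_mult intro!: sa_scaleR exI[of _ "r * t"])
qed

lemma pos_of_real: "r \<ge> 0 \<Longrightarrow> pos (of_real r)"
  unfolding pos_def by (auto intro!: sa_of_real exI[of _ r])

lemma pos_zero: "pos 0" using pos_of_real[of 0] by simp

lemma pos_one: "pos 1" using pos_of_real[of 1] by simp

text \<open>The radius witnessing \<open>pos g\<close> could grow along an approximating sequence;
  \<open>pos_normD\<close> replaces it by one close to \<open>norm h\<close>.\<close>

lemma pos_closed:
  fixes h :: "'a::ucstar"
  assumes "sa h" "\<And>\<epsilon>. \<epsilon> > 0 \<Longrightarrow> \<exists>g. pos g \<and> norm (g - h) \<le> \<epsilon>"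
  shows "pos h"
proof -
  have "norm (of_real (norm h) - h) \<le> norm h"
  proof (rule field_le_epsilon)
    fix e :: real assume e: "e > 0"
    obtain g where g: "pos g" "norm (g - h) \<le> e / 3" using assms(2)[of "e / 3"] e by auto
    have "norm g \<le> norm h + e / 3" using g(2) norm_triangle_ineq2[of g h] by linarith
    from pos_normD[OF g(1) this] have 1: "norm (of_real (norm h + e / 3) - g) \<le> norm h + e / 3" .
    have "of_real (norm h) - h = (of_real (norm h + e / 3) - g) + ((g - h) - of_real (e / 3))" by simp
    then have "norm (of_real (norm h) - h)
      \<le> norm (of_real (norm h + e / 3) - g) + norm ((g - h) - of_real (e / 3))"
      by (metis norm_triangle_ineq)
    moreover have "norm ((g - h) - of_real (e / 3)) \<le> e / 3 + e / 3"
      by (rule order_trans[OF norm_triangle_ineq4]) (use g e in \<open>auto simp: norm_divide intro!: add_mono\<close>)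
    ultimately show "norm (of_real (norm h) - h) \<le> norm h + e" using 1 by linarith
  qed
  then show ?thesis using assms(1) by (auto simp: pos_def intro!: exI[of _ "norm h"])
qed

lemma pos_eps:
  fixes h :: "'a::ucstar"
  assumes "\<And>\<epsilon>. \<epsilon> > 0 \<Longrightarrow> pos (h + \<epsilon> *\<^sub>R c)"
  shows "pos h"
proof (rule pos_closed)
  show sa: "sa h"
  proof -
    have "adj (h + e *\<^sub>R c) = h + e *\<^sub>R c" if "e > 0" for e
      using assms[OF that] by (auto simp: pos_def sa_def)
    \<comment> \<open>Subtracting these two instances gives \<open>adj c = c\<close>, and then
      \<open>adj h = h\<close>.\<close>
    from this[of 1] this[of 2] have "adj h + adj c = h + c" "adj h + 2 *\<^sub>R adj c = h + 2 *\<^sub>R c"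
      by (simp_all add: adj_add adj_scaleR)
    then show ?thesis unfolding sa_def scaleR_2 by (metis add.assoc add_left_cancel add_right_cancel)
  qed
  fix e :: real assume e: "e > 0"
  show "\<exists>g. pos g \<and> norm (g - h) \<le> e"
  proof (intro exI[of _ "h + (e / (norm c + 1)) *\<^sub>R c"] conjI assms)
    have c: "norm c + 1 > 0" by (simp add: add_nonneg_pos)
    then show "e / (norm c + 1) > 0" using e by simp
    show "norm (h + (e / (norm c + 1)) *\<^sub>R c - h) \<le> e" using e c by (simp add: field_simps)
  qed
qed

lemma pos_norm_minus: "sa h \<Longrightarrow> norm h \<le> t \<Longrightarrow> pos (of_real t - h)"
  using norm_ge_zero[of h] by (auto simp: pos_def intro!: sa_intros exI[of _ t] simp del: norm_ge_zero)

text \<open>For commuting roots \<open>r\<close> of \<open>t - h + e\<close> and \<open>s\<close> of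
  \<open>t + h + e\<close> the product satisfies
  \<open>h * h + (r * s) * (r * s) = (t + e) * (t + e)\<close>, so
  \<open>norm_le_of_sum_squares\<close> bounds \<open>h\<close>.\<close>

lemma norm_le_of_pos:
  fixes h :: "'a::ucstar"
  assumes "pos (of_real t - h)" "pos (of_real t + h)" "t \<ge> 0"
  shows "norm h \<le> t"
proof (rule field_le_epsilon)
  fix e :: real assume e: "e > 0"
  have hsa: "sa h"
    using sa_diff[OF pos_sa[OF assms(2)] sa_of_real[of t]] by simp
  obtain r where r: "sa r" "r * r = of_real t - h + of_real e"
    "\<forall>c. c * (of_real t - h) = (of_real t - h) * c \<longrightarrow> c * r = r * c"
    using pos_sqrt[OF assms(1) e] by blast
  obtain s where s: "sa s" "s * s = of_real t + h + of_real e"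
    "\<forall>c. c * (of_real t + h) = (of_real t + h) * c \<longrightarrow> c * s = s * c"
    using pos_sqrt[OF assms(2) e] by blast
  have hr: "h * r = r * h" by (rule r(3)[rule_format]) (simp add: algebra_simps of_real_def)
  have rs: "r * s = s * r" by (rule s(3)[rule_format]) (use hr in \<open>simp add: algebra_simps of_real_def\<close>)
  have hs: "h * s = s * h" by (rule s(3)[rule_format]) (simp add: algebra_simps of_real_def)
  have "r * s * (r * s) = (r * r) * (s * s)" using rs by (metis mult.assoc)
  also have "\<dots> = of_real (t + e) * of_real (t + e) - h * h"
    unfolding r s by (simp add: algebra_simps of_real_def)
  finally have "h * h + r * s * (r * s) = of_real (t + e) * of_real (t + e)" by simp
  moreover have "h * (r * s) = r * s * h" using hr hs by (metis mult.assoc)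
  moreover have "sa (r * s)" by (rule sa_comm[OF r(1) s(1) rs])
  ultimately show "norm h \<le> t + e"
    using hsa assms(3) e by (intro norm_le_of_sum_squares[of h "r * s"]) auto
qed

lemma pos_norm_mono:
  fixes a b :: "'a::ucstar"
  assumes "pos a" "pos (b - a)"
  shows "norm a \<le> norm b"
proof (rule norm_le_of_pos)
  have b: "sa b" using sa_add[OF pos_sa[OF assms(1)] pos_sa[OF assms(2)]] by simp
  show "pos (of_real (norm b) - a)"
    using pos_add[OF pos_norm_minus[OF b order_refl] assms(2)] by simp
  show "pos (of_real (norm b) + a)" by (intro pos_add pos_of_real assms) simp
qed simp

text \<open>Roots \<open>r\<close> and \<open>s\<close> of \<open>a + e\<close> and
  \<open>b + e\<close> commute, so \<open>(a + e) * (b + e)\<close> is the square of the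
  self-adjoint \<open>r * s\<close>; then \<open>e\<close> tends to zero.\<close>

lemma pos_comm_mult:
  fixes a b :: "'a::ucstar"
  assumes "pos a" "pos b" "a * b = b * a"
  shows "pos (a * b)"
proof -
  have "pos (a * b + e *\<^sub>R (a + b + e *\<^sub>R 1))" if e: "e > 0" for e
  proof -
    obtain r where r: "sa r" "r * r = a + of_real e" "\<forall>c. c * a = a * c \<longrightarrow> c * r = r * c"
      using pos_sqrt[OF assms(1) e] by blast
    obtain s where s: "sa s" "s * s = b + of_real e" "\<forall>c. c * b = b * c \<longrightarrow> c * s = s * c"
      using pos_sqrt[OF assms(2) e] by blast
    have "b * r = r * b" using r(3)[rule_format, of b] assms(3) by simp
    then have rs: "r * s = s * r" using s(3)[rule_format, of r] by simp
    have "pos ((r * s) * (r * s))" by (intro pos_square sa_comm r s rs)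
    also have "(r * s) * (r * s) = (r * r) * (s * s)" using rs by (metis mult.assoc)
    also have "\<dots> = a * b + e *\<^sub>R (a + b + e *\<^sub>R 1)"
      unfolding r s by (simp add: algebra_simps of_real_def)
    finally show ?thesis .
  qed
  then have e: "pos (a * b + e *\<^sub>R (a + b) + (e * e) *\<^sub>R 1)" if "e > 0" for e
    using that by (simp add: algebra_simps)
  show ?thesis
  proof (rule pos_closed)
    show "sa (a * b)" by (rule sa_comm[OF pos_sa[OF assms(1)] pos_sa[OF assms(2)] assms(3)])
    fix d :: real assume d: "d > 0"
    \<comment> \<open>The error \<open>e (a + b) + e\<^sup>2\<close> is quadratic in
      \<open>e\<close>, so closedness is applied directly; the bound \<open>e \<le> 1\<close>
      absorbs the quadratic part into the linear one.\<close>
    define e where "e = min 1 (d / (norm (a + b) + 1))"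
    have e0: "e > 0" using d by (auto simp: e_def add_nonneg_pos)
    have e1: "e * (norm (a + b) + 1) \<le> d"
    proof -
      have "norm (a + b) + 1 > 0" by (simp add: add_nonneg_pos)
      then show ?thesis by (metis e_def min.cobounded2 pos_le_divide_eq)
    qed
    have "norm (e *\<^sub>R (a + b) + (e * e) *\<^sub>R (1::'a)) \<le> e * norm (a + b) + e * e"
      by (rule order_trans[OF norm_triangle_ineq]) (use e0 in simp)
    also have "e * e \<le> e * 1" using e0 by (intro mult_left_mono) (auto simp: e_def)
    finally have "norm (e *\<^sub>R (a + b) + (e * e) *\<^sub>R (1::'a)) \<le> d" using e1 by (simp add: distrib_left)
    then show "\<exists>g. pos g \<and> norm (g - a * b) \<le> d"
      using e[OF e0] by (intro exI[of _ "a * b + e *\<^sub>R (a + b) + (e * e) *\<^sub>R 1"]) simp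
  qed
qed

lemma pos_power: "pos (a::'a::ucstar) \<Longrightarrow> pos (a ^ n)"
  by (induction n) (auto intro!: pos_comm_mult pos_one simp: power_commutes)

text \<open>The spectra of \<open>x x\<^sup>*\<close> and \<open>x\<^sup>* x\<close> agree up to \<open>0\<close>; without spectra, one compares the growth
  of the powers of \<open>\<tau> - x x\<^sup>*\<close> and \<open>\<tau> - x\<^sup>* x\<close>.\<close>

lemma pos_swap:
  fixes x :: "'a::ucstar"
  assumes "pos (x * adj x + of_real \<delta>)" "\<delta> \<ge> 0"
  shows "pos (adj x * x + of_real \<delta>)"
proof -
  \<comment> \<open>With this \<open>t\<close>, the element \<open>z\<close> below equals
    \<open>t - (adj x * x + \<delta>)\<close>, so the goal becomes
    \<open>norm z \<le> t\<close>.\<close>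
  define t where "t = norm (x * adj x) + \<delta>"
  define \<tau> where "\<tau> = t - \<delta>"
  have \<tau>: "\<tau> \<ge> 0" "\<tau> \<le> t" "t \<ge> 0" using assms(2) by (auto simp: t_def \<tau>_def)
  have "norm (x * adj x + of_real \<delta>) \<le> t"
    unfolding t_def by (rule order_trans[OF norm_triangle_ineq]) (use assms(2) in simp)
  from pos_normD[OF assms(1) this] have w: "norm (of_real \<tau> - x * adj x) \<le> t"
    by (simp add: \<tau>_def algebra_simps)
  define z where "z = of_real \<tau> - adj x * x"
  have zsa: "sa z" unfolding z_def by (intro sa_intros)
  have comm: "adj x * (of_real \<tau> - x * adj x) ^ n * x = z ^ n * (of_real \<tau> - z)" for n
  proof -
    have 1: "adj x * (of_real \<tau> - x * adj x) ^ n = z ^ n * adj x"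
    proof (induction n)
      case (Suc n)
      have *: "adj x * (of_real \<tau> - x * adj x) = z * adj x"
        by (simp add: z_def algebra_simps of_real_def)
      have "adj x * (of_real \<tau> - x * adj x) ^ Suc n
          = adj x * (of_real \<tau> - x * adj x) ^ n * (of_real \<tau> - x * adj x)"
        by (simp only: power_Suc2 mult.assoc)
      also have "\<dots> = z ^ n * (adj x * (of_real \<tau> - x * adj x))" by (simp only: Suc mult.assoc)
      also have "\<dots> = z ^ Suc n * adj x" by (simp only: * power_Suc2 mult.assoc)
      finally show ?case .
    qed simp
    show ?thesis unfolding 1 by (simp add: z_def mult.assoc)
  qed
  have "norm z \<le> t"
  proof (rule ccontr)
    assume "\<not> norm z \<le> t"
    then have zt: "norm z > t" by simp
    define K where "K = norm (adj x) * norm x"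
    have K: "K \<ge> 0" by (simp add: K_def)
    \<comment> \<open>\<open>z ^ Suc n\<close> differs from \<open>\<tau> *\<^sub>R z ^ n\<close> by
      \<open>adj x * (\<tau> - x * adj x) ^ n * x\<close>, of norm at most \<open>K * t ^ n\<close>.
      Since \<open>norm (z ^ n)\<close> equals \<open>norm z ^ n\<close>, division leaves
      \<open>norm z - \<tau> \<le> K * (t / norm z) ^ n\<close>, which tends to zero if
      \<open>norm z > t\<close>, although \<open>norm z > t \<ge> \<tau>\<close>.\<close>
    have bound: "norm z ^ Suc n \<le> \<tau> * norm z ^ n + K * t ^ n" for n
    proof -
      have "norm (z ^ n * (of_real \<tau> - z)) \<le> norm (adj x) * norm ((of_real \<tau> - x * adj x) ^ n) * norm x"
        unfolding comm[symmetric]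
        by (meson norm_mult_ineq mult_right_mono norm_ge_zero order_trans)
      also have "\<dots> \<le> norm (adj x) * t ^ n * norm x"
        by (intro mult_right_mono mult_left_mono order_trans[OF norm_power_ineq] power_mono w) auto
      finally have 1: "norm (z ^ n * (of_real \<tau> - z)) \<le> K * t ^ n" by (simp add: K_def mult_ac)
      have "z ^ Suc n = \<tau> *\<^sub>R z ^ n - z ^ n * (of_real \<tau> - z)"
        by (simp add: algebra_simps of_real_def power_commutes)
      then have "norm (z ^ Suc n) \<le> \<tau> * norm (z ^ n) + K * t ^ n"
        using norm_triangle_ineq4[of "\<tau> *\<^sub>R z ^ n" "z ^ n * (of_real \<tau> - z)"] 1 \<tau> by simp
      then show ?thesis by (simp only: norm_sa_power[OF zsa])
    qed
    define q where "q = t / norm z"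
    have z0: "norm z > 0" using zt \<tau> by linarith
    have q: "0 \<le> q" "q < 1" using zt \<tau> z0 by (auto simp: q_def)
    have "norm z - \<tau> \<le> K * q ^ n" for n
    proof -
      have "(norm z - \<tau>) * norm z ^ n \<le> K * t ^ n" using bound[of n] by (simp add: algebra_simps)
      then have "norm z - \<tau> \<le> K * t ^ n / norm z ^ n" using z0 by (simp add: pos_le_divide_eq)
      then show ?thesis by (simp add: q_def power_divide)
    qed
    moreover have "(\<lambda>n. K * q ^ n) \<longlonglongrightarrow> K * 0" using q by (intro tendsto_intros LIMSEQ_power_zero) simp
    ultimately have "norm z - \<tau> \<le> K * 0" by (intro LIMSEQ_le_const) auto
    then show False using zt \<tau> by simp
  qed
  moreover have "of_real t - (adj x * x + of_real \<delta>) = z" by (simp add: z_def \<tau>_def)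
  ultimately show ?thesis using \<tau>(3)
    by (auto simp: pos_def intro!: sa_intros exI[of _ t])
qed

text \<open>For \<open>c = b\<^sup>* b\<close> of norm at most one put \<open>g = 1 - c\<close> and \<open>x = b g\<^sup>n\<close>, so that \<open>x\<^sup>* x = (1 - g) g\<^sup>2\<^sup>n\<close>
  is at most one. As \<open>x x\<^sup>* + x\<^sup>* x\<close> is a sum of squares, \<open>x x\<^sup>* \<ge> -1\<close>, hence \<open>x\<^sup>* x \<ge> -1\<close>: this
  bounds the powers of \<open>g\<close> and forces \<open>g \<le> 1\<close>.\<close>

lemma pos_adj_mult_small:
  fixes b :: "'a::ucstar"
  assumes "norm b \<le> 1"
  shows "pos (adj b * b)"
proof -
  define c where "c = adj b * b"
  define g where "g = 1 - c"
  have csa: "sa c" unfolding c_def by (rule sa_adj_mult)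
  have nc: "norm c \<le> 1"
    unfolding c_def norm_adj_mult using assms by (simp add: power_le_one)
  have g: "pos g" using pos_norm_minus[OF csa nc] by (simp add: g_def)
  have gsa: "sa g" by (rule pos_sa[OF g])
  \<comment> \<open>\<open>(1 - g) * (1 - g ^ k)\<close> is the sum of the positive elements
    \<open>(1 - g) * (1 - g) * g ^ j\<close> for \<open>j < k\<close>; adding \<open>g\<close> to it
    gives the claim.\<close>
  have upper: "pos (1 - (1 - g) * g ^ k)" for k
  proof -
    have "pos ((1 - g) * (1 - g ^ k))"
    proof (induction k)
      case (Suc k)
      have "pos ((1 - g) * (1 - g))" by (intro pos_square sa_intros gsa)
      then have "pos ((1 - g) * (1 - g) * g ^ k)"
      proof (rule pos_comm_mult[OF _ pos_power[OF g]])
        have "(1 - g) * g ^ k = g ^ k * (1 - g)" by (simp add: algebra_simps power_commutes)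
        then show "(1 - g) * (1 - g) * g ^ k = g ^ k * ((1 - g) * (1 - g))" by (metis mult.assoc)
      qed
      from pos_add[OF Suc this] show ?case
        by (simp add: algebra_simps power_commutes)
    qed (simp add: pos_zero)
    from pos_add[OF this g] show ?thesis by (simp add: algebra_simps)
  qed
  have lower: "pos ((1 - g) * g ^ (2 * n) + 1)" for n
  proof -
    define x where "x = b * g ^ n"
    have ax: "adj x = g ^ n * adj b" using sa_power[OF gsa] by (simp add: x_def adj_mult sa_def)
    have "c * g = g * c" by (simp add: g_def algebra_simps)
    have cg: "g ^ n * c = c * g ^ n"
      using power_commuting_commutes[of g c n] \<open>c * g = g * c\<close> by simp
    have xx: "adj x * x = (1 - g) * g ^ (2 * n)"
    proof -
      have "adj x * x = g ^ n * c * g ^ n" by (simp only: ax) (simp only: x_def c_def mult.assoc)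
      also have "\<dots> = c * (g ^ n * g ^ n)" by (simp add: cg mult.assoc)
      finally show ?thesis by (simp add: g_def power_add mult_2)
    qed
    \<comment> \<open>\<open>h\<close> and \<open>k\<close> are, up to sign, twice the real and
      imaginary parts of \<open>x\<close>; hence the factor \<open>1/2\<close> in front of
      \<open>h * h + k * k\<close> below.\<close>
    define h where "h = x + adj x"
    define k where "k = imag * (x - adj x)"
    have "sa h" by (simp add: h_def sa_def adj_add add.commute)
    have "sa k" by (simp add: k_def sa_def adj_mult adj_diff adj_imag imag_central algebra_simps)
    have kk: "k * k = - ((x - adj x) * (x - adj x))"
    proof -
      define d where "d = x - adj x"
      have "imag * d * (imag * d) = imag * (d * imag) * d" by (simp add: mult.assoc)
      also have "d * imag = imag * d" by (rule imag_central[symmetric])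
      also have "imag * (imag * d) * d = imag * imag * (d * d)" by (simp add: mult.assoc)
      finally show ?thesis by (simp add: k_def d_def imag_imag)
    qed
    have "pos ((1/2) *\<^sub>R (h * h + k * k))"
      by (intro pos_scaleR pos_add pos_square \<open>sa h\<close> \<open>sa k\<close>) simp
    also have "h * h + k * k = 2 *\<^sub>R (x * adj x + adj x * x)"
      unfolding kk h_def by (simp add: algebra_simps scaleR_2)
    finally have "pos (x * adj x + adj x * x)" by simp
    from pos_add[OF this upper[of "2 * n"]] have "pos (x * adj x + of_real 1)"
      by (simp add: xx)
    from pos_swap[OF this] show ?thesis by (simp add: xx)
  qed
  have "norm g \<le> 1"
  proof (rule ccontr)
    assume "\<not> norm g \<le> 1"
    then have R: "norm g > 1" by simp
    have "norm g ^ (2 * n) * (norm g - 1) \<le> 1" for n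
    proof -
      have "pos ((1 + g ^ (2 * n)) - g ^ Suc (2 * n))"
        using lower[of n] by (simp add: algebra_simps)
      from pos_norm_mono[OF pos_power[OF g] this]
      have "norm (g ^ Suc (2 * n)) \<le> 1 + norm (g ^ (2 * n))"
        using norm_triangle_ineq[of 1 "g ^ (2 * n)"] by simp
      then show ?thesis by (simp only: norm_sa_power[OF gsa]) (simp add: algebra_simps)
    qed
    note up = this
    obtain n where "1 / (norm g - 1) < norm g ^ n" using real_arch_pow[OF R] by blast
    moreover have "norm g ^ n \<le> norm g ^ (2 * n)" using R by (intro power_increasing) auto
    ultimately have "1 / (norm g - 1) < norm g ^ (2 * n)" by linarith
    then have "1 < norm g ^ (2 * n) * (norm g - 1)" using R by (simp add: field_simps)
    then show False using up[of n] by linarith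
  qed
  then have "norm (of_real 1 - c) \<le> 1" by (simp add: g_def)
  then show ?thesis using csa unfolding pos_def c_def by (intro conjI exI[of _ 1]) auto
qed

lemma pos_adj_mult: "pos (adj b * (b::'a::ucstar))"
proof -
  define r where "r = norm b + 1"
  have r: "r > 0" by (simp add: r_def add_nonneg_pos)
  have "pos (adj ((1/r) *\<^sub>R b) * ((1/r) *\<^sub>R b))"
    by (rule pos_adj_mult_small) (use r in \<open>simp add: r_def\<close>)
  from pos_scaleR[OF this, of "r * r"] show ?thesis
    using r by (simp add: adj_scaleR)
qed

lemma pos_conj:
  fixes a c :: "'a::ucstar"
  assumes "pos a"
  shows "pos (adj c * a * c)"
proof (rule pos_eps)
  fix e :: real assume e: "e > 0"
  obtain s where s: "sa s" "s * s = a + of_real e" using pos_sqrt[OF assms e] by blast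
  have "pos (adj (s * c) * (s * c))" by (rule pos_adj_mult)
  also have "adj (s * c) * (s * c) = adj c * (s * s) * c"
    using s(1) by (simp add: adj_mult sa_def mult.assoc)
  also have "\<dots> = adj c * a * c + e *\<^sub>R (adj c * c)"
    unfolding s by (simp add: algebra_simps of_real_def)
  finally show "pos (adj c * a * c + e *\<^sub>R (adj c * c))" .
qed

text \<open>A Neumann series: \<open>h + \<epsilon> = t (1 - w)\<close> with
  \<open>norm w < 1\<close>, because \<open>pos_normD\<close> bounds the distance of
  \<open>h\<close> from \<open>norm h\<close> by \<open>norm h\<close>, which is less than
  \<open>t = norm h + \<epsilon>\<close>.\<close>

lemma pos_inverse:
  fixes h :: "'a::ucstar"
  assumes "pos h" "\<epsilon> > 0"
  obtains k where "k * (h + of_real \<epsilon>) = 1" "(h + of_real \<epsilon>) * k = 1"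
proof -
  define t where "t = norm h + \<epsilon>"
  have t: "t > 0" using assms(2) by (simp add: t_def add_nonneg_pos)
  have "norm (of_real (norm h) - h) \<le> norm h" by (rule pos_normD[OF assms(1)]) simp
  then have n: "norm (of_real t - (h + of_real \<epsilon>)) < t" using assms(2) by (simp add: t_def)
  define w where "w = (1/t) *\<^sub>R (of_real t - (h + of_real \<epsilon>))"
  have nw: "norm w < 1" using n t by (simp add: w_def)
  have hw: "h + of_real \<epsilon> = t *\<^sub>R (1 - w)"
    using t by (simp add: w_def scaleR_diff_right of_real_def)
  have sm: "summable (\<lambda>n. w ^ n)" by (rule complete_algebra_summable_geometric[OF nw])
  define S where "S = (\<Sum>n. w ^ n)"
  have "(\<lambda>n. w ^ n) sums S" using sm by (simp add: S_def summable_sums)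
  then have 1: "(\<lambda>n. w * w ^ n) sums (w * S)" "(\<lambda>n. w ^ n * w) sums (S * w)"
    by (auto intro: sums_mult sums_mult2)
  have "(\<lambda>n. w ^ Suc n) sums (S - 1)"
    using \<open>(\<lambda>n. w ^ n) sums S\<close> unfolding sums_Suc_iff[of "\<lambda>n. w ^ n"] by simp
  then have 2: "(\<lambda>n. w * w ^ n) sums (S - 1)" "(\<lambda>n. w ^ n * w) sums (S - 1)"
    by (simp_all add: power_commutes)
  have eqs: "w * S = S - 1" "S * w = S - 1"
    by (rule sums_unique2[OF 1(1) 2(1)], rule sums_unique2[OF 1(2) 2(2)])
  show ?thesis
  proof (rule that[of "(1/t) *\<^sub>R S"])
    show "(1/t) *\<^sub>R S * (h + of_real \<epsilon>) = 1" "(h + of_real \<epsilon>) * (1/t) *\<^sub>R S = 1"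
      unfolding hw using t by (simp_all add: right_diff_distrib left_diff_distrib eqs scaleR_diff_right)
  qed
qed

section \<open>Conditional expectations of index two on a typed algebra\<close>

text \<open>The subalgebra enters only as the range of the idempotent \<open>F\<close>, and the
  bimodule property is stated for values of \<open>F\<close>. \<open>F_square\<close> is positivity
  in the form that \<open>cpositive\<close> delivers.\<close>

locale expectation =
  fixes F :: "'b::ucstar \<Rightarrow> 'b"
  assumes F_add: "F (x + y) = F x + F y"
    and F_scaleR: "F (r *\<^sub>R x) = r *\<^sub>R F x"
    and F_imag: "F (imag * x) = imag * F x"
    and F_left: "F (F x * y) = F x * F y"
    and F_right: "F (x * F y) = F x * F y"
    and F_one: "F 1 = 1"
    and F_square: "\<exists>g. F (adj x * x) = adj g * g"
begin

lemma F_minus: "F (- x) = - F x"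
  using F_scaleR[of "-1" x] by simp

lemma F_diff: "F (x - y) = F x - F y"
  using F_add[of x "- y"] by (simp add: F_minus)

lemma F_of_real: "F (of_real r) = of_real r"
  using F_scaleR[of r 1] by (simp add: F_one of_real_def)

lemma F_F: "F (F x) = F x"
  using F_left[of x 1] by (simp add: F_one)

text \<open>Polarisation against the unit writes \<open>h\<close> as a difference of two squares of
  self-adjoint elements; their images have the form \<open>adj g * g\<close> and are therefore
  self-adjoint.\<close>

lemma F_sa: "sa h \<Longrightarrow> sa (F h)"
proof -
  assume h: "sa h"
  have sq: "sa (F (k * k))" if "sa k" for k
    using F_square[of k] that by (metis sa_adj_mult sa_def)
  have "h = (1/4) *\<^sub>R ((h + 1) * (h + 1) - (h - 1) * (h - 1))"
    by (simp add: algebra_simps scaleR_2[symmetric])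
  then have "F h = (1/4) *\<^sub>R (F ((h + 1) * (h + 1)) - F ((h - 1) * (h - 1)))"
    by (metis F_scaleR F_diff)
  moreover have "sa \<dots>" by (intro sa_scaleR sa_diff sq sa_intros h)
  ultimately show ?thesis by simp
qed

lemma F_adj: "F (adj x) = adj (F x)"
proof -
  define h where "h = (1/2) *\<^sub>R (x + adj x)"
  define k where "k = (1/2) *\<^sub>R (imag * (adj x - x))"
  have h: "sa h" by (simp add: h_def sa_def adj_add adj_scaleR add.commute)
  have k: "sa k"
    by (simp add: k_def sa_def adj_mult adj_diff adj_imag adj_scaleR imag_central algebra_simps)
  have ik: "imag * k = (1/2) *\<^sub>R (x - adj x)"
    by (simp add: k_def imag_imag flip: mult.assoc)
  have x: "x = h + imag * k" "adj x = h - imag * k"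
    unfolding ik h_def by (simp_all add: algebra_simps flip: scaleR_add_left)
  have "F x = F h + imag * F k" "F (adj x) = F h - imag * F k"
    by (subst x, simp add: F_add F_diff F_imag)+
  moreover have "adj (F h) = F h" "adj (F k) = F k" using F_sa h k by (auto simp: sa_def)
  ultimately show ?thesis by (simp add: adj_add adj_mult adj_imag imag_central)
qed

lemma F_pos: "pos h \<Longrightarrow> pos (F h)"
proof (rule pos_eps[of _ 1])
  fix e :: real assume "pos h" "e > 0"
  then obtain s where s: "sa s" "s * s = h + of_real e" using pos_sqrt by metis
  obtain g where "F (adj s * s) = adj g * g" using F_square by blast
  then have "F h + e *\<^sub>R 1 = adj g * g"
    using s by (simp add: sa_def F_add F_of_real) (simp add: of_real_def)
  then show "pos (F h + e *\<^sub>R 1)" by (simp add: pos_adj_mult)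
qed

lemma F_Schwarz: "pos (F (adj x * x) - adj (F x) * F x)"
proof -
  have "pos (F (adj (x - F x) * (x - F x)))" by (intro F_pos pos_adj_mult)
  also have "F (adj (x - F x) * (x - F x)) = F (adj x * x) - adj (F x) * F x"
    by (simp add: adj_diff F_diff F_add F_left F_right F_F ring_distribs flip: F_adj)
  finally show ?thesis .
qed

lemma norm_F_le: "norm (F x) \<le> norm x"
proof -
  have p: "pos (of_real ((norm x)\<^sup>2) - F (adj x * x))"
    using F_pos[OF pos_norm_minus[OF sa_adj_mult, of x "(norm x)\<^sup>2"]]
    by (simp add: norm_adj_mult F_diff F_of_real del: of_real_power)
  have "pos (of_real ((norm x)\<^sup>2) - adj (F x) * F x)"
    using pos_add[OF p F_Schwarz[of x]] by simp
  from pos_norm_mono[OF pos_adj_mult this] show ?thesis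
    by (simp add: norm_adj_mult del: of_real_power)
qed

text \<open>Gaussian elimination with the pivot \<open>F (b\<^sub>n\<^sup>* b\<^sub>n) + \<epsilon>\<close>, whose inverse is again fixed by \<open>F\<close>.\<close>

lemma completely_positive:
  "pos (\<Sum>i<n::nat. \<Sum>j<n. adj (y i) * F (adj (b i) * b j) * y j)"
proof (induction n arbitrary: b)
  case 0 show ?case by (simp add: pos_zero)
next
  case (Suc n)
  show ?case
  proof (rule pos_eps)
    fix e :: real assume e: "e > 0"
    define G where "G i j = F (adj (b i) * b j)" for i j
    have Gadj: "adj (G i j) = G j i" for i j by (simp add: G_def adj_mult flip: F_adj)
    \<comment> \<open>The summand \<open>e\<close> makes the pivot invertible. Its cost
      \<open>e *\<^sub>R (adj (y n) * y n)\<close> is exactly the perturbation that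
      \<open>pos_eps\<close> permits.\<close>
    define g where "g = G n n + of_real e"
    have posG: "pos (G n n)" unfolding G_def by (intro F_pos pos_adj_mult)
    obtain k where k: "k * g = 1" "g * k = 1"
      using pos_inverse[OF posG e] unfolding g_def by metis
    have Fg: "F g = g" by (simp add: g_def G_def F_add F_of_real F_F)
    have "F k * g = 1"
      using F_right[of k g] by (simp add: Fg k F_one)
    then have Fk: "F k = k" by (metis k(2) mult.assoc mult_1_left mult_1_right)
    have gsa: "adj g = g" by (simp add: g_def adj_add Gadj)
    define c where "c j = k * G n j" for j
    have gc: "g * c j = G n j" for j by (simp add: c_def k flip: mult.assoc)
    have cg: "adj (c i) * g = G i n" for i
      using arg_cong[OF gc[of i], of adj] by (simp add: adj_mult gsa Gadj)
    have Fc: "F (c j) = c j" for j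
      using F_left[of k "G n j"] by (simp add: c_def Fk G_def F_F)
    have Fac: "F (adj (c j)) = adj (c j)" for j by (simp add: F_adj Fc)
    \<comment> \<open>Gram-Schmidt with \<open>c j\<close> as the coefficient of \<open>b j\<close>
      along \<open>b n\<close>. The Gram matrix of the \<open>b'\<close> is the Schur complement of
      the pivot less \<open>e *\<^sub>R (adj (c i) * c j)\<close>; that loss returns below as the
      positive summand \<open>e *\<^sub>R (adj Y * Y)\<close>.\<close>
    define b' where "b' j = b j - b n * c j" for j
    have gram: "F (adj (b' i) * b' j) = G i j - adj (c i) * g * c j - e *\<^sub>R (adj (c i) * c j)" for i j
    proof -
      have 1: "F (x * c j) = F x * c j" for x using F_right[of x "c j"] by (simp add: Fc)
      have 2: "F (adj (c i) * x) = adj (c i) * F x" for x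
        using F_left[of "adj (c i)" x] by (simp add: Fac)
      have "adj (b' i) * b' j = adj (b i) * b j - adj (b i) * b n * c j - adj (c i) * (adj (b n) * b j)
          + adj (c i) * (adj (b n) * b n * c j)"
        by (simp add: b'_def adj_diff adj_mult algebra_simps)
      then have "F (adj (b' i) * b' j) = G i j - G i n * c j - adj (c i) * G n j + adj (c i) * (G n n * c j)"
        by (simp add: F_add F_diff 1 2 G_def)
      also have "G i n * c j = adj (c i) * g * c j" by (simp add: cg)
      also have "adj (c i) * G n j = adj (c i) * g * c j" by (simp add: gc[symmetric] mult.assoc)
      also have "G n n = g - of_real e" by (simp add: g_def)
      finally show ?thesis by (simp add: algebra_simps of_real_def)
    qed
    define Y where "Y = (\<Sum>j<n. c j * y j)"
    have q: "(\<Sum>i<n. \<Sum>j<n. adj (y i) * (adj (c i) * a * c j) * y j) = adj Y * a * Y" for a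
      by (simp add: Y_def adj_sum adj_mult sum_distrib_left sum_distrib_right mult.assoc) (rule sum.swap)
    have s1: "(\<Sum>i<n. adj (y i) * G i n * y n) = adj Y * g * y n"
      by (simp add: Y_def adj_sum adj_mult sum_distrib_right cg[symmetric] mult.assoc)
    have s2: "(\<Sum>j<n. adj (y n) * G n j * y j) = adj (y n) * g * Y"
      by (simp add: Y_def sum_distrib_left gc[symmetric] mult.assoc)
    have s3: "(\<Sum>i<n. \<Sum>j<n. adj (y i) * G i j * y j)
      = (\<Sum>i<n. \<Sum>j<n. adj (y i) * F (adj (b' i) * b' j) * y j) + adj Y * g * Y + e *\<^sub>R (adj Y * Y)"
    proof -
      have "adj (y i) * G i j * y j = adj (y i) * F (adj (b' i) * b' j) * y j
        + adj (y i) * (adj (c i) * g * c j) * y j + e *\<^sub>R (adj (y i) * (adj (c i) * 1 * c j) * y j)" for i j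
        unfolding gram by (simp add: algebra_simps)
      then show ?thesis using q[of g] q[of 1]
        by (simp add: sum.distrib flip: scaleR_sum_right)
    qed
    have "(\<Sum>i<Suc n. \<Sum>j<Suc n. adj (y i) * F (adj (b i) * b j) * y j) + e *\<^sub>R (adj (y n) * y n)
      = (\<Sum>i<n. \<Sum>j<n. adj (y i) * G i j * y j) + adj Y * g * y n + adj (y n) * g * Y
         + adj (y n) * g * y n"
    proof -
      have "adj (y n) * G n n * y n + e *\<^sub>R (adj (y n) * y n) = adj (y n) * g * y n"
        by (simp add: g_def algebra_simps of_real_def)
      then show ?thesis
        by (simp add: sum.distrib G_def[symmetric] s1 s2 add.assoc)
    qed
    \<comment> \<open>Completing the square: the two mixed terms and the last diagonal term join
      \<open>adj Y * g * Y\<close> to one expression in \<open>Y + y n\<close>. The induction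
      hypothesis covers the remaining double sum over the \<open>b'\<close>.\<close>
    also have "\<dots> = (\<Sum>i<n. \<Sum>j<n. adj (y i) * F (adj (b' i) * b' j) * y j)
        + adj (Y + y n) * g * (Y + y n) + e *\<^sub>R (adj Y * Y)"
      unfolding s3 by (simp add: adj_add algebra_simps)
    also have "pos \<dots>"
      unfolding g_def using e
      by (intro pos_add Suc.IH pos_conj posG pos_of_real pos_scaleR pos_adj_mult) auto
    finally show "pos ((\<Sum>i<Suc n. \<Sum>j<Suc n. adj (y i) * F (adj (b i) * b j) * y j)
      + e *\<^sub>R (adj (y n) * y n))" .
  qed
qed

end

text \<open>In the intended model the algebra is a product and the quasi-basis lives in one factor,
  with unit the central projection \<open>z\<close>. The basis identities therefore reproduce
  \<open>z * x\<close>, and the index is twice \<open>z\<close>.\<close>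

locale index_two = expectation F for F :: "'b::ucstar \<Rightarrow> 'b" +
  fixes z :: 'b and n :: nat and u v :: "nat \<Rightarrow> 'b"
  assumes z_adj: "adj z = z" and z_idem: "z * z = z" and z_central: "z * x = x * z"
    and F_z: "F z = z"
    and basis_left: "z * x = (\<Sum>i<n. u i * F (v i * x))"
    and basis_right: "z * x = (\<Sum>i<n. F (x * u i) * v i)"
    and index: "(\<Sum>i<n. u i * v i) = 2 *\<^sub>R z"
begin

text \<open>If \<open>s * s = d + e\<close> and \<open>F d = 0\<close>, the Schwarz inequality makes
  every \<open>F (v i * s)\<close> of size \<open>sqrt e\<close>. The quasi-basis rebuilds
  \<open>z * s\<close> from these finitely many values, so \<open>z * d\<close> is of order
  \<open>e\<close>.\<close>

lemma faithful:
  assumes "pos d" "F d = 0"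
  shows "z * d = 0"
proof -
  define K where "K = (\<Sum>i<n. norm (u i) * norm (v i))"
  have bound: "norm (z * d) \<le> (K\<^sup>2 + norm z) * e" if e: "e > 0" for e
  proof -
    obtain s where s: "sa s" "s * s = d + of_real e" using pos_sqrt[OF assms(1) e] by metis
    have Fs: "norm (F (v i * s)) \<le> norm (v i) * sqrt e" for i
    proof -
      have "adj (v i * s) * (v i * s) = adj s * (adj (v i) * v i) * s"
        by (simp add: adj_mult mult.assoc)
      then have p1: "pos (F (adj s * (adj (v i) * v i) * s) - adj (F (v i * s)) * F (v i * s))"
        using F_Schwarz[of "v i * s"] by simp
      have "pos (of_real ((norm (v i))\<^sup>2) - adj (v i) * v i)"
        by (rule pos_norm_minus[OF sa_adj_mult]) (simp add: norm_adj_mult)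
      from F_pos[OF pos_conj[OF this, of s]]
      have "pos (F ((norm (v i))\<^sup>2 *\<^sub>R (adj s * s)) - F (adj s * (adj (v i) * v i) * s))"
        by (simp add: algebra_simps F_diff of_real_def)
      moreover have "F ((norm (v i))\<^sup>2 *\<^sub>R (adj s * s)) = of_real ((norm (v i))\<^sup>2 * e)"
        using s assms(2) by (simp add: sa_def F_scaleR F_add F_of_real) (simp add: of_real_def)
      ultimately have "pos (of_real ((norm (v i))\<^sup>2 * e) - adj (F (v i * s)) * F (v i * s))"
        using pos_add[OF _ p1] by fastforce
      from pos_norm_mono[OF pos_adj_mult this]
      have "(norm (F (v i * s)))\<^sup>2 \<le> (norm (v i))\<^sup>2 * e"
        using e by (simp only: norm_adj_mult norm_of_real) simp
      also have "\<dots> = (norm (v i) * sqrt e)\<^sup>2" using e by (simp add: power_mult_distrib)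
      finally show ?thesis by (rule power2_le_imp_le) (use e in simp)
    qed
    have "norm (z * s) \<le> (\<Sum>i<n. norm (u i * F (v i * s)))"
      unfolding basis_left[of s] by (rule norm_sum)
    also have "\<dots> \<le> (\<Sum>i<n. norm (u i) * (norm (v i) * sqrt e))"
      by (intro sum_mono order_trans[OF norm_mult_ineq] mult_left_mono Fs) auto
    also have "\<dots> = K * sqrt e" by (simp add: K_def sum_distrib_right mult.assoc)
    finally have zs: "norm (z * s) \<le> K * sqrt e" .
    have "z * s * adj (z * s) = z * (s * s) * z"
      using s(1) by (simp add: adj_mult z_adj sa_def mult.assoc)
    also have "\<dots> = z * (d + of_real e)"
      using s(2) z_idem z_central by (metis mult.assoc)
    finally have "z * d = z * s * adj (z * s) - e *\<^sub>R z"
      by (simp add: algebra_simps of_real_def)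
    also have "norm \<dots> \<le> norm (z * s) * norm (z * s) + e * norm z"
      using norm_triangle_ineq4[of "z * s * adj (z * s)" "e *\<^sub>R z"]
        norm_mult_ineq[of "z * s" "adj (z * s)"] e by simp
    also have "norm (z * s) * norm (z * s) \<le> (K * sqrt e) * (K * sqrt e)"
      by (intro mult_mono zs order_trans[OF norm_ge_zero zs]) auto
    also have "(K * sqrt e) * (K * sqrt e) = K\<^sup>2 * e" using e by (simp add: power2_eq_square)
    finally show ?thesis by (simp add: algebra_simps)
  qed
  have "norm (z * d) \<le> 0"
  proof (rule field_le_epsilon)
    fix e :: real assume e: "e > 0"
    have K: "K\<^sup>2 + norm z + 1 > 0" by (simp add: add_nonneg_pos)
    have "norm (z * d) \<le> (K\<^sup>2 + norm z) * (e / (K\<^sup>2 + norm z + 1))"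
      using K e by (intro bound) simp
    also have "\<dots> \<le> e" using K e by (simp add: field_simps)
    finally show "norm (z * d) \<le> 0 + e" by simp
  qed
  then show ?thesis by simp
qed

text \<open>With \<open>p = 1 - F\<close>, the operator \<open>R = p b p\<close> and its adjoint \<open>R'\<close> satisfy
  \<open>\<Sum>i. R' (R (u i)) * v i = F (b\<^sup>* b) - b\<^sup>* b\<close> because the index is two, and the left side is
  positive by complete positivity of \<open>F\<close>. Faithfulness makes it vanish.\<close>

lemma adj_mult_self:
  assumes zb: "z * b = b" and Fb: "F b = 0"
  shows "F (adj b * b) = adj b * b"
proof -
  have Fab: "F (adj b) = 0" by (simp add: F_adj Fb)
  \<comment> \<open>Expanding \<open>p b p\<close> produces one more term
    \<open>F (b * F x)\<close>, which is zero because \<open>F b = 0\<close>.\<close>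
  define R where "R x = b * x - b * F x - F (b * x)" for x
  define R' where "R' x = adj b * x - adj b * F x - F (adj b * x)" for x
  have adjoint: "F (adj (R x) * y) = F (adj x * R' y)" for x y
  proof -
    have "adj (R x) * y = adj x * (adj b * y) - F (adj x) * (adj b * y) - F (adj x * adj b) * y"
      by (simp add: R_def adj_diff adj_mult left_diff_distrib mult.assoc flip: F_adj)
    moreover have "adj x * R' y = adj x * (adj b * y) - adj x * adj b * F y - adj x * F (adj b * y)"
      by (simp add: R'_def right_diff_distrib mult.assoc)
    ultimately show ?thesis by (simp add: F_diff F_left F_right)
  qed
  have w: "R' (R x) = adj b * b * x - adj b * b * F x - adj b * F (b * x) - F (adj b * b * x)
      + F (adj b * b) * F x" for x
  proof -
    have "F (R x) = 0" by (simp add: R_def F_diff F_right F_F Fb)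
    moreover have "F (adj b * R x) = F (adj b * b * x) - F (adj b * b) * F x"
      by (simp add: R_def right_diff_distrib F_diff F_right Fab flip: mult.assoc)
    ultimately show ?thesis
      by (simp add: R'_def) (simp add: R_def algebra_simps)
  qed
  \<comment> \<open>The adjoint of the right basis identity. It collapses the sum over
    \<open>i\<close> once \<open>adjoint\<close> has moved \<open>R\<close> across the inner
    product.\<close>
  have fs: "(\<Sum>i<n. adj (v i) * F (adj (u i) * x)) = z * x" for x
  proof -
    have "(\<Sum>i<n. adj (v i) * F (adj (u i) * x)) = adj (\<Sum>i<n. F (adj x * u i) * v i)"
      by (simp add: adj_sum adj_mult flip: F_adj)
    also have "\<dots> = adj (z * adj x)" by (simp add: basis_right)
    finally show ?thesis by (simp add: adj_mult z_adj z_central)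
  qed
  define d where "d = F (adj b * b) - adj b * b"
  have "pos (\<Sum>i<n. \<Sum>j<n. adj (v i) * F (adj (R (u i)) * R (u j)) * v j)"
    by (rule completely_positive)
  also have "(\<Sum>i<n. \<Sum>j<n. adj (v i) * F (adj (R (u i)) * R (u j)) * v j)
    = (\<Sum>j<n. z * R' (R (u j)) * v j)"
    unfolding adjoint by (subst sum.swap) (simp add: fs flip: sum_distrib_right)
  also have "\<dots> = z * (\<Sum>j<n. R' (R (u j)) * v j)" by (simp add: sum_distrib_left mult.assoc)
  \<comment> \<open>The five sums contribute \<open>2\<close>, \<open>-1\<close>, \<open>-1\<close>,
    \<open>-1\<close> copies of \<open>adj b * b\<close> and one copy of
    \<open>F (adj b * b)\<close>; the \<open>2\<close> is the index.\<close>
  also have "(\<Sum>j<n. R' (R (u j)) * v j) = z * d"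
  proof -
    have "(\<Sum>j<n. R' (R (u j)) * v j) = adj b * b * (\<Sum>j<n. u j * v j)
      - adj b * b * (\<Sum>j<n. F (1 * u j) * v j) - adj b * (\<Sum>j<n. F (b * u j) * v j)
      - (\<Sum>j<n. F (adj b * b * u j) * v j) + F (adj b * b) * (\<Sum>j<n. F (1 * u j) * v j)"
      unfolding w by (simp add: ring_distribs sum.distrib sum_subtractf sum_distrib_left mult.assoc)
    also have "\<dots> = z * d"
      unfolding index basis_right[symmetric] d_def
      using z_central by (simp add: algebra_simps scaleR_2 zb)
    finally show ?thesis .
  qed
  also have "z * (z * d) = z * d" by (simp add: z_idem flip: mult.assoc)
  finally have "pos (z * d)" .
  moreover have zd: "z * d = d"
  proof -
    have "z * F (adj b * b) = F (z * (adj b * b))"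
      using F_left[of z "adj b * b"] by (simp add: F_z)
    moreover have "z * (adj b * b) = adj b * b" by (metis z_central mult.assoc zb)
    ultimately show ?thesis by (simp add: d_def right_diff_distrib)
  qed
  ultimately have "z * d = 0" using faithful[of d] by (simp add: d_def F_diff F_F)
  then show ?thesis using zd by (simp add: d_def)
qed

text \<open>Polarisation of \<open>adj_mult_self\<close>: applied to \<open>b + c\<close> it makes
  the defects of \<open>adj b * c\<close> and \<open>adj c * b\<close> opposite, applied to
  \<open>b + imag * c\<close> it makes them equal.\<close>

lemma adj_mult_kernel:
  assumes b: "z * b = b" "F b = 0" and c: "z * c = c" "F c = 0"
  shows "F (adj b * c) = adj b * c"
proof -
  define G where "G x = F x - x" for x
  have G_add: "G (x + y) = G x + G y" and G_diff: "G (x - y) = G x - G y"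
    and G_imag: "G (imag * x) = imag * G x" for x y
    by (simp_all add: G_def F_add F_diff F_imag algebra_simps)
  have sq: "G (adj x * x) = 0" if "z * x = x" "F x = 0" for x
    using adj_mult_self[OF that] by (simp add: G_def)
  have "z * (imag * c) = imag * c" using c(1) by (metis imag_central mult.assoc)
  then have "z * (b + c) = b + c" "F (b + c) = 0" "z * (b + imag * c) = b + imag * c" "F (b + imag * c) = 0"
    using b c by (simp_all add: distrib_left F_add F_imag)
  then have "G (adj (b + c) * (b + c)) = 0" "G (adj (b + imag * c) * (b + imag * c)) = 0"
    by (intro sq; simp)+
  moreover have "adj (b + c) * (b + c) = adj b * b + adj c * c + (adj b * c + adj c * b)"
    by (simp add: adj_add algebra_simps)
  moreover have "adj (b + imag * c) * (b + imag * c)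
      = adj b * b + adj c * c + imag * (adj b * c - adj c * b)"
  proof -
    have "adj b * (imag * c) = imag * (adj b * c)" "adj c * (imag * c) = imag * (adj c * c)"
      "adj c * imag = imag * adj c"
      by (metis imag_central mult.assoc)+
    moreover have "imag * (imag * x) = - x" for x :: 'b by (simp add: imag_imag flip: mult.assoc)
    ultimately show ?thesis
      by (simp add: adj_add adj_mult adj_imag ring_distribs mult.assoc)
  qed
  ultimately have "G (adj b * c) + G (adj c * b) = 0" "imag * (G (adj b * c) - G (adj c * b)) = 0"
    using sq[OF b] sq[OF c] by (simp_all add: G_add G_diff G_imag)
  moreover have "imag * (imag * (G (adj b * c) - G (adj c * b))) = - (G (adj b * c) - G (adj c * b))"
    by (simp add: imag_imag flip: mult.assoc)
  ultimately have "G (adj b * c) + G (adj b * c) = 0" by (simp add: eq_neg_iff_add_eq_0 algebra_simps)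
  then have "2 *\<^sub>R G (adj b * c) = 0" by (simp add: scaleR_2)
  then show ?thesis by (simp add: G_def)
qed

end

section \<open>Families of $C^*$-algebras as a type\<close>

lemma complex_ring_simps [simp]:
  "carrier complex_ring = UNIV" "\<one>\<^bsub>complex_ring\<^esub> = 1" "\<zero>\<^bsub>complex_ring\<^esub> = 0"
  "a \<oplus>\<^bsub>complex_ring\<^esub> b = a + b" "a \<otimes>\<^bsub>complex_ring\<^esub> b = a * b"
  by (simp_all add: complex_ring_def)

sublocale unital_cstar_algebra \<subseteq> ring A
  by (rule is_ring)

sublocale unital_cstar_algebra \<subseteq> V: module complex_ring A
  rewrites "carrier complex_ring = UNIV" and "one complex_ring = 1" and "zero complex_ring = 0"
    and "add complex_ring = (+)" and "mult complex_ring = (*)"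
  by (rule is_vector_space) (simp_all add: complex_ring_def)

context unital_cstar_algebra
begin

lemma smult_minus_one: "x \<in> carrier A \<Longrightarrow> (-1) \<odot> x = \<ominus> x"
proof -
  assume x: "x \<in> carrier A"
  have "x \<oplus> (-1) \<odot> x = 1 \<odot> x \<oplus> (-1) \<odot> x" using x by simp
  also have "\<dots> = (1 + -1) \<odot> x" using x V.smult_l_distr[of 1 "-1" x] by simp
  also have "\<dots> = \<zero>" using x by simp
  finally have "(-1) \<odot> x \<oplus> x = \<zero>" using x by (simp add: a_comm)
  then show ?thesis using x minus_equality[of "(-1) \<odot> x" x] by simp
qed

lemma norm_zero: "cnorm A \<zero> = 0"
  using norm_eq_0[of \<zero>] by simp

lemma norm_uminus: "x \<in> carrier A \<Longrightarrow> cnorm A (\<ominus> x) = cnorm A x"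
  using norm_smult[of x "-1"] by (simp add: smult_minus_one)

lemma star_one: "star A \<one> = \<one>"
  by (metis one_closed star_closed star_mult star_star l_one r_one)

lemma norm_one_le: "cnorm A \<one> \<le> 1"
proof -
  have "cnorm A \<one> = (cnorm A \<one>)\<^sup>2" using norm_cstar[of \<one>] by (simp add: star_one)
  then have "cnorm A \<one> = 0 \<or> cnorm A \<one> = 1" by (simp add: power2_eq_square)
  then show ?thesis by auto
qed

lemma norm_star: "x \<in> carrier A \<Longrightarrow> cnorm A (star A x) = cnorm A x"
proof -
  have le: "cnorm A y \<le> cnorm A (star A y)" if y: "y \<in> carrier A" for y
  proof (cases "cnorm A y = 0")
    case False
    have "(cnorm A y)\<^sup>2 \<le> cnorm A (star A y) * cnorm A y"
      using norm_mult[of "star A y" y] y by (simp add: norm_cstar star_closed)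
    then show ?thesis using False norm_nonneg[OF y]
      by (simp add: power2_eq_square mult_le_cancel_right)
  qed (simp add: norm_nonneg star_closed y)
  assume "x \<in> carrier A"
  then show ?thesis using le[of x] le[of "star A x"] by (simp add: star_closed star_star)
qed

lemma minus_triangle:
  "\<lbrakk>x \<in> carrier A; y \<in> carrier A; z \<in> carrier A\<rbrakk> \<Longrightarrow> x \<ominus> z = (x \<ominus> y) \<oplus> (y \<ominus> z)"
  by (simp add: a_minus_def a_assoc r_neg1)

lemmas closed_ops = a_closed m_closed minus_closed a_inv_closed zero_closed one_closed
  V.smult_closed[OF UNIV_I]

lemma norm_bounds:
  assumes "x \<in> carrier A" "y \<in> carrier A" "cnorm A x \<le> K" "cnorm A y \<le> L"
  shows "cnorm A (x \<oplus> y) \<le> K + L" "cnorm A (x \<ominus> y) \<le> K + L" "cnorm A (x \<otimes> y) \<le> K * L"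
proof -
  show "cnorm A (x \<oplus> y) \<le> K + L" using norm_triangle[of x y] assms by simp
  show "cnorm A (x \<ominus> y) \<le> K + L"
    using norm_triangle[of x "\<ominus> y"] assms by (simp add: a_minus_def norm_uminus)
  have "cnorm A x * cnorm A y \<le> K * L"
    by (rule mult_mono) (use assms norm_nonneg[of x] norm_nonneg[of y] in linarith)+
  then show "cnorm A (x \<otimes> y) \<le> K * L" using norm_mult[of x y] assms by simp
qed

end

text \<open>Bounded families \<open>(x\<^sub>A)\<close> indexed by all unital $C^*$-algebras \<open>A\<close> on a given type, together
  with a complex number that keeps \<open>0\<close> and \<open>1\<close> apart, form a $C^*$-algebra whose carrier is a type.
  A carrier-based algebra is one of its factors.\<close>

typedef 'b family = "{p :: ('b cstar \<Rightarrow> 'b) \<times> complex.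
    (\<forall>A. unital_cstar_algebra A \<longrightarrow> fst p A \<in> carrier A) \<and>
    (\<forall>A. \<not> unital_cstar_algebra A \<longrightarrow> fst p A = undefined) \<and>
    (\<exists>K. \<forall>A. unital_cstar_algebra A \<longrightarrow> cnorm A (fst p A) \<le> K)}"
  by (intro exI[of _ "(\<lambda>A. if unital_cstar_algebra A then \<zero>\<^bsub>A\<^esub> else undefined, 0)"])
    (auto simp: unital_cstar_algebra.norm_zero
      intro: exI[of _ 0] abelian_monoid.zero_closed ring.is_abelian_group[THEN abelian_group.axioms(1)]
        unital_cstar_algebra.is_ring)

definition coord :: "'b cstar \<Rightarrow> 'b family \<Rightarrow> 'b" where
  "coord A x = fst (Rep_family x) A"

definition scalar_part :: "'b family \<Rightarrow> complex" where
  "scalar_part x = snd (Rep_family x)"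

definition mk_family :: "('b cstar \<Rightarrow> 'b) \<Rightarrow> complex \<Rightarrow> 'b family" where
  "mk_family f c = Abs_family (\<lambda>A. if unital_cstar_algebra A then f A else undefined, c)"

lemma coord_closed: "unital_cstar_algebra A \<Longrightarrow> coord A x \<in> carrier A"
  using Rep_family[of x] by (simp add: coord_def)

lemma coord_bounded: "\<exists>K. \<forall>A. unital_cstar_algebra A \<longrightarrow> cnorm A (coord A x) \<le> K"
  using Rep_family[of x] by (simp add: coord_def)

text \<open>Off the $C^*$-algebras all families share the value \<open>undefined\<close>, so nothing
  has to be compared there.\<close>

lemma family_eqI:
  assumes "\<And>A. unital_cstar_algebra A \<Longrightarrow> coord A x = coord A y"
    and "scalar_part x = scalar_part y"
  shows "x = y"
proof -
  have "fst (Rep_family x) A = fst (Rep_family y) A" for A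
    using assms(1)[of A] Rep_family[of x] Rep_family[of y]
    by (cases "unital_cstar_algebra A") (simp_all add: coord_def)
  then have "Rep_family x = Rep_family y" using assms(2)
    by (auto simp: scalar_part_def prod_eq_iff)
  then show ?thesis by (simp add: Rep_family_inject)
qed

lemma mk_family:
  assumes "\<And>A. unital_cstar_algebra A \<Longrightarrow> f A \<in> carrier A"
    and "\<And>A. unital_cstar_algebra A \<Longrightarrow> cnorm A (f A) \<le> K"
  shows coord_mk_family: "unital_cstar_algebra A \<Longrightarrow> coord A (mk_family f c) = f A"
    and scalar_part_mk_family: "scalar_part (mk_family f c) = c"
proof -
  have "Rep_family (mk_family f c) = (\<lambda>A. if unital_cstar_algebra A then f A else undefined, c)"
    unfolding mk_family_def by (rule Abs_family_inverse) (use assms in auto)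
  then show "unital_cstar_algebra A \<Longrightarrow> coord A (mk_family f c) = f A"
    "scalar_part (mk_family f c) = c"
    by (simp_all add: coord_def scalar_part_def)
qed

instantiation family :: (type) "{zero, one, plus, minus, uminus, times, scaleR}"
begin

definition "0 = mk_family (\<lambda>A. \<zero>\<^bsub>A\<^esub>) 0"
definition "1 = mk_family (\<lambda>A. \<one>\<^bsub>A\<^esub>) 1"
definition "x + y = mk_family (\<lambda>A. coord A x \<oplus>\<^bsub>A\<^esub> coord A y) (scalar_part x + scalar_part y)"
definition "- x = mk_family (\<lambda>A. \<ominus>\<^bsub>A\<^esub> coord A x) (- scalar_part x)"
definition "x - y = mk_family (\<lambda>A. coord A x \<ominus>\<^bsub>A\<^esub> coord A y) (scalar_part x - scalar_part y)"
definition "x * y = mk_family (\<lambda>A. coord A x \<otimes>\<^bsub>A\<^esub> coord A y) (scalar_part x * scalar_part y)"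
definition "r *\<^sub>R x = mk_family (\<lambda>A. complex_of_real r \<odot>\<^bsub>A\<^esub> coord A x) (r *\<^sub>R scalar_part x)"

instance ..

end

text \<open>The scalar part counts as one more factor; it gives the unit norm 1, although the unit
  of a trivial algebra has norm 0.\<close>

definition family_norm :: "'b family \<Rightarrow> real" where
  "family_norm x = Sup (insert (cmod (scalar_part x))
    ((\<lambda>A. cnorm A (coord A x)) ` {A. unital_cstar_algebra A}))"

lemma family_norm_le_iff:
  "family_norm x \<le> K \<longleftrightarrow> cmod (scalar_part x) \<le> K \<and>
     (\<forall>A. unital_cstar_algebra A \<longrightarrow> cnorm A (coord A x) \<le> K)"
proof -
  obtain L where L: "\<forall>A. unital_cstar_algebra A \<longrightarrow> cnorm A (coord A x) \<le> L"
    using coord_bounded by blast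
  have "bdd_above (insert (cmod (scalar_part x)) ((\<lambda>A. cnorm A (coord A x)) ` {A. unital_cstar_algebra A}))"
    by (rule bdd_aboveI[of _ "max L (cmod (scalar_part x))"]) (use L in auto)
  then show ?thesis unfolding family_norm_def by (subst cSup_le_iff) auto
qed

lemma norm_coord_le: "unital_cstar_algebra A \<Longrightarrow> cnorm A (coord A x) \<le> family_norm x"
  and norm_scalar_part_le: "cmod (scalar_part x) \<le> family_norm x"
  using family_norm_le_iff[of x "family_norm x"] by auto

lemma family_norm_nonneg: "0 \<le> family_norm x"
  using norm_scalar_part_le[of x] norm_ge_zero[of "scalar_part x"] by linarith

lemma coord_zero: "unital_cstar_algebra A \<Longrightarrow> coord A (0 :: 'b family) = \<zero>\<^bsub>A\<^esub>"
  and scalar_part_zero: "scalar_part (0 :: 'b family) = 0"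
  unfolding zero_family_def
  by (rule mk_family[where K = 0]; simp add: unital_cstar_algebra.closed_ops
      unital_cstar_algebra.norm_zero)+

lemma coord_one: "unital_cstar_algebra A \<Longrightarrow> coord A (1 :: 'b family) = \<one>\<^bsub>A\<^esub>"
  and scalar_part_one: "scalar_part (1 :: 'b family) = 1"
  unfolding one_family_def
  by (rule mk_family[where K = 1]; simp add: unital_cstar_algebra.closed_ops
      unital_cstar_algebra.norm_one_le)+

lemma coord_add: "unital_cstar_algebra A \<Longrightarrow> coord A (x + y) = coord A x \<oplus>\<^bsub>A\<^esub> coord A y"
  and scalar_part_add: "scalar_part (x + y) = scalar_part x + scalar_part y"
  unfolding plus_family_def
  by (rule mk_family[where K = "family_norm x + family_norm y"];
      simp add: unital_cstar_algebra.closed_ops unital_cstar_algebra.norm_bounds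
        coord_closed norm_coord_le)+

lemma coord_minus: "unital_cstar_algebra A \<Longrightarrow> coord A (- x) = \<ominus>\<^bsub>A\<^esub> coord A x"
  and scalar_part_minus: "scalar_part (- x) = - scalar_part x"
  unfolding uminus_family_def
  by (rule mk_family[where K = "family_norm x"];
      simp add: unital_cstar_algebra.closed_ops unital_cstar_algebra.norm_uminus
        coord_closed norm_coord_le)+

lemma coord_diff: "unital_cstar_algebra A \<Longrightarrow> coord A (x - y) = coord A x \<ominus>\<^bsub>A\<^esub> coord A y"
  and scalar_part_diff: "scalar_part (x - y) = scalar_part x - scalar_part y"
  unfolding minus_family_def
  by (rule mk_family[where K = "family_norm x + family_norm y"];
      simp add: unital_cstar_algebra.closed_ops unital_cstar_algebra.norm_bounds
        coord_closed norm_coord_le)+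

lemma coord_mult: "unital_cstar_algebra A \<Longrightarrow> coord A (x * y) = coord A x \<otimes>\<^bsub>A\<^esub> coord A y"
  and scalar_part_mult: "scalar_part (x * y) = scalar_part x * scalar_part y"
  unfolding times_family_def
  by (rule mk_family[where K = "family_norm x * family_norm y"];
      simp add: unital_cstar_algebra.closed_ops unital_cstar_algebra.norm_bounds
        coord_closed norm_coord_le)+

lemma coord_scaleR: "unital_cstar_algebra A \<Longrightarrow> coord A (r *\<^sub>R x) = complex_of_real r \<odot>\<^bsub>A\<^esub> coord A x"
  and scalar_part_scaleR: "scalar_part (r *\<^sub>R x) = r *\<^sub>R scalar_part x"
  unfolding scaleR_family_def
  by (rule mk_family[where K = "\<bar>r\<bar> * family_norm x"];
      simp add: unital_cstar_algebra.closed_ops unital_cstar_algebra.norm_smult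
        coord_closed norm_coord_le mult_left_mono)+

lemmas family_simps =
  coord_zero scalar_part_zero coord_one scalar_part_one coord_add scalar_part_add
  coord_minus scalar_part_minus coord_diff scalar_part_diff coord_mult scalar_part_mult
  coord_scaleR scalar_part_scaleR coord_closed

instance family :: (type) "{ring_1, real_algebra_1}"
proof
  fix x y z :: "'a family" and r s :: real
  show "x + y + z = x + (y + z)" "x + y = y + x" "0 + x = x" "- x + x = 0" "x - y = x + - y"
    "x * y * z = x * (y * z)" "(x + y) * z = x * z + y * z" "x * (y + z) = x * y + x * z"
    "1 * x = x" "x * 1 = x"
    by (rule family_eqI, (frule unital_cstar_algebra.is_ring,
          simp add: family_simps ring.ring_simprules monoid.r_one ring.is_monoid), simp add: family_simps algebra_simps)+
  show "r *\<^sub>R (x + y) = r *\<^sub>R x + r *\<^sub>R y" "(r + s) *\<^sub>R x = r *\<^sub>R x + s *\<^sub>R x"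
    "r *\<^sub>R s *\<^sub>R x = (r * s) *\<^sub>R x" "1 *\<^sub>R x = x"
    by (rule family_eqI, (frule unital_cstar_algebra.is_vector_space,
          simp add: family_simps module.smult_l_distr[of complex_ring, simplified]
            module.smult_r_distr[of complex_ring, simplified]
            module.smult_assoc1[of complex_ring, simplified]
            module.smult_one[of complex_ring, simplified]), simp add: family_simps algebra_simps)+
  show "r *\<^sub>R x * y = r *\<^sub>R (x * y)" "x * r *\<^sub>R y = r *\<^sub>R (x * y)"
    by (rule family_eqI, simp add: family_simps unital_cstar_algebra.smult_mult_left
        unital_cstar_algebra.smult_mult_right, simp add: family_simps)+
  show "(0::'a family) \<noteq> 1"
    by (metis scalar_part_one scalar_part_zero zero_neq_one)
qed

instantiation family :: (type) real_normed_algebra_1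
begin

definition norm_family :: "'a family \<Rightarrow> real" where "norm_family = family_norm"
definition dist_family :: "'a family \<Rightarrow> 'a family \<Rightarrow> real" where "dist_family x y = norm (x - y)"
definition uniformity_family :: "('a family \<times> 'a family) filter" where
  "uniformity_family = (INF e\<in>{0<..}. principal {(x, y). dist x y < e})"
definition open_family :: "'a family set \<Rightarrow> bool" where
  "open_family U \<longleftrightarrow> (\<forall>x\<in>U. \<forall>\<^sub>F (x', y) in uniformity. x' = x \<longrightarrow> y \<in> U)"
definition sgn_family :: "'a family \<Rightarrow> 'a family" where "sgn_family x = x /\<^sub>R norm x"

instance
proof
  fix x y z :: "'a family" and r s :: real
  show "dist x y = norm (x - y)" by (rule dist_family_def)
  show "sgn x = x /\<^sub>R norm x" by (rule sgn_family_def)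
  show "uniformity = (INF e\<in>{0 <..}. principal {(x::'a family, y). dist x y < e})"
    by (rule uniformity_family_def)
  show "open U \<longleftrightarrow> (\<forall>x\<in>U. \<forall>\<^sub>F (x', y) in uniformity. x' = x \<longrightarrow> y \<in> U)" for U :: "'a family set"
    by (rule open_family_def)
  have norm_le_iff: "norm x \<le> K \<longleftrightarrow> cmod (scalar_part x) \<le> K \<and>
      (\<forall>A. unital_cstar_algebra A \<longrightarrow> cnorm A (coord A x) \<le> K)" for x :: "'a family" and K
    unfolding norm_family_def by (rule family_norm_le_iff)
  have nonneg: "0 \<le> norm x" for x :: "'a family"
    unfolding norm_family_def by (rule family_norm_nonneg)
  have comp_le: "cnorm A (coord A x) \<le> norm x" if "unital_cstar_algebra A" for A and x :: "'a family"
    unfolding norm_family_def using that by (rule norm_coord_le)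
  have scal_le: "cmod (scalar_part x) \<le> norm x" for x :: "'a family"
    unfolding norm_family_def by (rule norm_scalar_part_le)
  show "norm x = 0 \<longleftrightarrow> x = 0"
  proof
    assume n: "norm x = 0"
    show "x = 0"
    proof (rule family_eqI)
      fix A :: "'a cstar" assume A: "unital_cstar_algebra A"
      interpret unital_cstar_algebra A by fact
      have "cnorm A (coord A x) = 0"
        using comp_le[OF A, of x] norm_nonneg[OF coord_closed[OF A]] n by (metis antisym)
      then show "coord A x = coord A 0"
        by (simp add: norm_eq_0 coord_closed A coord_zero)
    next
      show "scalar_part x = scalar_part 0" using scal_le[of x] n by (simp add: scalar_part_zero)
    qed
  next
    assume "x = 0"
    then have "norm x \<le> 0"
      by (simp add: norm_le_iff family_simps unital_cstar_algebra.norm_zero)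
    then show "norm x = 0" using nonneg[of x] by simp
  qed
  show "norm (x + y) \<le> norm x + norm y"
    unfolding norm_le_iff[of "x + y"]
  proof (intro conjI allI impI)
    show "cmod (scalar_part (x + y)) \<le> norm x + norm y"
      unfolding scalar_part_add
      by (rule order_trans[OF norm_triangle_ineq]) (intro add_mono scal_le)
    fix A :: "'a cstar" assume A: "unital_cstar_algebra A"
    interpret unital_cstar_algebra A by fact
    show "cnorm A (coord A (x + y)) \<le> norm x + norm y"
      unfolding coord_add[OF A]
      by (rule order_trans[OF norm_triangle]) (auto intro!: add_mono comp_le A coord_closed)
  qed
  show "norm (x * y) \<le> norm x * norm y"
    unfolding norm_le_iff[of "x * y"]
  proof (intro conjI allI impI)
    show "cmod (scalar_part (x * y)) \<le> norm x * norm y"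
      unfolding scalar_part_mult norm_mult
      by (intro mult_mono scal_le nonneg norm_ge_zero)
    fix A :: "'a cstar" assume A: "unital_cstar_algebra A"
    interpret unital_cstar_algebra A by fact
    show "cnorm A (coord A (x * y)) \<le> norm x * norm y"
      unfolding coord_mult[OF A]
      by (rule order_trans[OF norm_mult])
        (auto intro!: mult_mono comp_le A coord_closed norm_nonneg nonneg)
  qed
  show "norm (r *\<^sub>R x) = \<bar>r\<bar> * norm x"
  proof -
    have le: "norm (r *\<^sub>R x) \<le> \<bar>r\<bar> * norm x" for r and x :: "'a family"
      unfolding norm_le_iff[of "r *\<^sub>R x"]
      by (auto simp: family_simps unital_cstar_algebra.norm_smult intro!: mult_left_mono
          scal_le comp_le)
    show ?thesis
    proof (cases "r = 0")
      case False
      have "x = inverse r *\<^sub>R (r *\<^sub>R x)"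
        using False by simp
      then have "norm x \<le> \<bar>inverse r\<bar> * norm (r *\<^sub>R x)" by (metis le)
      then have "\<bar>r\<bar> * norm x \<le> norm (r *\<^sub>R x)" using False by (simp add: field_simps abs_inverse)
      then show ?thesis using le[of r x] by simp
    next
      case True
      then show ?thesis using le[of r x] nonneg[of "r *\<^sub>R x"] by simp
    qed
  qed
  show "norm (1 :: 'a family) = 1"
  proof (rule antisym)
    show "norm (1 :: 'a family) \<le> 1"
      by (simp add: norm_le_iff family_simps unital_cstar_algebra.norm_one_le)
    show "1 \<le> norm (1 :: 'a family)" using scal_le[of "1::'a family"] by (simp add: family_simps)
  qed
qed

end

lemma norm_family_le_iff:
  "norm x \<le> K \<longleftrightarrow> cmod (scalar_part x) \<le> K \<and>
    (\<forall>A. unital_cstar_algebra A \<longrightarrow> cnorm A (coord A x) \<le> K)"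
  unfolding norm_family_def by (rule family_norm_le_iff)

lemma cnorm_coord_le: "unital_cstar_algebra A \<Longrightarrow> cnorm A (coord A x) \<le> norm x"
  unfolding norm_family_def by (rule norm_coord_le)

lemma cmod_scalar_part_le: "cmod (scalar_part x) \<le> norm x"
  unfolding norm_family_def by (rule norm_scalar_part_le)

text \<open>Limits are taken coordinatewise. They inherit a common bound \<open>K\<close> from the
  sequence and so form a family, and the Cauchy estimate is uniform over the coordinates, which
  gives convergence in the supremum norm.\<close>

instance family :: (type) banach
proof
  fix X :: "nat \<Rightarrow> 'a family" assume C: "Cauchy X"
  have CX: "\<exists>N. \<forall>m\<ge>N. \<forall>n\<ge>N. norm (X m - X n) < e" if "e > 0" for e
    using C that unfolding Cauchy_iff by blast
  obtain K where K: "\<And>n. norm (X n) \<le> K"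
    using Cauchy_Bseq[OF C] unfolding Bseq_def by blast
  have "\<exists>l\<in>carrier A. (\<lambda>n. cnorm A (coord A (X n) \<ominus>\<^bsub>A\<^esub> l)) \<longlonglongrightarrow> 0"
    if A: "unital_cstar_algebra A" for A
  proof -
    interpret unital_cstar_algebra A by fact
    have "\<exists>N. \<forall>m\<ge>N. \<forall>n\<ge>N. cnorm A (coord A (X m) \<ominus>\<^bsub>A\<^esub> coord A (X n)) < e" if e: "e > 0" for e
    proof -
      obtain N where N: "\<forall>m\<ge>N. \<forall>n\<ge>N. norm (X m - X n) < e" using CX[OF e] by blast
      have "cnorm A (coord A (X m) \<ominus>\<^bsub>A\<^esub> coord A (X n)) < e" if "m \<ge> N" "n \<ge> N" for m n
        using le_less_trans[OF cnorm_coord_le[OF A, of "X m - X n"]] N that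
        by (simp add: coord_diff A)
      then show ?thesis by blast
    qed
    with complete[unfolded cauchy_complete_def, rule_format, of "\<lambda>n. coord A (X n)"]
    show ?thesis using coord_closed[OF A] by simp
  qed
  then obtain l where l: "\<And>A. unital_cstar_algebra A \<Longrightarrow> l A \<in> carrier A"
    "\<And>A. unital_cstar_algebra A \<Longrightarrow> (\<lambda>n. cnorm A (coord A (X n) \<ominus>\<^bsub>A\<^esub> l A)) \<longlonglongrightarrow> 0"
    by metis
  have "Cauchy (\<lambda>n. scalar_part (X n))"
  proof (rule CauchyI)
    fix e :: real assume "e > 0"
    then obtain N where N: "\<forall>m\<ge>N. \<forall>n\<ge>N. norm (X m - X n) < e" using CX by blast
    have "cmod (scalar_part (X m) - scalar_part (X n)) < e" if "m \<ge> N" "n \<ge> N" for m n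
      using le_less_trans[OF cmod_scalar_part_le[of "X m - X n"]] N that
      by (simp add: scalar_part_diff)
    then show "\<exists>M. \<forall>m\<ge>M. \<forall>n\<ge>M. cmod (scalar_part (X m) - scalar_part (X n)) < e" by blast
  qed
  then obtain c where c: "(\<lambda>n. scalar_part (X n)) \<longlonglongrightarrow> c"
    by (auto simp: Cauchy_convergent_iff convergent_def)
  have bound: "cnorm A (l A) \<le> K" if A: "unital_cstar_algebra A" for A
  proof -
    interpret unital_cstar_algebra A by fact
    note [simp] = coord_closed[OF A] l(1)[OF A]
    have "cnorm A (l A) \<le> cnorm A (coord A (X n) \<ominus>\<^bsub>A\<^esub> l A) + K" for n
    proof -
      have "l A = coord A (X n) \<ominus>\<^bsub>A\<^esub> (coord A (X n) \<ominus>\<^bsub>A\<^esub> l A)"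
        by (simp add: a_minus_def minus_add minus_minus r_neg2)
      also have "cnorm A \<dots> \<le> cnorm A (coord A (X n)) + cnorm A (coord A (X n) \<ominus>\<^bsub>A\<^esub> l A)"
        using norm_triangle[of "coord A (X n)" "\<ominus>\<^bsub>A\<^esub> (coord A (X n) \<ominus>\<^bsub>A\<^esub> l A)"]
        by (simp add: norm_uminus a_minus_def[of A "coord A (X n)" "coord A (X n) \<ominus>\<^bsub>A\<^esub> l A"])
      finally have "cnorm A (l A) \<le> cnorm A (coord A (X n)) + cnorm A (coord A (X n) \<ominus>\<^bsub>A\<^esub> l A)" .
      then show ?thesis using order_trans[OF cnorm_coord_le[OF A] K, of n] by simp
    qed
    moreover have "(\<lambda>n. cnorm A (coord A (X n) \<ominus>\<^bsub>A\<^esub> l A) + K) \<longlonglongrightarrow> 0 + K"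
      by (intro tendsto_intros l(2) A)
    ultimately show ?thesis by (intro LIMSEQ_le_const[of _ "K"]) auto
  qed
  note L = mk_family[of l K, OF l(1) bound]
  have "X \<longlonglongrightarrow> mk_family l c"
  proof (rule LIMSEQ_I)
    fix e :: real assume e: "e > 0"
    obtain N where N: "\<And>m n. m \<ge> N \<Longrightarrow> n \<ge> N \<Longrightarrow> norm (X m - X n) < e / 2"
      using CX[of "e / 2"] e by auto
    have "norm (X n - mk_family l c) \<le> e / 2" if n: "n \<ge> N" for n
      unfolding norm_family_le_iff
    proof (intro conjI allI impI)
      have "(\<lambda>m. cmod (scalar_part (X n) - scalar_part (X m))) \<longlonglongrightarrow> cmod (scalar_part (X n) - c)"
        by (intro tendsto_intros c)
      moreover have "cmod (scalar_part (X n) - scalar_part (X m)) \<le> e / 2" if "m \<ge> N" for m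
        using order_trans[OF cmod_scalar_part_le less_imp_le[OF N[OF n that]]] by (simp add: scalar_part_diff)
      ultimately have "cmod (scalar_part (X n) - c) \<le> e / 2"
        by (intro LIMSEQ_le_const2) blast+
      then show "cmod (scalar_part (X n - mk_family l c)) \<le> e / 2"
        by (simp add: scalar_part_diff L)
      fix A :: "'a cstar" assume A: "unital_cstar_algebra A"
      interpret unital_cstar_algebra A by fact
      note [simp] = coord_closed[OF A] l(1)[OF A]
      have "cnorm A (coord A (X n) \<ominus>\<^bsub>A\<^esub> l A) \<le> e / 2 + cnorm A (coord A (X m) \<ominus>\<^bsub>A\<^esub> l A)"
        if m: "m \<ge> N" for m
      proof -
        have "cnorm A (coord A (X n) \<ominus>\<^bsub>A\<^esub> l A)
          \<le> cnorm A (coord A (X n) \<ominus>\<^bsub>A\<^esub> coord A (X m)) + cnorm A (coord A (X m) \<ominus>\<^bsub>A\<^esub> l A)"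
          by (subst minus_triangle[of _ "coord A (X m)"]) (simp_all add: norm_triangle)
        moreover have "cnorm A (coord A (X n) \<ominus>\<^bsub>A\<^esub> coord A (X m)) \<le> e / 2"
          using order_trans[OF cnorm_coord_le[OF A] less_imp_le[OF N[OF n m]]]
          by (simp add: coord_diff A)
        ultimately show ?thesis by simp
      qed
      moreover have "(\<lambda>m. e / 2 + cnorm A (coord A (X m) \<ominus>\<^bsub>A\<^esub> l A)) \<longlonglongrightarrow> e / 2 + 0"
        by (intro tendsto_intros l(2) A)
      ultimately have "cnorm A (coord A (X n) \<ominus>\<^bsub>A\<^esub> l A) \<le> e / 2 + 0"
        by (intro LIMSEQ_le_const) blast+
      then show "cnorm A (coord A (X n - mk_family l c)) \<le> e / 2"
        by (simp add: coord_diff A L)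
    qed
    moreover have "e / 2 < e" using e by simp
    ultimately show "\<exists>no. \<forall>n\<ge>no. norm (X n - mk_family l c) < e" by (meson le_less_trans)
  qed
  then show "convergent X" by (auto simp: convergent_def)
qed

instantiation family :: (type) ucstar
begin

definition adj_family :: "'a family \<Rightarrow> 'a family" where
  "adj_family x = mk_family (\<lambda>A. star A (coord A x)) (cnj (scalar_part x))"

definition imag_family :: "'a family" where
  "imag_family = mk_family (\<lambda>A. \<i> \<odot>\<^bsub>A\<^esub> \<one>\<^bsub>A\<^esub>) \<i>"

lemma coord_adj: "unital_cstar_algebra A \<Longrightarrow> coord A (adj x) = star A (coord A x)"
  and scalar_part_adj: "scalar_part (adj x :: 'a family) = cnj (scalar_part x)"
  unfolding adj_family_def
  by (rule mk_family[of _ "norm x"]; simp add: unital_cstar_algebra.star_closed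
      unital_cstar_algebra.norm_star coord_closed cnorm_coord_le)+

lemma coord_imag: "unital_cstar_algebra A \<Longrightarrow> coord A (imag :: 'a family) = \<i> \<odot>\<^bsub>A\<^esub> \<one>\<^bsub>A\<^esub>"
  and scalar_part_imag: "scalar_part (imag :: 'a family) = \<i>"
  unfolding imag_family_def
  by (rule mk_family[of _ 1]; simp add: unital_cstar_algebra.closed_ops
      unital_cstar_algebra.norm_smult unital_cstar_algebra.norm_one_le)+

instance
proof
  note adj = coord_adj scalar_part_adj and im = coord_imag scalar_part_imag
  fix x y :: "'a family" and r :: real
  show "adj (adj x) = x" "adj (x + y) = adj x + adj y" "adj (x * y) = adj y * adj x"
    "adj (r *\<^sub>R x) = r *\<^sub>R adj x"
    by (rule family_eqI, simp add: family_simps adj unital_cstar_algebra.star_star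
        unital_cstar_algebra.star_add unital_cstar_algebra.star_mult unital_cstar_algebra.star_smult,
        simp add: family_simps adj)+
  show "imag * x = x * imag"
  proof (rule family_eqI)
    fix A :: "'a cstar" assume A: "unital_cstar_algebra A"
    interpret unital_cstar_algebra A by fact
    note [simp] = coord_closed[OF A]
    show "coord A (imag * x) = coord A (x * imag)"
      by (simp add: coord_mult A im smult_mult_left smult_mult_right)
  qed (simp add: family_simps im)
  show "imag * imag = (- 1 :: 'a family)"
  proof (rule family_eqI)
    fix A :: "'a cstar" assume A: "unital_cstar_algebra A"
    interpret unital_cstar_algebra A by fact
    show "coord A (imag * imag) = coord A (- 1)"
      by (simp add: family_simps A im smult_mult_left smult_mult_right smult_minus_one flip: V.smult_assoc1)
  qed (simp add: family_simps im)
  show "adj imag = - (imag :: 'a family)"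
  proof (rule family_eqI)
    fix A :: "'a cstar" assume A: "unital_cstar_algebra A"
    interpret unital_cstar_algebra A by fact
    show "coord A (adj imag) = coord A (- imag)"
      using V.smult_assoc1[of "-1" "\<i>" "\<one>\<^bsub>A\<^esub>"]
      by (simp add: family_simps A im adj star_smult star_one smult_minus_one)
  qed (simp add: family_simps im adj)
  show "norm (adj x * x) = (norm x)\<^sup>2"
  proof (rule antisym)
    show "norm (adj x * x) \<le> (norm x)\<^sup>2"
      unfolding norm_family_le_iff
    proof (intro conjI allI impI)
      show "cmod (scalar_part (adj x * x)) \<le> (norm x)\<^sup>2"
        unfolding scalar_part_mult adj norm_mult complex_mod_cnj power2_eq_square
        by (intro mult_mono cmod_scalar_part_le norm_ge_zero)
      fix A :: "'a cstar" assume A: "unital_cstar_algebra A"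
      show "cnorm A (coord A (adj x * x)) \<le> (norm x)\<^sup>2"
        unfolding coord_mult[OF A] adj(1)[OF A]
          unital_cstar_algebra.norm_cstar[OF A coord_closed[OF A]]
        by (intro power_mono cnorm_coord_le[OF A] unital_cstar_algebra.norm_nonneg[OF A] coord_closed[OF A])
    qed
    have "norm x \<le> sqrt (norm (adj x * x))"
      unfolding norm_family_le_iff[of x]
    proof (intro conjI allI impI real_le_rsqrt)
      show "(cmod (scalar_part x))\<^sup>2 \<le> norm (adj x * x)"
        using cmod_scalar_part_le[of "adj x * x"]
        by (simp add: scalar_part_mult adj norm_mult power2_eq_square)
      fix A :: "'a cstar" assume A: "unital_cstar_algebra A"
      show "(cnorm A (coord A x))\<^sup>2 \<le> norm (adj x * x)"
        using cnorm_coord_le[OF A, of "adj x * x"]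
        by (simp add: family_simps A adj unital_cstar_algebra.norm_cstar)
    qed
    then show "(norm x)\<^sup>2 \<le> norm (adj x * x)"
      by (metis norm_ge_zero power_mono real_sqrt_pow2)
  qed
qed

end

lemma coord_sum:
  assumes "unital_cstar_algebra A"
  shows "coord A (\<Sum>i<n. f i) = (\<Oplus>\<^bsub>A\<^esub>i\<in>{..<n::nat}. coord A (f i))"
proof -
  interpret unital_cstar_algebra A by fact
  note [simp] = coord_closed[OF assms]
  show ?thesis
  proof (induction n)
    case (Suc n)
    have "(\<Oplus>\<^bsub>A\<^esub>i\<in>{..<Suc n}. coord A (f i)) = coord A (f n) \<oplus>\<^bsub>A\<^esub> (\<Oplus>\<^bsub>A\<^esub>i\<in>{..<n}. coord A (f i))"
      unfolding lessThan_Suc by (rule finsum_insert) auto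
    then show ?case using Suc by (simp add: coord_add assms a_comm)
  qed (simp add: coord_zero assms)
qed

lemma scalar_part_sum: "scalar_part (sum f S) = (\<Sum>i\<in>S. scalar_part (f i))"
  by (induction S rule: infinite_finite_induct) (auto simp: scalar_part_add scalar_part_zero)

text \<open>The inclusion of a factor, which is not unital: the image of the unit of
  \<open>B\<close> is the projection that cuts this factor out.\<close>

definition embed :: "'b cstar \<Rightarrow> 'b \<Rightarrow> 'b family" where
  "embed B x = mk_family (\<lambda>A. if A = B then x else \<zero>\<^bsub>A\<^esub>) 0"

lemma embed:
  assumes "unital_cstar_algebra B" "x \<in> carrier B"
  shows coord_embed: "unital_cstar_algebra A \<Longrightarrow> coord A (embed B x) = (if A = B then x else \<zero>\<^bsub>A\<^esub>)"
    and scalar_part_embed: "scalar_part (embed B x) = 0"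
    and norm_embed_le: "norm (embed B x) \<le> cnorm B x"
proof -
  have f: "(if A = B then x else \<zero>\<^bsub>A\<^esub>) \<in> carrier A" "cnorm A (if A = B then x else \<zero>\<^bsub>A\<^esub>) \<le> cnorm B x"
    if "unital_cstar_algebra A" for A
  proof -
    interpret unital_cstar_algebra A by fact
    show "(if A = B then x else \<zero>\<^bsub>A\<^esub>) \<in> carrier A" "cnorm A (if A = B then x else \<zero>\<^bsub>A\<^esub>) \<le> cnorm B x"
      using assms by (auto simp: norm_zero unital_cstar_algebra.norm_nonneg)
  qed
  note m = mk_family[of "\<lambda>A. if A = B then x else \<zero>\<^bsub>A\<^esub>", OF f]
  show c: "unital_cstar_algebra A \<Longrightarrow> coord A (embed B x) = (if A = B then x else \<zero>\<^bsub>A\<^esub>)" for A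
    unfolding embed_def using m by blast
  show s: "scalar_part (embed B x) = 0" unfolding embed_def using m by blast
  show "norm (embed B x) \<le> cnorm B x"
    unfolding norm_family_le_iff using f c s assms by (auto simp: unital_cstar_algebra.norm_nonneg)
qed

section \<open>Transfer to carrier-based extensions\<close>

locale index2_extension =
  fixes A :: "'a cstar" and P :: "('a, 'b) extension"
  assumes cstar_A: "unital_cstar_algebra A" and P: "P \<in> index2_extensions A"
begin

abbreviation B :: "'b cstar" where "B \<equiv> alg P"
abbreviation \<iota> :: "'a \<Rightarrow> 'b" where "\<iota> \<equiv> incl P"
abbreviation E :: "'b \<Rightarrow> 'a" where "E \<equiv> expec P"
abbreviation F :: "'b \<Rightarrow> 'b" where "F x \<equiv> \<iota> (E x)"

lemma cstar_B: "unital_cstar_algebra B"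
  using P by (simp add: index2_extensions_def)

end

sublocale index2_extension \<subseteq> A: unital_cstar_algebra A by (rule cstar_A)

sublocale index2_extension \<subseteq> B: unital_cstar_algebra "alg P" by (rule cstar_B)

context index2_extension
begin

abbreviation bmult (infixl \<open>\<cdot>\<close> 70) where "x \<cdot> y \<equiv> x \<otimes>\<^bsub>alg P\<^esub> y"
abbreviation bplus (infixl \<open>\<boxplus>\<close> 65) where "x \<boxplus> y \<equiv> x \<oplus>\<^bsub>alg P\<^esub> y"
abbreviation bminus (infixl \<open>\<boxminus>\<close> 65) where "x \<boxminus> y \<equiv> x \<ominus>\<^bsub>alg P\<^esub> y"
abbreviation bstar (\<open>_\<star>\<close> [100] 100) where "x\<star> \<equiv> star (alg P) x"

lemma incl_hom: "\<iota> \<in> ring_hom A B"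
  and incl_smult: "a \<in> carrier A \<Longrightarrow> \<iota> (c \<odot>\<^bsub>A\<^esub> a) = c \<odot>\<^bsub>B\<^esub> \<iota> a"
  and incl_star: "a \<in> carrier A \<Longrightarrow> \<iota> (star A a) = (\<iota> a)\<star>"
  and incl_inj: "inj_on \<iota> (carrier A)"
  and norm_incl: "a \<in> carrier A \<Longrightarrow> cnorm B (\<iota> a) = cnorm A a"
  using P by (auto simp: index2_extensions_def star_hom_def)

lemmas incl_closed [simp] = ring_hom_closed[OF incl_hom]
lemmas incl_mult = ring_hom_mult[OF incl_hom]
lemmas incl_add = ring_hom_add[OF incl_hom]
lemmas incl_one = ring_hom_one[OF incl_hom]
lemmas incl_zero [simp] = ring_hom_zero[OF incl_hom A.is_ring B.is_ring]

lemma incl_eq_iff: "a \<in> carrier A \<Longrightarrow> b \<in> carrier A \<Longrightarrow> \<iota> a = \<iota> b \<longleftrightarrow> a = b"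
  using incl_inj by (auto dest: inj_onD)

lemma cond_exp: "cond_expectation A P"
  using P by (simp add: index2_extensions_def)

lemma E_closed [simp]: "x \<in> carrier B \<Longrightarrow> E x \<in> carrier A"
  and E_add: "x \<in> carrier B \<Longrightarrow> y \<in> carrier B \<Longrightarrow> E (x \<boxplus> y) = E x \<oplus>\<^bsub>A\<^esub> E y"
  and E_smult: "x \<in> carrier B \<Longrightarrow> E (c \<odot>\<^bsub>B\<^esub> x) = c \<odot>\<^bsub>A\<^esub> E x"
  and E_incl: "a \<in> carrier A \<Longrightarrow> E (\<iota> a) = a"
  and E_left: "a \<in> carrier A \<Longrightarrow> x \<in> carrier B \<Longrightarrow> E (\<iota> a \<cdot> x) = a \<otimes>\<^bsub>A\<^esub> E x"
  and E_right: "a \<in> carrier A \<Longrightarrow> x \<in> carrier B \<Longrightarrow> E (x \<cdot> \<iota> a) = E x \<otimes>\<^bsub>A\<^esub> a"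
  and E_positive: "x \<in> carrier B \<Longrightarrow> cpositive B x \<Longrightarrow> cpositive A (E x)"
  using cond_exp by (auto simp: cond_expectation_def Let_def)

lemmas B_closed [simp] = B.star_closed B.V.smult_closed[OF UNIV_I]
lemmas A_closed [simp] = A.star_closed A.V.smult_closed[OF UNIV_I]

lemma E_one: "E \<one>\<^bsub>B\<^esub> = \<one>\<^bsub>A\<^esub>"
  using E_incl[of "\<one>\<^bsub>A\<^esub>"] by (simp add: incl_one)

text \<open>The identity on the other components makes the extended expectation unital.\<close>

definition F_family :: "'b family \<Rightarrow> 'b family" where
  "F_family y = mk_family (\<lambda>D. if D = B then F (coord D y) else coord D y) (scalar_part y)"

lemma coord_F_family:
    "unital_cstar_algebra D \<Longrightarrow>
      coord D (F_family y) = (if D = B then F (coord D y) else coord D y)"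
  and scalar_part_F_family: "scalar_part (F_family y) = scalar_part y"
proof -
  have f: "(if D = B then F (coord D y) else coord D y) \<in> carrier D"
    "cnorm D (if D = B then F (coord D y) else coord D y) \<le> max (cnorm B (F (coord B y))) (norm y)"
    if "unital_cstar_algebra D" for D
    using coord_closed[OF that, of y] cnorm_coord_le[OF that, of y] by auto
  note m = mk_family[of "\<lambda>D. if D = B then F (coord D y) else coord D y", OF f]
  show "unital_cstar_algebra D \<Longrightarrow>
      coord D (F_family y) = (if D = B then F (coord D y) else coord D y)" for D
    unfolding F_family_def using m by blast
  show "scalar_part (F_family y) = scalar_part y" unfolding F_family_def using m by blast
qed

lemma expectation_F_family: "expectation F_family"
proof
  have eqI: "x = y" if "coord B x = coord B y" "scalar_part x = scalar_part y"
    "\<And>D. unital_cstar_algebra D \<Longrightarrow> D \<noteq> B \<Longrightarrow> coord D x = coord D y" for x y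
    using that by (metis family_eqI)
  note simps = family_simps coord_F_family scalar_part_F_family coord_adj scalar_part_adj
    coord_imag scalar_part_imag cstar_B coord_closed
  fix x y :: "'b family" and r :: real
  show "F_family (x + y) = F_family x + F_family y" "F_family (r *\<^sub>R x) = r *\<^sub>R F_family x"
    "F_family (F_family x * y) = F_family x * F_family y"
    "F_family (x * F_family y) = F_family x * F_family y"
    "F_family 1 = 1" "F_family (imag * x) = imag * F_family x"
    by (rule eqI; simp add: simps E_add incl_add E_smult incl_smult E_left E_right incl_mult
        incl_one E_one B.smult_mult_left)+
  define b where "b = coord B x"
  have b: "b \<in> carrier B" by (simp add: b_def coord_closed cstar_B)
  have "cpositive A (E (b\<star> \<cdot> b))" using b by (intro E_positive) (auto simp: cpositive_def)
  then obtain a where a: "a \<in> carrier A" "E (b\<star> \<cdot> b) = star A a \<otimes>\<^bsub>A\<^esub> a" by (auto simp: cpositive_def)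
  \<comment> \<open>In the coordinate \<open>B\<close> the witness comes from positivity of
    \<open>E\<close>; in all others \<open>F_family\<close> is the identity and \<open>x\<close>
    itself serves.\<close>
  define f where "f = (\<lambda>D. if D = B then \<iota> a else coord D x)"
  have "f D \<in> carrier D" "cnorm D (f D) \<le> max (cnorm B (\<iota> a)) (norm x)" if "unital_cstar_algebra D" for D
    using coord_closed[OF that, of x] cnorm_coord_le[OF that, of x] a by (auto simp: f_def)
  note m = mk_family[of f, OF this]
  have m1: "coord D (mk_family f (scalar_part x)) = f D" if "unital_cstar_algebra D" for D
    using m that by blast
  have m2: "scalar_part (mk_family f (scalar_part x)) = scalar_part x" using m by blast
  show "\<exists>g. F_family (adj x * x) = adj g * g"
  proof (rule exI[of _ "mk_family f (scalar_part x)"], rule eqI)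
    show "coord B (F_family (adj x * x)) =
        coord B (adj (mk_family f (scalar_part x)) * mk_family f (scalar_part x))"
      using m1[OF cstar_B] a by (simp add: simps f_def incl_mult incl_star flip: b_def)
    fix D assume "unital_cstar_algebra D" "D \<noteq> B"
    then show "coord D (F_family (adj x * x)) =
        coord D (adj (mk_family f (scalar_part x)) * mk_family f (scalar_part x))"
      using m1[of D] by (simp add: simps f_def)
  qed (use m2 in \<open>simp add: simps\<close>)
qed

lemma quasi_basis: "\<exists>n u v. quasi_basis P n u v \<and>
    2 \<odot>\<^bsub>B\<^esub> \<one>\<^bsub>B\<^esub> = (\<Oplus>\<^bsub>B\<^esub>i\<in>{..<n}. u i \<cdot> v i)"
  using P by (simp add: index2_extensions_def has_index_def)

end

locale index2_basis = index2_extension +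
  fixes n :: nat and u v :: "nat \<Rightarrow> 'b"
  assumes qb: "quasi_basis P n u v"
    and index: "2 \<odot>\<^bsub>B\<^esub> \<one>\<^bsub>B\<^esub> = (\<Oplus>\<^bsub>B\<^esub>i\<in>{..<n}. u i \<cdot> v i)"
begin

lemma u_closed [simp]: "i < n \<Longrightarrow> u i \<in> carrier B"
  and v_closed [simp]: "i < n \<Longrightarrow> v i \<in> carrier B"
  and basis_left: "x \<in> carrier B \<Longrightarrow> (\<Oplus>\<^bsub>B\<^esub>i\<in>{..<n}. u i \<cdot> F (v i \<cdot> x)) = x"
  and basis_right: "x \<in> carrier B \<Longrightarrow> (\<Oplus>\<^bsub>B\<^esub>i\<in>{..<n}. F (x \<cdot> u i) \<cdot> v i) = x"
  using qb by (auto simp: quasi_basis_def Let_def)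

abbreviation unit_family :: "'b family" where "unit_family \<equiv> embed B \<one>\<^bsub>B\<^esub>"

text \<open>In the coordinates other than \<open>B\<close>, and in the scalar part, embedded
  elements vanish and each identity reads \<open>0 = 0\<close>; in the coordinate \<open>B\<close>
  it is the given quasi-basis.\<close>

lemma index_two_family:
  "index_two F_family unit_family n (\<lambda>i. embed B (u i)) (\<lambda>i. embed B (v i))"
proof -
  interpret expectation F_family by (rule expectation_F_family)
  note ec = coord_embed[OF cstar_B]
  note simps = family_simps coord_F_family scalar_part_F_family coord_adj scalar_part_adj
    coord_imag scalar_part_imag cstar_B ec[OF B.one_closed] scalar_part_embed[OF cstar_B]
    B.star_one scalar_part_sum coord_sum
  have eqI: "x = y" if "coord B x = coord B y" "scalar_part x = scalar_part y"
    "\<And>D. unital_cstar_algebra D \<Longrightarrow> D \<noteq> B \<Longrightarrow> coord D x = coord D y" for x y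
    using that by (metis family_eqI)
  have zero_sum: "coord D (\<Sum>i<n. f i) = \<zero>\<^bsub>D\<^esub>"
    if "unital_cstar_algebra D" "\<And>i. i < n \<Longrightarrow> coord D (f i) = \<zero>\<^bsub>D\<^esub>" for D f
  proof -
    interpret D: unital_cstar_algebra D by fact
    have "(\<Oplus>\<^bsub>D\<^esub>i\<in>{..<n}. coord D (f i)) = (\<Oplus>\<^bsub>D\<^esub>i\<in>{..<n}. \<zero>\<^bsub>D\<^esub>)"
      by (rule D.finsum_cong') (use that in auto)
    then show ?thesis by (simp add: coord_sum that(1))
  qed
  have B_sum: "coord B (\<Sum>i<n. f i) = (\<Oplus>\<^bsub>B\<^esub>i\<in>{..<n}. g i)"
    if "\<And>i. i < n \<Longrightarrow> coord B (f i) = g i" for f g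
    unfolding coord_sum[OF cstar_B]
    by (rule B.finsum_cong') (use that coord_closed[OF cstar_B] in auto, metis coord_closed[OF cstar_B])
  have other: "coord D (embed B x * y) = \<zero>\<^bsub>D\<^esub>" "coord D (y * embed B x) = \<zero>\<^bsub>D\<^esub>"
    if "unital_cstar_algebra D" "D \<noteq> B" "x \<in> carrier B" for D x y
  proof -
    interpret D: unital_cstar_algebra D by fact
    show "coord D (embed B x * y) = \<zero>\<^bsub>D\<^esub>" "coord D (y * embed B x) = \<zero>\<^bsub>D\<^esub>"
      using that by (simp_all add: coord_mult ec coord_closed)
  qed
  have star_zero: "star D \<zero>\<^bsub>D\<^esub> = \<zero>\<^bsub>D\<^esub>" if "unital_cstar_algebra D" for D :: "'b cstar"
    using coord_adj[OF that, of 0] by (simp add: coord_zero that)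
  have null: "\<zero>\<^bsub>D\<^esub> \<otimes>\<^bsub>D\<^esub> x = \<zero>\<^bsub>D\<^esub>" "x \<otimes>\<^bsub>D\<^esub> \<zero>\<^bsub>D\<^esub> = \<zero>\<^bsub>D\<^esub>"
    if "unital_cstar_algebra D" "x \<in> carrier D" for D :: "'b cstar" and x
  proof -
    interpret D: unital_cstar_algebra D by fact
    show "\<zero>\<^bsub>D\<^esub> \<otimes>\<^bsub>D\<^esub> x = \<zero>\<^bsub>D\<^esub>" "x \<otimes>\<^bsub>D\<^esub> \<zero>\<^bsub>D\<^esub> = \<zero>\<^bsub>D\<^esub>" using that by simp_all
  qed
  have zero_closed: "\<zero>\<^bsub>D\<^esub> \<in> carrier D" if "unital_cstar_algebra D" for D :: "'b cstar"
    using coord_closed[OF that, of 0] by (simp add: coord_zero that)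
  show ?thesis
  proof
    show "adj unit_family = unit_family"
      by (rule eqI) (auto simp: simps star_zero)
    show "unit_family * unit_family = unit_family"
      by (rule eqI) (auto simp: simps null zero_closed)
    show "unit_family * x = x * unit_family" for x
      by (rule eqI) (auto simp: simps null coord_closed)
    show "F_family unit_family = unit_family"
      by (rule eqI) (auto simp: simps E_one incl_one)
    show "unit_family * x = (\<Sum>i<n. embed B (u i) * F_family (embed B (v i) * x))" for x
    proof (rule eqI)
      have "coord B (\<Sum>i<n. embed B (u i) * F_family (embed B (v i) * x))
        = (\<Oplus>\<^bsub>B\<^esub>i\<in>{..<n}. u i \<cdot> F (v i \<cdot> coord B x))"
        by (rule B_sum) (simp add: simps ec)
      then show "coord B (unit_family * x) =
          coord B (\<Sum>i<n. embed B (u i) * F_family (embed B (v i) * x))"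
        by (simp add: simps basis_left coord_closed)
      fix D assume D: "unital_cstar_algebra D" "D \<noteq> B"
      show "coord D (unit_family * x) =
          coord D (\<Sum>i<n. embed B (u i) * F_family (embed B (v i) * x))"
        by (subst zero_sum) (auto simp: other D)
    qed (simp add: simps)
    show "unit_family * x = (\<Sum>i<n. F_family (x * embed B (u i)) * embed B (v i))" for x
    proof (rule eqI)
      have "coord B (\<Sum>i<n. F_family (x * embed B (u i)) * embed B (v i))
        = (\<Oplus>\<^bsub>B\<^esub>i\<in>{..<n}. F (coord B x \<cdot> u i) \<cdot> v i)"
        by (rule B_sum) (simp add: simps ec)
      then show "coord B (unit_family * x) =
          coord B (\<Sum>i<n. F_family (x * embed B (u i)) * embed B (v i))"
        by (simp add: simps basis_right coord_closed)
      fix D assume D: "unital_cstar_algebra D" "D \<noteq> B"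
      show "coord D (unit_family * x) =
          coord D (\<Sum>i<n. F_family (x * embed B (u i)) * embed B (v i))"
        by (subst zero_sum) (auto simp: other D)
    qed (simp add: simps)
    show "(\<Sum>i<n. embed B (u i) * embed B (v i)) = 2 *\<^sub>R unit_family"
    proof (rule eqI)
      have "coord B (\<Sum>i<n. embed B (u i) * embed B (v i)) = (\<Oplus>\<^bsub>B\<^esub>i\<in>{..<n}. u i \<cdot> v i)"
        by (rule B_sum) (simp add: simps ec)
      then show "coord B (\<Sum>i<n. embed B (u i) * embed B (v i)) = coord B (2 *\<^sub>R unit_family)"
        by (simp add: simps index)
      fix D assume D: "unital_cstar_algebra D" "D \<noteq> B"
      interpret D: unital_cstar_algebra D by fact
      show "coord D (\<Sum>i<n. embed B (u i) * embed B (v i)) = coord D (2 *\<^sub>R unit_family)"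
        by (subst zero_sum) (auto simp: other D coord_scaleR ec)
    qed (simp add: simps scalar_part_embed)
  qed
qed

text \<open>\<open>adj_mult_kernel\<close> read off in the coordinate \<open>B\<close>.\<close>

lemma kernel_mult:
  assumes "b \<in> carrier B" "E b = \<zero>\<^bsub>A\<^esub>" "c \<in> carrier B" "E c = \<zero>\<^bsub>A\<^esub>"
  shows "F (b\<star> \<cdot> c) = b\<star> \<cdot> c"
proof -
  interpret index_two F_family unit_family n "\<lambda>i. embed B (u i)" "\<lambda>i. embed B (v i)"
    by (rule index_two_family)
  note ec = coord_embed[OF cstar_B]
  have 1: "unit_family * embed B x = embed B x" if "x \<in> carrier B" for x
  proof (rule family_eqI)
    fix D :: "'b cstar" assume D: "unital_cstar_algebra D"
    interpret D: unital_cstar_algebra D by fact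
    show "coord D (unit_family * embed B x) = coord D (embed B x)"
      using that by (auto simp: coord_mult D ec)
  qed (simp add: scalar_part_mult scalar_part_embed cstar_B that)
  have 2: "F_family (embed B x) = 0" if "x \<in> carrier B" "E x = \<zero>\<^bsub>A\<^esub>" for x
    by (rule family_eqI)
      (auto simp: coord_F_family scalar_part_F_family ec scalar_part_embed family_simps incl_zero
        cstar_B that)
  have "F_family (adj (embed B b) * embed B c) = adj (embed B b) * embed B c"
    by (rule adj_mult_kernel) (use 1 2 assms in auto)
  from arg_cong[OF this, of "coord B"] show ?thesis
    using assms by (simp add: coord_F_family coord_mult coord_adj cstar_B ec)
qed

end

context index2_extension
begin

text \<open>Not an axiom of \<open>cond_expectation\<close>: positivity implies it through
  \<open>F_adj\<close>, read off in the coordinate \<open>B\<close>.\<close>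

lemma E_star: "x \<in> carrier B \<Longrightarrow> E (x\<star>) = star A (E x)"
proof -
  interpret expectation F_family by (rule expectation_F_family)
  assume x: "x \<in> carrier B"
  from arg_cong[OF F_adj[of "embed B x"], of "coord B"]
  have "F (x\<star>) = (F x)\<star>"
    using x by (simp add: coord_F_family coord_adj cstar_B coord_embed)
  then have "\<iota> (E (x\<star>)) = \<iota> (star A (E x))" using x by (simp add: incl_star)
  then show ?thesis using x by (simp add: incl_eq_iff)
qed

text \<open>Contractivity, too, is a consequence of positivity; it is what makes the kernel of
  \<open>E\<close> closed later on.\<close>

lemma norm_E_le: "x \<in> carrier B \<Longrightarrow> cnorm A (E x) \<le> cnorm B x"
proof -
  interpret expectation F_family by (rule expectation_F_family)
  assume x: "x \<in> carrier B"
  have "cnorm A (E x) = cnorm B (coord B (F_family (embed B x)))"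
    using x by (simp add: coord_F_family cstar_B coord_embed norm_incl)
  also have "\<dots> \<le> norm (F_family (embed B x))" by (rule cnorm_coord_le[OF cstar_B])
  also have "\<dots> \<le> norm (embed B x)" by (rule norm_F_le)
  also have "\<dots> \<le> cnorm B x" by (rule norm_embed_le[OF cstar_B x])
  finally show ?thesis .
qed

end

section \<open>The kernel of the expectation\<close>

lemma additive_finsum:
  assumes G: "abelian_monoid G" and H: "abelian_monoid H"
    and h: "\<And>x. x \<in> carrier G \<Longrightarrow> h x \<in> carrier H"
    and add: "\<And>x y. x \<in> carrier G \<Longrightarrow> y \<in> carrier G \<Longrightarrow> h (x \<oplus>\<^bsub>G\<^esub> y) = h x \<oplus>\<^bsub>H\<^esub> h y"
    and zero: "h \<zero>\<^bsub>G\<^esub> = \<zero>\<^bsub>H\<^esub>"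
    and "finite S" "\<And>i. i \<in> S \<Longrightarrow> g i \<in> carrier G"
  shows "h (\<Oplus>\<^bsub>G\<^esub>i\<in>S. g i) = (\<Oplus>\<^bsub>H\<^esub>i\<in>S. h (g i))"
  using assms(6,7)
proof (induction S rule: finite_induct)
  case empty
  then show ?case by (simp add: abelian_monoid.finsum_empty G H zero)
next
  case (insert i S)
  then show ?case
    by (simp add: abelian_monoid.finsum_insert[OF G] abelian_monoid.finsum_insert[OF H] Pi_def
        h add abelian_monoid.finsum_closed[OF G])
qed

context index2_extension
begin

lemma B_abelian_monoid: "abelian_monoid B" and A_abelian_monoid: "abelian_monoid A"
  using B.abelian_monoid_axioms A.abelian_monoid_axioms by auto

lemma E_zero [simp]: "E \<zero>\<^bsub>B\<^esub> = \<zero>\<^bsub>A\<^esub>"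
  using E_smult[of "\<zero>\<^bsub>B\<^esub>" 0] by simp

lemma E_minus: "x \<in> carrier B \<Longrightarrow> E (\<ominus>\<^bsub>B\<^esub> x) = \<ominus>\<^bsub>A\<^esub> E x"
  using E_smult[of x "-1"] by (simp add: B.smult_minus_one A.smult_minus_one)

lemma E_diff: "x \<in> carrier B \<Longrightarrow> y \<in> carrier B \<Longrightarrow> E (x \<boxminus> y) = E x \<ominus>\<^bsub>A\<^esub> E y"
  by (simp add: a_minus_def E_add E_minus)

lemma star_zero [simp]: "\<zero>\<^bsub>B\<^esub>\<star> = \<zero>\<^bsub>B\<^esub>"
  using B.star_smult[of "\<zero>\<^bsub>B\<^esub>" 0] by simp

lemma star_minus: "x \<in> carrier B \<Longrightarrow> (\<ominus>\<^bsub>B\<^esub> x)\<star> = \<ominus>\<^bsub>B\<^esub> x\<star>"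
  using B.star_smult[of x "-1"] by (simp add: B.smult_minus_one)

lemma star_diff: "x \<in> carrier B \<Longrightarrow> y \<in> carrier B \<Longrightarrow> (x \<boxminus> y)\<star> = x\<star> \<boxminus> y\<star>"
  by (simp add: a_minus_def B.star_add star_minus)

lemma F_star: "x \<in> carrier B \<Longrightarrow> (F x)\<star> = F (x\<star>)"
  by (simp add: E_star incl_star)

lemma F_left: "x \<in> carrier B \<Longrightarrow> y \<in> carrier B \<Longrightarrow> F (F x \<cdot> y) = F x \<cdot> F y"
  and F_right: "x \<in> carrier B \<Longrightarrow> y \<in> carrier B \<Longrightarrow> F (x \<cdot> F y) = F x \<cdot> F y"
  by (simp_all add: E_left E_right incl_mult)

lemma E_F: "x \<in> carrier B \<Longrightarrow> E (F x) = E x"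
  by (simp add: E_incl)

definition N :: "'b set" where "N = {b \<in> carrier B. E b = \<zero>\<^bsub>A\<^esub>}"

lemma N_I: "b \<in> carrier B \<Longrightarrow> E b = \<zero>\<^bsub>A\<^esub> \<Longrightarrow> b \<in> N"
  and N_closed: "b \<in> N \<Longrightarrow> b \<in> carrier B" and N_E: "b \<in> N \<Longrightarrow> E b = \<zero>\<^bsub>A\<^esub>"
  by (simp_all add: N_def)

declare N_closed [simp] N_E [simp]

definition ker_part :: "'b \<Rightarrow> 'b" where "ker_part x = x \<boxminus> F x"

lemma ker_part_N [simp]: "x \<in> carrier B \<Longrightarrow> ker_part x \<in> N"
  by (rule N_I) (simp_all add: ker_part_def E_diff E_incl A.r_neg a_minus_def[of A])

lemma ker_part_of_N [simp]: "b \<in> N \<Longrightarrow> ker_part b = b"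
  by (simp add: ker_part_def a_minus_def[of B])

lemma decompose: "x \<in> carrier B \<Longrightarrow> x = F x \<boxplus> ker_part x"
  by (simp add: ker_part_def a_minus_def[of B] B.a_lcomm B.r_neg)

lemma N_zero [simp]: "\<zero>\<^bsub>B\<^esub> \<in> N"
  and N_add [simp]: "b \<in> N \<Longrightarrow> c \<in> N \<Longrightarrow> b \<boxplus> c \<in> N"
  and N_minus [simp]: "b \<in> N \<Longrightarrow> \<ominus>\<^bsub>B\<^esub> b \<in> N"
  and N_smult [simp]: "b \<in> N \<Longrightarrow> k \<odot>\<^bsub>B\<^esub> b \<in> N"
  and N_star [simp]: "b \<in> N \<Longrightarrow> b\<star> \<in> N"
  and N_left [simp]: "a \<in> carrier A \<Longrightarrow> b \<in> N \<Longrightarrow> \<iota> a \<cdot> b \<in> N"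
  and N_right [simp]: "a \<in> carrier A \<Longrightarrow> b \<in> N \<Longrightarrow> b \<cdot> \<iota> a \<in> N"
proof -
  have "star A \<zero>\<^bsub>A\<^esub> = \<zero>\<^bsub>A\<^esub>" using A.star_smult[of "\<zero>\<^bsub>A\<^esub>" 0] by simp
  then show "b \<in> N \<Longrightarrow> b\<star> \<in> N" by (intro N_I) (simp_all add: E_star)
qed (auto intro!: N_I simp: E_add E_minus E_smult E_left E_right A.V.smult_r_null)

lemma N_diff [simp]: "b \<in> N \<Longrightarrow> c \<in> N \<Longrightarrow> b \<boxminus> c \<in> N"
  by (simp add: a_minus_def)

lemma ker_part_left: "a \<in> carrier A \<Longrightarrow> x \<in> carrier B \<Longrightarrow> ker_part (\<iota> a \<cdot> x) = \<iota> a \<cdot> ker_part x"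
  and ker_part_right: "a \<in> carrier A \<Longrightarrow> x \<in> carrier B \<Longrightarrow> ker_part (x \<cdot> \<iota> a) = ker_part x \<cdot> \<iota> a"
  by (simp_all add: ker_part_def E_left E_right incl_mult a_minus_def B.r_distr B.l_distr B.r_minus B.l_minus)

lemma ker_part_add: "x \<in> carrier B \<Longrightarrow> y \<in> carrier B \<Longrightarrow> ker_part (x \<boxplus> y) = ker_part x \<boxplus> ker_part y"
  by (simp add: ker_part_def E_add incl_add a_minus_def B.minus_add B.a_ac)

lemma ker_part_smult: "x \<in> carrier B \<Longrightarrow> ker_part (c \<odot>\<^bsub>B\<^esub> x) = c \<odot>\<^bsub>B\<^esub> ker_part x"
  by (simp add: ker_part_def E_smult incl_smult a_minus_def B.V.smult_r_distr B.V.smult_r_minus)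

lemma ker_part_star: "x \<in> carrier B \<Longrightarrow> ker_part (x\<star>) = (ker_part x)\<star>"
  by (simp add: ker_part_def star_diff F_star)

end

context index2_basis
begin

text \<open>The grading relation: odd times odd is even.\<close>

lemma N_mult: "b \<in> N \<Longrightarrow> c \<in> N \<Longrightarrow> F (b \<cdot> c) = b \<cdot> c"
  using kernel_mult[of "b\<star>" c] N_star[of b] by (simp add: B.star_star)

text \<open>The product of \<open>b\<close> with the even part of \<open>x\<close> is odd and is
  killed by \<open>F\<close>; the product with the odd part is already even.\<close>

lemma N_mult_left: "b \<in> N \<Longrightarrow> x \<in> carrier B \<Longrightarrow> F (b \<cdot> x) = b \<cdot> ker_part x"
proof -
  assume b: "b \<in> N" and x: "x \<in> carrier B"
  have "b \<cdot> x = b \<cdot> (F x \<boxplus> ker_part x)" by (rule arg_cong[OF decompose[OF x]])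
  also have "\<dots> = b \<cdot> F x \<boxplus> b \<cdot> ker_part x" using b x by (intro B.r_distr) auto
  finally have "F (b \<cdot> x) = F (b \<cdot> F x \<boxplus> b \<cdot> ker_part x)" by (rule arg_cong)
  also have "\<dots> = b \<cdot> ker_part x"
    using b x by (simp add: E_add incl_add E_right N_mult)
  finally show ?thesis .
qed

lemma N_mult_right: "b \<in> N \<Longrightarrow> x \<in> carrier B \<Longrightarrow> F (x \<cdot> b) = ker_part x \<cdot> b"
proof -
  assume b: "b \<in> N" and x: "x \<in> carrier B"
  have "x \<cdot> b = (F x \<boxplus> ker_part x) \<cdot> b" by (rule arg_cong[OF decompose[OF x]])
  also have "\<dots> = F x \<cdot> b \<boxplus> ker_part x \<cdot> b" using b x by (intro B.l_distr) auto
  finally have "F (x \<cdot> b) = F (F x \<cdot> b \<boxplus> ker_part x \<cdot> b)" by (rule arg_cong)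
  also have "\<dots> = ker_part x \<cdot> b"
    using b x by (simp add: E_add incl_add E_left N_mult)
  finally show ?thesis .
qed

definition p :: "nat \<Rightarrow> 'b" where "p i = ker_part (u i)"
definition q :: "nat \<Rightarrow> 'b" where "q i = ker_part (v i)"

lemma p_N [simp]: "i < n \<Longrightarrow> p i \<in> N" and q_N [simp]: "i < n \<Longrightarrow> q i \<in> N"
  by (simp_all add: p_def q_def)

text \<open>The quasi-basis evaluated at the unit gives \<open>1\<close> for the sums of
  \<open>u i \<cdot> F (v i)\<close> and of \<open>F (u i) \<cdot> v i\<close>, and applying
  \<open>F\<close> gives \<open>1\<close> for the even parts. Of the index \<open>2\<close>, the
  even parts account for one unit and the odd parts for the other.\<close>

lemma sum_p_q: "(\<Oplus>\<^bsub>B\<^esub>i\<in>{..<n}. p i \<cdot> q i) = \<one>\<^bsub>B\<^esub>"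
proof -
  let ?S = "\<lambda>f. \<Oplus>\<^bsub>B\<^esub>i\<in>{..<n}. f i"
  have 1: "?S (\<lambda>i. u i \<cdot> F (v i)) = \<one>\<^bsub>B\<^esub>"
  proof -
    have "?S (\<lambda>i. u i \<cdot> F (v i)) = ?S (\<lambda>i. u i \<cdot> F (v i \<cdot> \<one>\<^bsub>B\<^esub>))"
      by (rule B.finsum_cong') auto
    then show ?thesis by (simp add: basis_left)
  qed
  have 2: "?S (\<lambda>i. F (u i) \<cdot> v i) = \<one>\<^bsub>B\<^esub>"
  proof -
    have "?S (\<lambda>i. F (u i) \<cdot> v i) = ?S (\<lambda>i. F (\<one>\<^bsub>B\<^esub> \<cdot> u i) \<cdot> v i)"
      by (rule B.finsum_cong') auto
    then show ?thesis by (simp add: basis_right)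
  qed
  have 3: "?S (\<lambda>i. F (u i) \<cdot> F (v i)) = \<one>\<^bsub>B\<^esub>"
  proof -
    have "F (?S (\<lambda>i. F (u i) \<cdot> v i)) = ?S (\<lambda>i. F (F (u i) \<cdot> v i))"
      by (rule additive_finsum[OF B_abelian_monoid B_abelian_monoid])
        (auto simp: E_add incl_add)
    also have "\<dots> = ?S (\<lambda>i. F (u i) \<cdot> F (v i))"
      by (rule B.finsum_cong') (auto simp: F_left)
    finally show ?thesis by (simp add: 2 E_one incl_one)
  qed
  \<comment> \<open>The expansion of
    \<open>(F (u i) \<boxplus> p i) \<cdot> (F (v i) \<boxplus> q i)\<close>, arranged with
    additions only so that the two known units can be cancelled at the end.\<close>
  have "?S (\<lambda>i. p i \<cdot> q i) \<boxplus> ?S (\<lambda>i. u i \<cdot> F (v i)) \<boxplus> ?S (\<lambda>i. F (u i) \<cdot> v i)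
      = ?S (\<lambda>i. p i \<cdot> q i \<boxplus> u i \<cdot> F (v i) \<boxplus> F (u i) \<cdot> v i)"
    by (subst B.finsum_addf, auto)+
  also have "\<dots> = ?S (\<lambda>i. u i \<cdot> v i \<boxplus> F (u i) \<cdot> F (v i))"
  proof (rule B.finsum_cong')
    fix i assume i: "i \<in> {..<n}"
    have uv: "u i = F (u i) \<boxplus> p i" "v i = F (v i) \<boxplus> q i"
      unfolding p_def q_def using i by (auto intro!: decompose)
    show "p i \<cdot> q i \<boxplus> u i \<cdot> F (v i) \<boxplus> F (u i) \<cdot> v i = u i \<cdot> v i \<boxplus> F (u i) \<cdot> F (v i)"
    proof -
      define a b c d where "a = F (u i)" "b = F (v i)" "c = p i" "d = q i"
      have [simp]: "a \<in> carrier B" "b \<in> carrier B" "c \<in> carrier B" "d \<in> carrier B"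
        using i by (auto simp: a_b_c_d_def)
      have "c \<cdot> d \<boxplus> (a \<boxplus> c) \<cdot> b \<boxplus> a \<cdot> (b \<boxplus> d) = (a \<boxplus> c) \<cdot> (b \<boxplus> d) \<boxplus> a \<cdot> b"
        by (simp add: B.l_distr B.r_distr B.a_ac)
      then show ?thesis using uv by (simp add: a_b_c_d_def)
    qed
  qed auto
  also have "\<dots> = ?S (\<lambda>i. u i \<cdot> v i) \<boxplus> ?S (\<lambda>i. F (u i) \<cdot> F (v i))"
    by (rule B.finsum_addf) auto
  also have "\<dots> = \<one>\<^bsub>B\<^esub> \<boxplus> \<one>\<^bsub>B\<^esub> \<boxplus> \<one>\<^bsub>B\<^esub>"
    using B.V.smult_l_distr[of 1 1 "\<one>\<^bsub>B\<^esub>"] by (simp add: 3 flip: index)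
  finally have "?S (\<lambda>i. p i \<cdot> q i) \<boxplus> \<one>\<^bsub>B\<^esub> \<boxplus> \<one>\<^bsub>B\<^esub> = \<one>\<^bsub>B\<^esub> \<boxplus> \<one>\<^bsub>B\<^esub> \<boxplus> \<one>\<^bsub>B\<^esub>"
    by (simp only: 1 2)
  moreover have "?S (\<lambda>i. p i \<cdot> q i) \<in> carrier B" by (rule B.finsum_closed) auto
  ultimately show ?thesis by simp
qed

end

section \<open>The basic construction\<close>

context index2_basis
begin

abbreviation Y where "Y \<equiv> extension_module P"
abbreviation C where "C \<equiv> adjointable_algebra A Y"
abbreviation cmult (infixl \<open>\<bullet>\<close> 70) where "S \<bullet> T \<equiv> S \<otimes>\<^bsub>C\<^esub> T"

lemma Y_simps [simp]:
  "carrier Y = carrier B" "\<zero>\<^bsub>Y\<^esub> = \<zero>\<^bsub>B\<^esub>" "x \<oplus>\<^bsub>Y\<^esub> y = x \<boxplus> y" "c \<odot>\<^bsub>Y\<^esub> x = c \<odot>\<^bsub>B\<^esub> x"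
  "rinner Y x y = E (x\<star> \<cdot> y)"
  by (simp_all add: extension_module_def Let_def)

abbreviation adjoint_pair where "adjoint_pair \<equiv> is_adjoint Y"

lemma adjoint_pair_iff: "adjoint_pair T S \<longleftrightarrow> S \<in> carrier B \<rightarrow>\<^sub>E carrier B \<and>
    (\<forall>x\<in>carrier B. \<forall>y\<in>carrier B. E ((T x)\<star> \<cdot> y) = E (x\<star> \<cdot> S y))"
  by (simp add: is_adjoint_def)

lemma C_simps:
  "carrier C = {T \<in> carrier B \<rightarrow>\<^sub>E carrier B. \<exists>S. adjoint_pair T S}"
  "S \<bullet> T = compose (carrier B) S T"
  "\<one>\<^bsub>C\<^esub> = (\<lambda>x\<in>carrier B. x)" "\<zero>\<^bsub>C\<^esub> = (\<lambda>x\<in>carrier B. \<zero>\<^bsub>B\<^esub>)"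
  "S \<oplus>\<^bsub>C\<^esub> T = (\<lambda>x\<in>carrier B. S x \<boxplus> T x)" "c \<odot>\<^bsub>C\<^esub> T = (\<lambda>x\<in>carrier B. c \<odot>\<^bsub>B\<^esub> T x)"
  "star C T = (THE S. adjoint_pair T S)" "cnorm C = op_norm A Y"
  by (simp_all add: adjointable_algebra_def)

text \<open>Nondegeneracy of the inner product comes from the quasi-basis, without any positivity.\<close>

lemma inner_eqI:
  assumes "x \<in> carrier B" "y \<in> carrier B" "\<And>w. w \<in> carrier B \<Longrightarrow> E (x\<star> \<cdot> w) = E (y\<star> \<cdot> w)"
  shows "x = y"
proof -
  have "(\<Oplus>\<^bsub>B\<^esub>i\<in>{..<n}. F (x\<star> \<cdot> u i) \<cdot> v i) = (\<Oplus>\<^bsub>B\<^esub>i\<in>{..<n}. F (y\<star> \<cdot> u i) \<cdot> v i)"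
    by (rule B.finsum_cong') (use assms in auto)
  then have "x\<star> = y\<star>" using assms by (simp add: basis_right)
  then show ?thesis using assms B.star_star by metis
qed

lemma inner_star: "x \<in> carrier B \<Longrightarrow> y \<in> carrier B \<Longrightarrow> star A (E (x\<star> \<cdot> y)) = E (y\<star> \<cdot> x)"
  by (simp add: B.star_mult B.star_star flip: E_star)

lemma inner_eqI':
  assumes "x \<in> carrier B" "y \<in> carrier B" "\<And>w. w \<in> carrier B \<Longrightarrow> E (w\<star> \<cdot> x) = E (w\<star> \<cdot> y)"
  shows "x = y"
proof (rule inner_eqI)
  fix w assume w: "w \<in> carrier B"
  show "E (x\<star> \<cdot> w) = E (y\<star> \<cdot> w)"
    using inner_star[OF w assms(1)] inner_star[OF w assms(2)] assms(3)[OF w] by simp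
qed (use assms in auto)

lemma op_closed: "T \<in> carrier C \<Longrightarrow> x \<in> carrier B \<Longrightarrow> T x \<in> carrier B"
  by (auto simp: C_simps)

lemma op_eqI:
  "S \<in> carrier C \<Longrightarrow> T \<in> carrier C \<Longrightarrow> (\<And>x. x \<in> carrier B \<Longrightarrow> S x = T x) \<Longrightarrow> S = T"
  by (auto simp: C_simps intro: PiE_ext)

lemma adjoint_pairI:
  assumes "\<And>x. x \<in> carrier B \<Longrightarrow> S x \<in> carrier B"
    and "\<And>x y. x \<in> carrier B \<Longrightarrow> y \<in> carrier B \<Longrightarrow> E ((T x)\<star> \<cdot> y) = E (x\<star> \<cdot> S y)"
  shows "adjoint_pair T (\<lambda>x\<in>carrier B. S x)"
  using assms by (auto simp: adjoint_pair_iff)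

lemma adjoint_pair_unique: "adjoint_pair T S \<Longrightarrow> adjoint_pair T S' \<Longrightarrow> S = S'"
  by (rule PiE_ext[of S "carrier B" "\<lambda>_. carrier B"])
    (auto simp: adjoint_pair_iff intro!: inner_eqI')

lemma star_C_eq: "adjoint_pair T S \<Longrightarrow> star C T = S"
  unfolding C_simps by (rule the_equality) (auto intro: adjoint_pair_unique)

lemma C_I: "T \<in> carrier B \<rightarrow>\<^sub>E carrier B \<Longrightarrow> adjoint_pair T S \<Longrightarrow> T \<in> carrier C"
  by (auto simp: C_simps)

lemma adjoint_pair_star: "T \<in> carrier C \<Longrightarrow> adjoint_pair T (star C T)"
proof -
  assume "T \<in> carrier C"
  then obtain S where "adjoint_pair T S" by (auto simp: C_simps(1))
  then show ?thesis using star_C_eq[of T S] by simp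
qed

lemma adjoint_pair_sym:
  "T \<in> carrier B \<rightarrow>\<^sub>E carrier B \<Longrightarrow> adjoint_pair T S \<Longrightarrow> adjoint_pair S T"
proof -
  assume T: "T \<in> carrier B \<rightarrow>\<^sub>E carrier B" and TS: "adjoint_pair T S"
  have S: "S \<in> carrier B \<rightarrow>\<^sub>E carrier B" using TS by (simp add: adjoint_pair_iff)
  have "E ((S x)\<star> \<cdot> y) = E (x\<star> \<cdot> T y)" if x: "x \<in> carrier B" and y: "y \<in> carrier B" for x y
  proof -
    have [simp]: "S x \<in> carrier B" "T y \<in> carrier B" using S T x y by auto
    have "E ((T y)\<star> \<cdot> x) = E (y\<star> \<cdot> S x)" using TS x y by (simp add: adjoint_pair_iff)
    from arg_cong[OF this, of "star A"] show ?thesis using x y by (simp add: inner_star)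
  qed
  then show ?thesis using T by (simp add: adjoint_pair_iff)
qed

lemma star_C_closed: "T \<in> carrier C \<Longrightarrow> star C T \<in> carrier C"
  by (rule C_I[OF _ adjoint_pair_sym[OF _ adjoint_pair_star]])
    (use adjoint_pair_star[of T] in \<open>auto simp: adjoint_pair_iff C_simps(1)\<close>)

lemma star_C_star: "T \<in> carrier C \<Longrightarrow> star C (star C T) = T"
  by (rule star_C_eq, rule adjoint_pair_sym) (auto simp: adjoint_pair_star, auto simp: C_simps(1))

lemma inner_op: "T \<in> carrier C \<Longrightarrow> x \<in> carrier B \<Longrightarrow> y \<in> carrier B \<Longrightarrow>
    E ((T x)\<star> \<cdot> y) = E (x\<star> \<cdot> star C T y)"
  using adjoint_pair_star[of T] by (simp add: adjoint_pair_iff)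

lemma inner_op': "T \<in> carrier C \<Longrightarrow> x \<in> carrier B \<Longrightarrow> y \<in> carrier B \<Longrightarrow>
    E (x\<star> \<cdot> T y) = E ((star C T x)\<star> \<cdot> y)"
  using inner_op[of "star C T" x y] by (simp add: star_C_star star_C_closed)

text \<open>Linearity comes from moving \<open>T\<close> to the other side of the nondegenerate
  inner product; scalars and the right action are treated alike.\<close>

lemma op_add: "T \<in> carrier C \<Longrightarrow> x \<in> carrier B \<Longrightarrow> y \<in> carrier B \<Longrightarrow> T (x \<boxplus> y) = T x \<boxplus> T y"
  by (rule inner_eqI)
    (simp_all add: op_closed inner_op B.star_add B.l_distr E_add star_C_closed)

lemma op_smult: "T \<in> carrier C \<Longrightarrow> x \<in> carrier B \<Longrightarrow> T (c \<odot>\<^bsub>B\<^esub> x) = c \<odot>\<^bsub>B\<^esub> T x"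
  by (rule inner_eqI)
    (simp_all add: op_closed inner_op B.star_smult B.smult_mult_left E_smult star_C_closed)

lemma op_right: "T \<in> carrier C \<Longrightarrow> x \<in> carrier B \<Longrightarrow> a \<in> carrier A \<Longrightarrow> T (x \<cdot> \<iota> a) = T x \<cdot> \<iota> a"
  by (rule inner_eqI)
    (simp_all add: op_closed inner_op B.star_mult B.m_assoc E_left star_C_closed flip: incl_star)

lemma op_zero: "T \<in> carrier C \<Longrightarrow> T \<zero>\<^bsub>B\<^esub> = \<zero>\<^bsub>B\<^esub>"
  using op_smult[of T "\<zero>\<^bsub>B\<^esub>" 0] by (simp add: op_closed)

lemma op_finsum:
  assumes "T \<in> carrier C" "\<And>i. i < k \<Longrightarrow> g i \<in> carrier B"
  shows "T (\<Oplus>\<^bsub>B\<^esub>i\<in>{..<k::nat}. g i) = (\<Oplus>\<^bsub>B\<^esub>i\<in>{..<k}. T (g i))"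
  by (rule additive_finsum[OF B_abelian_monoid B_abelian_monoid])
    (use assms in \<open>auto simp: op_add op_zero op_closed\<close>)

lemma op_expand:
  assumes "T \<in> carrier C" "x \<in> carrier B"
  shows "T x = (\<Oplus>\<^bsub>B\<^esub>i\<in>{..<n}. T (u i) \<cdot> F (v i \<cdot> x))"
proof -
  have "T x = T (\<Oplus>\<^bsub>B\<^esub>i\<in>{..<n}. u i \<cdot> F (v i \<cdot> x))" using assms by (simp add: basis_left)
  also have "\<dots> = (\<Oplus>\<^bsub>B\<^esub>i\<in>{..<n}. T (u i \<cdot> F (v i \<cdot> x)))"
    by (rule op_finsum) (use assms in auto)
  also have "\<dots> = (\<Oplus>\<^bsub>B\<^esub>i\<in>{..<n}. T (u i) \<cdot> F (v i \<cdot> x))"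
    by (rule B.finsum_cong') (use assms in \<open>auto simp: op_right op_closed\<close>)
  finally show ?thesis .
qed

lemma compose_closed: "S \<in> carrier C \<Longrightarrow> T \<in> carrier C \<Longrightarrow> S \<bullet> T \<in> carrier C"
proof -
  assume S: "S \<in> carrier C" and T: "T \<in> carrier C"
  have "adjoint_pair (compose (carrier B) S T) (compose (carrier B) (star C T) (star C S))"
    using S T unfolding compose_def
    by (intro adjoint_pairI) (auto simp: op_closed star_C_closed inner_op)
  moreover have "compose (carrier B) S T \<in> carrier B \<rightarrow>\<^sub>E carrier B"
    using S T by (auto simp: compose_def op_closed)
  ultimately show "S \<bullet> T \<in> carrier C" unfolding C_simps(2) by (rule C_I[rotated])
qed

lemma add_closed: "S \<in> carrier C \<Longrightarrow> T \<in> carrier C \<Longrightarrow> S \<oplus>\<^bsub>C\<^esub> T \<in> carrier C"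
proof -
  assume S: "S \<in> carrier C" and T: "T \<in> carrier C"
  have "adjoint_pair (S \<oplus>\<^bsub>C\<^esub> T) (star C S \<oplus>\<^bsub>C\<^esub> star C T)"
    using S T unfolding C_simps(5)
    by (intro adjoint_pairI)
      (auto simp: op_closed star_C_closed inner_op B.star_add B.l_distr B.r_distr E_add)
  moreover have "S \<oplus>\<^bsub>C\<^esub> T \<in> carrier B \<rightarrow>\<^sub>E carrier B"
    using S T by (auto simp: C_simps(5) op_closed)
  ultimately show "S \<oplus>\<^bsub>C\<^esub> T \<in> carrier C" by (rule C_I[rotated])
qed

lemma smult_closed: "T \<in> carrier C \<Longrightarrow> c \<odot>\<^bsub>C\<^esub> T \<in> carrier C"
proof -
  assume T: "T \<in> carrier C"
  have "adjoint_pair (c \<odot>\<^bsub>C\<^esub> T) (cnj c \<odot>\<^bsub>C\<^esub> star C T)"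
    using T unfolding C_simps(6)
    by (intro adjoint_pairI)
      (auto simp: op_closed star_C_closed inner_op B.star_smult B.smult_mult_left B.smult_mult_right E_smult)
  moreover have "c \<odot>\<^bsub>C\<^esub> T \<in> carrier B \<rightarrow>\<^sub>E carrier B"
    using T by (auto simp: C_simps(6) op_closed)
  ultimately show "c \<odot>\<^bsub>C\<^esub> T \<in> carrier C" by (rule C_I[rotated])
qed

lemma zero_closed: "\<zero>\<^bsub>C\<^esub> \<in> carrier C"
proof (rule C_I)
  show "adjoint_pair \<zero>\<^bsub>C\<^esub> \<zero>\<^bsub>C\<^esub>"
    unfolding C_simps by (rule adjoint_pairI) auto
qed (auto simp: C_simps)

lemma one_closed: "\<one>\<^bsub>C\<^esub> \<in> carrier C"
proof (rule C_I)
  show "adjoint_pair \<one>\<^bsub>C\<^esub> \<one>\<^bsub>C\<^esub>"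
    unfolding C_simps by (rule adjoint_pairI) auto
qed (auto simp: C_simps)

lemma C_apply: "x \<in> carrier B \<Longrightarrow> (S \<oplus>\<^bsub>C\<^esub> T) x = S x \<boxplus> T x"
  "x \<in> carrier B \<Longrightarrow> (c \<odot>\<^bsub>C\<^esub> T) x = c \<odot>\<^bsub>B\<^esub> T x"
  "x \<in> carrier B \<Longrightarrow> (S \<bullet> T) x = S (T x)"
  "x \<in> carrier B \<Longrightarrow> \<zero>\<^bsub>C\<^esub> x = \<zero>\<^bsub>B\<^esub>" "x \<in> carrier B \<Longrightarrow> \<one>\<^bsub>C\<^esub> x = x"
  by (simp_all add: C_simps compose_def)

lemmas C_closed = compose_closed add_closed smult_closed zero_closed one_closed star_C_closed

lemma cring_complex_ring: "cring complex_ring"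
  using A.V.R.is_cring by simp

lemma abelian_group_C: "abelian_group C"
proof (rule abelian_groupI)
  fix T assume T: "T \<in> carrier C"
  show "\<exists>S\<in>carrier C. S \<oplus>\<^bsub>C\<^esub> T = \<zero>\<^bsub>C\<^esub>"
    by (rule bexI[of _ "(-1) \<odot>\<^bsub>C\<^esub> T"], rule op_eqI)
      (auto simp: C_closed C_apply T op_closed B.smult_minus_one B.l_neg)
qed (auto intro!: op_eqI simp: C_closed C_apply op_closed B.a_ac)

lemma module_C: "module complex_ring C"
  by (rule moduleI[OF cring_complex_ring abelian_group_C])
    (auto intro!: op_eqI simp: C_closed C_apply op_closed B.V.smult_l_distr B.V.smult_r_distr
      B.V.smult_assoc1)

end

sublocale index2_basis \<subseteq> C: abelian_group "adjointable_algebra A (extension_module P)"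
  by (rule abelian_group_C)

context index2_basis
begin

lemma C_minus_apply: "S \<in> carrier C \<Longrightarrow> T \<in> carrier C \<Longrightarrow> x \<in> carrier B \<Longrightarrow> (S \<ominus>\<^bsub>C\<^esub> T) x = S x \<boxminus> T x"
proof -
  assume S: "S \<in> carrier C" and T: "T \<in> carrier C" and x: "x \<in> carrier B"
  have "\<ominus>\<^bsub>C\<^esub> T = (-1) \<odot>\<^bsub>C\<^esub> T"
  proof (rule C.minus_equality)
    show "(-1) \<odot>\<^bsub>C\<^esub> T \<oplus>\<^bsub>C\<^esub> T = \<zero>\<^bsub>C\<^esub>"
      by (rule op_eqI) (auto simp: C_closed C_apply T op_closed B.smult_minus_one B.l_neg)
  qed (auto simp: T smult_closed)
  then show ?thesis
    using S T x by (simp add: a_minus_def C_apply B.smult_minus_one op_closed)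
qed

lemma C_finsum_apply:
  assumes "\<And>i. i < k \<Longrightarrow> g i \<in> carrier C" "x \<in> carrier B"
  shows "(\<Oplus>\<^bsub>C\<^esub>i\<in>{..<k::nat}. g i) x = (\<Oplus>\<^bsub>B\<^esub>i\<in>{..<k}. g i x)"
  by (rule additive_finsum[where h = "\<lambda>T. T x", OF C.abelian_monoid_axioms B_abelian_monoid])
    (use assms in \<open>auto simp: C_apply op_closed\<close>)

abbreviation e where "e \<equiv> jones_proj P"
abbreviation l where "l \<equiv> left_mult P"

lemma e_apply: "x \<in> carrier B \<Longrightarrow> e x = F x"
  and l_apply: "x \<in> carrier B \<Longrightarrow> l b x = b \<cdot> x"
  by (simp_all add: jones_proj_def left_mult_def)

lemma e_closed: "e \<in> carrier C"
proof -
  have "adjoint_pair e e" unfolding jones_proj_def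
    by (rule adjoint_pairI) (auto simp: F_star E_left E_right E_star)
  then show "e \<in> carrier C" by (auto intro!: C_I simp: jones_proj_def)
qed

lemma l_closed: "b \<in> carrier B \<Longrightarrow> l b \<in> carrier C"
proof -
  assume b: "b \<in> carrier B"
  have "adjoint_pair (l b) (l (b\<star>))" unfolding left_mult_def
    by (rule adjoint_pairI) (use b in \<open>auto simp: B.star_mult B.m_assoc\<close>)
  then show "l b \<in> carrier C" using b by (auto intro!: C_I simp: left_mult_def)
qed

text \<open>\<open>T\<close> is right \<open>A\<close>-linear, hence determined by its values on the
  \<open>u i\<close>. This exhibits every adjointable operator as a sum of terms
  \<open>b e c\<close>.\<close>

lemma op_as_sum:
  assumes T: "T \<in> carrier C"
  shows "T = (\<Oplus>\<^bsub>C\<^esub>i\<in>{..<n}. l (T (u i)) \<bullet> (e \<bullet> l (v i)))"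
proof -
  have c: "l (T (u i)) \<bullet> (e \<bullet> l (v i)) \<in> carrier C" if "i < n" for i
    using that op_closed[OF T u_closed] by (intro compose_closed l_closed e_closed) auto
  show ?thesis
  proof (rule op_eqI[OF T])
    show "(\<Oplus>\<^bsub>C\<^esub>i\<in>{..<n}. l (T (u i)) \<bullet> (e \<bullet> l (v i))) \<in> carrier C"
      by (rule C.finsum_closed) (use c in auto)
    fix x assume x: "x \<in> carrier B"
    have "(\<Oplus>\<^bsub>B\<^esub>i\<in>{..<n}. T (u i) \<cdot> F (v i \<cdot> x))
      = (\<Oplus>\<^bsub>B\<^esub>i\<in>{..<n}. (l (T (u i)) \<bullet> (e \<bullet> l (v i))) x)"
      by (rule B.finsum_cong')
        (use x T c in \<open>auto simp: C_apply l_apply e_apply op_closed\<close>)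
    then show "T x = (\<Oplus>\<^bsub>C\<^esub>i\<in>{..<n}. l (T (u i)) \<bullet> (e \<bullet> l (v i))) x"
      using op_expand[OF T x] x c by (simp add: C_finsum_apply)
  qed
qed

text \<open>The linear span of \<open>b e c\<close> already contains every adjointable operator, so no closure is needed.\<close>

lemma basic_construction_eq: "basic_construction A P = C"
proof -
  let ?S = "insert e (l ` carrier B)"
  have sub: "cstar_subalgebra (carrier C) C"
    unfolding cstar_subalgebra_def
    using module.carrier_is_submodule[OF module_C] by (auto simp: C_closed)
  have gen: "?S \<subseteq> carrier C" by (auto intro: e_closed l_closed)
  have "carrier C \<subseteq> H" if H: "cstar_subalgebra H C" "?S \<subseteq> H" for H
  proof
    fix T assume T: "T \<in> carrier C"
    have sm: "submodule H complex_ring C" and mult: "\<And>x y. x \<in> H \<Longrightarrow> y \<in> H \<Longrightarrow> x \<bullet> y \<in> H"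
      using H(1) by (auto simp: cstar_subalgebra_def)
    have HC: "H \<subseteq> carrier C" and zero: "\<zero>\<^bsub>C\<^esub> \<in> H" and add: "\<And>x y. x \<in> H \<Longrightarrow> y \<in> H \<Longrightarrow> x \<oplus>\<^bsub>C\<^esub> y \<in> H"
      using module.submoduleE[OF module_C sm] submodule.axioms(1)[OF sm] subgroup.one_closed
      by fastforce+
    have sum: "(\<Oplus>\<^bsub>C\<^esub>i\<in>{..<k}. g i) \<in> H" if "\<And>i. i < k \<Longrightarrow> g i \<in> H" for g and k :: nat
      using that
    proof (induction k)
      case (Suc k)
      have "(\<Oplus>\<^bsub>C\<^esub>i\<in>{..<Suc k}. g i) = g k \<oplus>\<^bsub>C\<^esub> (\<Oplus>\<^bsub>C\<^esub>i\<in>{..<k}. g i)"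
        unfolding lessThan_Suc by (rule C.finsum_insert) (use Suc HC in auto)
      then show ?case using Suc add by simp
    qed (simp add: zero)
    have "(\<Oplus>\<^bsub>C\<^esub>i\<in>{..<n}. l (T (u i)) \<bullet> (e \<bullet> l (v i))) \<in> H"
      by (intro sum mult) (use H(2) op_closed[OF T u_closed] in auto)
    then show "T \<in> H" using op_as_sum[OF T] by simp
  qed
  then have "\<Inter>{H. cstar_subalgebra H C \<and> ?S \<subseteq> H} = carrier C"
    using sub gen by blast
  then show ?thesis
    by (simp add: basic_construction_def generated_cstar_def)
qed

end

lemma submodule_finsum:
  assumes M: "module R M" and H: "submodule H R M" and g: "\<And>i. i < k \<Longrightarrow> g i \<in> H"
  shows "(\<Oplus>\<^bsub>M\<^esub>i\<in>{..<k::nat}. g i) \<in> H"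
  using g
proof (induction k)
  case 0
  have "\<zero>\<^bsub>M\<^esub> \<in> H" using submodule.axioms(1)[OF H] subgroup.one_closed by fastforce
  then show ?case
    by (simp add: abelian_monoid.finsum_empty[OF abelian_group.axioms(1)[OF module.axioms(2)[OF M]]])
next
  case (Suc k)
  have HM: "H \<subseteq> carrier M" by (rule module.submoduleE(1)[OF M H])
  have "(\<Oplus>\<^bsub>M\<^esub>i\<in>{..<Suc k}. g i) = g k \<oplus>\<^bsub>M\<^esub> (\<Oplus>\<^bsub>M\<^esub>i\<in>{..<k}. g i)"
    unfolding lessThan_Suc
    by (rule abelian_monoid.finsum_insert[OF abelian_group.axioms(1)[OF module.axioms(2)[OF M]]])
      (use Suc HM in auto)
  then show ?case using Suc module.submoduleE(5)[OF M H] by simp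
qed

section \<open>The dual automorphism\<close>

context index2_basis
begin

lemma N_expand: "w \<in> carrier B \<Longrightarrow> (\<Oplus>\<^bsub>B\<^esub>i\<in>{..<n}. (w \<cdot> p i) \<cdot> q i) = w"
proof -
  assume w: "w \<in> carrier B"
  have "(\<Oplus>\<^bsub>B\<^esub>i\<in>{..<n}. w \<cdot> p i \<cdot> q i) = (\<Oplus>\<^bsub>B\<^esub>i\<in>{..<n}. w \<cdot> (p i \<cdot> q i))"
    by (rule B.finsum_cong') (use w in \<open>auto simp: B.m_assoc\<close>)
  also have "\<dots> = w \<cdot> (\<Oplus>\<^bsub>B\<^esub>i\<in>{..<n}. p i \<cdot> q i)"
    by (rule B.finsum_rdistr[symmetric]) (use w in auto)
  finally show ?thesis using w by (simp add: sum_p_q)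
qed

text \<open>Since \<open>1\<close> is the sum of the \<open>p i \<cdot> q i\<close>, an element is
  recovered from its products with the \<open>p i\<close>. Identities in \<open>B\<close> can thus
  be checked after multiplication by odd elements.\<close>

lemma N_cancel:
  assumes "x \<in> carrier B" "y \<in> carrier B" "\<And>c. c \<in> N \<Longrightarrow> x \<cdot> c = y \<cdot> c"
  shows "x = y"
proof -
  have "(\<Oplus>\<^bsub>B\<^esub>i\<in>{..<n}. x \<cdot> p i \<cdot> q i) = (\<Oplus>\<^bsub>B\<^esub>i\<in>{..<n}. y \<cdot> p i \<cdot> q i)"
    by (rule B.finsum_cong') (use assms in auto)
  then show ?thesis using assms by (simp add: N_expand)
qed

abbreviation f where "f \<equiv> \<one>\<^bsub>C\<^esub> \<ominus>\<^bsub>C\<^esub> e"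

lemma f_closed: "f \<in> carrier C"
  by (rule C.minus_closed[OF one_closed e_closed])

lemma f_apply: "x \<in> carrier B \<Longrightarrow> f x = ker_part x"
  by (simp add: C_minus_apply one_closed e_closed C_apply e_apply ker_part_def)

text \<open>The map \<open>b e c \<mapsto> b (1 - e) c\<close>; \<open>flip_N\<close> below characterises it, by \<open>N_cancel\<close>.\<close>

definition flip :: "('b \<Rightarrow> 'b) \<Rightarrow> 'b \<Rightarrow> 'b" where
  "flip T = (\<lambda>y\<in>carrier B. \<Oplus>\<^bsub>B\<^esub>i\<in>{..<n}. T (y \<cdot> p i) \<cdot> q i)"

lemma op_N_N:
  "T \<in> carrier C \<Longrightarrow> x \<in> carrier B \<Longrightarrow> b \<in> N \<Longrightarrow> c \<in> N \<Longrightarrow> T (x \<cdot> b \<cdot> c) = T x \<cdot> b \<cdot> c"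
proof -
  assume *: "T \<in> carrier C" "x \<in> carrier B" "b \<in> N" "c \<in> N"
  have "T (x \<cdot> b \<cdot> c) = T (x \<cdot> F (b \<cdot> c))" using * by (simp add: B.m_assoc N_mult)
  also have "\<dots> = T x \<cdot> F (b \<cdot> c)" using * by (simp add: op_right)
  also have "\<dots> = T x \<cdot> b \<cdot> c" using * by (simp add: B.m_assoc N_mult op_closed)
  finally show ?thesis .
qed

lemma flip_value_closed: "T \<in> carrier C \<Longrightarrow> y \<in> carrier B \<Longrightarrow> flip T y \<in> carrier B"
  unfolding flip_def by (auto intro!: B.finsum_closed simp: op_closed)

lemma flip_N:
  assumes T: "T \<in> carrier C" and y: "y \<in> carrier B" and c: "c \<in> N"
  shows "flip T y \<cdot> c = T (y \<cdot> c)"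
proof -
  have "flip T y \<cdot> c = (\<Oplus>\<^bsub>B\<^esub>i\<in>{..<n}. T (y \<cdot> p i) \<cdot> q i \<cdot> c)"
    unfolding flip_def using y c T
    by simp (rule B.finsum_ldistr, auto simp: op_closed)
  \<comment> \<open>\<open>q i \<cdot> c\<close> lies in \<open>A\<close> by the grading, so right
    \<open>A\<close>-linearity moves it inside \<open>T\<close>.\<close>
  also have "\<dots> = (\<Oplus>\<^bsub>B\<^esub>i\<in>{..<n}. T (y \<cdot> p i \<cdot> q i \<cdot> c))"
    by (rule B.finsum_cong') (use T y c in \<open>auto simp: op_N_N op_closed\<close>)
  also have "\<dots> = T (\<Oplus>\<^bsub>B\<^esub>i\<in>{..<n}. y \<cdot> p i \<cdot> q i \<cdot> c)"
    by (rule op_finsum[symmetric]) (use T y c in auto)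
  also have "(\<Oplus>\<^bsub>B\<^esub>i\<in>{..<n}. y \<cdot> p i \<cdot> q i \<cdot> c) = (\<Oplus>\<^bsub>B\<^esub>i\<in>{..<n}. y \<cdot> p i \<cdot> q i) \<cdot> c"
    by (rule B.finsum_ldistr[symmetric]) (use y c in auto)
  finally show ?thesis using y by (simp add: N_expand)
qed

lemma flip_N': "T \<in> carrier C \<Longrightarrow> y \<in> carrier B \<Longrightarrow> c \<in> N \<Longrightarrow> flip T (y \<cdot> c) = T y \<cdot> c"
  by (rule N_cancel) (simp_all add: flip_N flip_value_closed op_closed op_N_N)

text \<open>Between two odd factors the odd part of \<open>x\<close> yields an odd product, which
  \<open>E\<close> kills.\<close>

lemma E_N_N: "b \<in> N \<Longrightarrow> c \<in> N \<Longrightarrow> x \<in> carrier B \<Longrightarrow> E (b \<cdot> x \<cdot> c) = E (b \<cdot> F x \<cdot> c)"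
proof -
  assume *: "b \<in> N" "c \<in> N" "x \<in> carrier B"
  have "b \<cdot> x = b \<cdot> F x \<boxplus> b \<cdot> ker_part x"
    using * by (subst (1) decompose[of x]) (auto simp: B.r_distr)
  then have "b \<cdot> x \<cdot> c = b \<cdot> F x \<cdot> c \<boxplus> b \<cdot> ker_part x \<cdot> c"
    using * by (simp add: B.l_distr)
  moreover have "E (b \<cdot> ker_part x \<cdot> c) = \<zero>\<^bsub>A\<^esub>"
  proof -
    have "E (b \<cdot> ker_part x \<cdot> c) = E (F (b \<cdot> ker_part x) \<cdot> c)" using * by (simp add: N_mult)
    then show ?thesis using * by (simp add: E_left)
  qed
  ultimately show ?thesis using * by (simp add: E_add)
qed

lemma additive_B:
  assumes "\<And>x. x \<in> carrier B \<Longrightarrow> h x \<in> carrier A"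
    and "\<And>x y. x \<in> carrier B \<Longrightarrow> y \<in> carrier B \<Longrightarrow> h (x \<boxplus> y) = h x \<oplus>\<^bsub>A\<^esub> h y"
    and "\<And>i. i < k \<Longrightarrow> g i \<in> carrier B"
  shows "h (\<Oplus>\<^bsub>B\<^esub>i\<in>{..<k::nat}. g i) = (\<Oplus>\<^bsub>A\<^esub>i\<in>{..<k}. h (g i))"
proof (rule additive_finsum[OF B_abelian_monoid A_abelian_monoid])
  have "h \<zero>\<^bsub>B\<^esub> \<oplus>\<^bsub>A\<^esub> h \<zero>\<^bsub>B\<^esub> = h \<zero>\<^bsub>B\<^esub>" using assms(2)[of "\<zero>\<^bsub>B\<^esub>" "\<zero>\<^bsub>B\<^esub>"] by simp
  then show "h \<zero>\<^bsub>B\<^esub> = \<zero>\<^bsub>A\<^esub>" using assms(1)[of "\<zero>\<^bsub>B\<^esub>"] by simp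
qed (use assms in auto)

text \<open>Every \<open>w\<close> is the sum of the products
  \<open>(w \<cdot> p i) \<cdot> q i\<close>, so additive maps are determined on elements
  \<open>x \<cdot> c\<close> with \<open>c\<close> odd, where \<open>flip\<close> has the closed
  form \<open>flip_N'\<close>.\<close>

lemma additive_eqI:
  assumes "\<And>x. x \<in> carrier B \<Longrightarrow> h x \<in> carrier A" "\<And>x. x \<in> carrier B \<Longrightarrow> h' x \<in> carrier A"
    and "\<And>x y. x \<in> carrier B \<Longrightarrow> y \<in> carrier B \<Longrightarrow> h (x \<boxplus> y) = h x \<oplus>\<^bsub>A\<^esub> h y"
    and "\<And>x y. x \<in> carrier B \<Longrightarrow> y \<in> carrier B \<Longrightarrow> h' (x \<boxplus> y) = h' x \<oplus>\<^bsub>A\<^esub> h' y"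
    and eq: "\<And>x c. x \<in> carrier B \<Longrightarrow> c \<in> N \<Longrightarrow> h (x \<cdot> c) = h' (x \<cdot> c)"
    and w: "w \<in> carrier B"
  shows "h w = h' w"
proof -
  have "h w = h (\<Oplus>\<^bsub>B\<^esub>i\<in>{..<n}. w \<cdot> p i \<cdot> q i)" using w by (simp add: N_expand)
  also have "\<dots> = (\<Oplus>\<^bsub>A\<^esub>i\<in>{..<n}. h (w \<cdot> p i \<cdot> q i))"
    by (rule additive_B) (use assms in auto)
  also have "\<dots> = (\<Oplus>\<^bsub>A\<^esub>i\<in>{..<n}. h' (w \<cdot> p i \<cdot> q i))"
    by (rule A.finsum_cong') (use assms in auto)
  also have "\<dots> = h' (\<Oplus>\<^bsub>B\<^esub>i\<in>{..<n}. w \<cdot> p i \<cdot> q i)"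
    by (rule additive_B[symmetric]) (use assms in auto)
  finally show ?thesis using w by (simp add: N_expand)
qed

lemma flip_add_arg: "T \<in> carrier C \<Longrightarrow> x \<in> carrier B \<Longrightarrow> y \<in> carrier B \<Longrightarrow>
    flip T (x \<boxplus> y) = flip T x \<boxplus> flip T y"
  by (rule N_cancel) (simp_all add: flip_value_closed B.l_distr flip_N op_add)

text \<open>On \<open>x \<cdot> c\<close> and \<open>y \<cdot> d\<close> the inner product is
  \<open>E\<close> of \<open>(T x)\<star> \<cdot> y\<close> between two odd factors. There only its
  even part counts, and that is the inner product to which adjointness of \<open>T\<close> applies.
  \<open>additive_eqI\<close> then frees both arguments.\<close>

lemma adjoint_pair_flip:
  assumes T: "T \<in> carrier C"
  shows "adjoint_pair (flip T) (flip (star C T))"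
proof -
  let ?S = "star C T"
  have S: "?S \<in> carrier C" by (rule star_C_closed[OF T])
  have 1: "E ((flip T (x \<cdot> c))\<star> \<cdot> (y \<cdot> d)) = E ((x \<cdot> c)\<star> \<cdot> flip ?S (y \<cdot> d))"
    if "x \<in> carrier B" "c \<in> N" "y \<in> carrier B" "d \<in> N" for x y c d
  proof -
    note [simp] = op_closed[OF T] op_closed[OF S]
    have "E ((flip T (x \<cdot> c))\<star> \<cdot> (y \<cdot> d)) = E (c\<star> \<cdot> ((T x)\<star> \<cdot> y) \<cdot> d)"
      using that by (simp add: flip_N' T B.star_mult B.m_assoc)
    also have "\<dots> = E (c\<star> \<cdot> F ((T x)\<star> \<cdot> y) \<cdot> d)"
      by (rule E_N_N) (use that in auto)
    also have "E ((T x)\<star> \<cdot> y) = E (x\<star> \<cdot> ?S y)" by (rule inner_op[OF T]) (use that in auto)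
    also have "E (c\<star> \<cdot> F (x\<star> \<cdot> ?S y) \<cdot> d) = E (c\<star> \<cdot> (x\<star> \<cdot> ?S y) \<cdot> d)"
      by (rule E_N_N[symmetric]) (use that in auto)
    finally show ?thesis
      using that by (simp add: flip_N' S B.star_mult B.m_assoc)
  qed
  have 2: "E ((flip T x)\<star> \<cdot> (y \<cdot> d)) = E (x\<star> \<cdot> flip ?S (y \<cdot> d))"
    if "x \<in> carrier B" "y \<in> carrier B" "d \<in> N" for x y d
  proof -
    have "star A (E ((flip T x)\<star> \<cdot> (y \<cdot> d))) = star A (E (x\<star> \<cdot> flip ?S (y \<cdot> d)))"
    proof (rule additive_eqI[of "\<lambda>x. star A (E ((flip T x)\<star> \<cdot> (y \<cdot> d)))"
          "\<lambda>x. star A (E (x\<star> \<cdot> flip ?S (y \<cdot> d)))" x])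
    qed (use that in \<open>auto simp: flip_value_closed T S flip_add_arg B.star_add B.l_distr E_add A.star_add 1\<close>)
    then show ?thesis
      using that A.star_star by (metis A.star_star E_closed B.m_closed B.star_closed N_closed flip_value_closed T S)
  qed
  have 3: "E ((flip T x)\<star> \<cdot> y) = E (x\<star> \<cdot> flip ?S y)"
    if "x \<in> carrier B" "y \<in> carrier B" for x y
  proof (rule additive_eqI[of "\<lambda>y. E ((flip T x)\<star> \<cdot> y)" "\<lambda>y. E (x\<star> \<cdot> flip ?S y)" y])
  qed (use that in \<open>auto simp: flip_value_closed T S flip_add_arg B.r_distr E_add 2\<close>)
  have "flip ?S \<in> carrier B \<rightarrow>\<^sub>E carrier B"
    using flip_value_closed[OF S] by (auto simp: flip_def)
  then show ?thesis using 3 by (simp add: adjoint_pair_iff)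
qed

lemma flip_closed: "T \<in> carrier C \<Longrightarrow> flip T \<in> carrier C"
  by (rule C_I[OF _ adjoint_pair_flip]) (use flip_value_closed in \<open>auto simp: flip_def\<close>)

lemma flip_star: "T \<in> carrier C \<Longrightarrow> flip (star C T) = star C (flip T)"
  by (rule star_C_eq[symmetric]) (rule adjoint_pair_flip)

lemma flip_eqI:
  assumes "T \<in> carrier C" "S \<in> carrier C"
    and "\<And>y c. y \<in> carrier B \<Longrightarrow> c \<in> N \<Longrightarrow> T (y \<cdot> c) = S y \<cdot> c"
  shows "flip T = S"
proof (rule op_eqI[OF flip_closed[OF assms(1)] assms(2)])
  fix y assume y: "y \<in> carrier B"
  show "flip T y = S y"
    by (rule N_cancel) (use assms y in \<open>auto simp: flip_N flip_value_closed op_closed\<close>)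
qed

lemma flip_flip: "T \<in> carrier C \<Longrightarrow> flip (flip T) = T"
  by (rule flip_eqI) (auto simp: flip_closed flip_N')

lemma flip_mult: "S \<in> carrier C \<Longrightarrow> T \<in> carrier C \<Longrightarrow> flip (S \<bullet> T) = flip S \<bullet> flip T"
  by (rule flip_eqI) (auto simp: C_closed flip_closed C_apply flip_N flip_value_closed)

lemma flip_add: "S \<in> carrier C \<Longrightarrow> T \<in> carrier C \<Longrightarrow> flip (S \<oplus>\<^bsub>C\<^esub> T) = flip S \<oplus>\<^bsub>C\<^esub> flip T"
  by (rule flip_eqI) (auto simp: C_closed flip_closed C_apply flip_N flip_value_closed B.l_distr)

lemma flip_smult: "T \<in> carrier C \<Longrightarrow> flip (c \<odot>\<^bsub>C\<^esub> T) = c \<odot>\<^bsub>C\<^esub> flip T"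
  by (rule flip_eqI) (auto simp: C_closed flip_closed C_apply flip_N flip_value_closed B.smult_mult_left)

lemma flip_one: "flip \<one>\<^bsub>C\<^esub> = \<one>\<^bsub>C\<^esub>"
  by (rule flip_eqI) (auto simp: C_closed C_apply)

lemma flip_l: "b \<in> carrier B \<Longrightarrow> flip (l b) = l b"
  by (rule flip_eqI) (auto simp: l_closed l_apply B.m_assoc)

lemma flip_e: "flip e = f"
  by (rule flip_eqI) (auto simp: e_closed f_closed e_apply f_apply N_mult_right)

lemma star_iso_flip: "star_iso C C (\<lambda>T\<in>carrier C. flip T)"
  unfolding star_iso_def star_hom_def
proof (intro conjI ballI allI)
  show "(\<lambda>T\<in>carrier C. flip T) \<in> ring_hom C C"
    by (rule ring_hom_memI) (auto simp: C_closed flip_closed flip_mult flip_add flip_one)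
  show "bij_betw (\<lambda>T\<in>carrier C. flip T) (carrier C) (carrier C)"
    by (rule bij_betw_byWitness[where f' = "\<lambda>T\<in>carrier C. flip T"])
      (auto simp: flip_closed flip_flip)
qed (auto simp: C_closed flip_smult flip_star)

text \<open>Uniqueness: by \<open>op_as_sum\<close> every operator is built from left
  multiplications and \<open>e\<close>, so both \<open>\<beta>\<close> and \<open>flip\<close> must
  take \<open>T\<close> to the same sum with \<open>f\<close> in place of \<open>e\<close>.\<close>

lemma dual_auto_eq: "dual_auto A P = (\<lambda>T\<in>carrier C. flip T)"
  unfolding dual_auto_def Let_def basic_construction_eq
proof (rule the_equality)
  show "(\<lambda>T\<in>carrier C. flip T) \<in> extensional (carrier C) \<and> star_iso C C (\<lambda>T\<in>carrier C. flip T) \<and>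
      (\<forall>b\<in>carrier B. (\<lambda>T\<in>carrier C. flip T) (l b) = l b) \<and> (\<lambda>T\<in>carrier C. flip T) e = f"
    by (auto simp: star_iso_flip l_closed e_closed flip_l flip_e)
next
  fix \<beta> assume b: "\<beta> \<in> extensional (carrier C) \<and> star_iso C C \<beta> \<and>
      (\<forall>b\<in>carrier B. \<beta> (l b) = l b) \<and> \<beta> e = f"
  have hom_eq: "h T = (\<Oplus>\<^bsub>C\<^esub>i\<in>{..<n}. l (T (u i)) \<bullet> (f \<bullet> l (v i)))"
    if h: "h \<in> ring_hom C C" "\<forall>b\<in>carrier B. h (l b) = l b" "h e = f" and T: "T \<in> carrier C" for h T
  proof -
    have c: "l (T (u i)) \<bullet> (e \<bullet> l (v i)) \<in> carrier C" if "i < n" for i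
      using that op_closed[OF T u_closed] by (intro compose_closed l_closed e_closed) auto
    have c': "l (T (u i)) \<bullet> (f \<bullet> l (v i)) \<in> carrier C" if "i < n" for i
      using that op_closed[OF T u_closed] by (intro compose_closed l_closed f_closed) auto
    have "h \<zero>\<^bsub>C\<^esub> \<oplus>\<^bsub>C\<^esub> h \<zero>\<^bsub>C\<^esub> = h \<zero>\<^bsub>C\<^esub>"
      using ring_hom_add[OF h(1) zero_closed zero_closed] by simp
    then have h0: "h \<zero>\<^bsub>C\<^esub> = \<zero>\<^bsub>C\<^esub>"
      using ring_hom_closed[OF h(1) zero_closed] by simp
    have "h T = h (\<Oplus>\<^bsub>C\<^esub>i\<in>{..<n}. l (T (u i)) \<bullet> (e \<bullet> l (v i)))"
      using op_as_sum[OF T] by (rule arg_cong)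
    also have "\<dots> = (\<Oplus>\<^bsub>C\<^esub>i\<in>{..<n}. h (l (T (u i)) \<bullet> (e \<bullet> l (v i))))"
      by (rule additive_finsum[OF C.abelian_monoid_axioms C.abelian_monoid_axioms])
        (use c h0 ring_hom_closed[OF h(1)] ring_hom_add[OF h(1)] in auto)
    also have "\<dots> = (\<Oplus>\<^bsub>C\<^esub>i\<in>{..<n}. l (T (u i)) \<bullet> (f \<bullet> l (v i)))"
    proof (rule C.finsum_cong')
      fix i assume "i \<in> {..<n}"
      then show "h (l (T (u i)) \<bullet> (e \<bullet> l (v i))) = l (T (u i)) \<bullet> (f \<bullet> l (v i))"
        using ring_hom_mult[OF h(1)] h op_closed[OF T u_closed]
        by (simp add: compose_closed l_closed e_closed)
    qed (use c' in auto)
    finally show ?thesis .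
  qed
  show "\<beta> = (\<lambda>T\<in>carrier C. flip T)"
  proof (rule extensionalityI)
    fix T assume T: "T \<in> carrier C"
    have "\<beta> T = (\<Oplus>\<^bsub>C\<^esub>i\<in>{..<n}. l (T (u i)) \<bullet> (f \<bullet> l (v i)))"
      by (rule hom_eq) (use b T in \<open>auto simp: star_iso_def star_hom_def\<close>)
    moreover have "(\<lambda>T\<in>carrier C. flip T) T = (\<Oplus>\<^bsub>C\<^esub>i\<in>{..<n}. l (T (u i)) \<bullet> (f \<bullet> l (v i)))"
    proof (rule hom_eq[OF _ _ _ T])
      show "(\<lambda>T\<in>carrier C. flip T) \<in> ring_hom C C"
        using star_iso_flip by (simp add: star_iso_def star_hom_def)
    qed (auto simp: l_closed e_closed flip_l flip_e)
    ultimately show "\<beta> T = (\<lambda>T\<in>carrier C. flip T) T" by simp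
  qed (use b in auto)
qed

end

section \<open>The bimodule of an extension\<close>

context index2_basis
begin

text \<open>The element \<open>e b (1 - e)\<close> of the bimodule.\<close>

definition xop :: "'b \<Rightarrow> 'b \<Rightarrow> 'b" where "xop b = (\<lambda>y\<in>carrier B. F (b \<cdot> y))"

abbreviation X where "X \<equiv> bimodule_of A P"

lemma xop_apply: "y \<in> carrier B \<Longrightarrow> xop b y = F (b \<cdot> y)"
  by (simp add: xop_def)

lemma xop_corner: "b \<in> N \<Longrightarrow> xop b = e \<bullet> l b \<bullet> f"
proof (rule PiE_ext[of _ "carrier B" "\<lambda>_. carrier B"])
  assume b: "b \<in> N"
  show "xop b \<in> carrier B \<rightarrow>\<^sub>E carrier B" using b by (auto simp: xop_def)
  have "e \<bullet> l b \<bullet> f \<in> carrier C" using b by (simp add: C_closed e_closed l_closed f_closed)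
  then show "e \<bullet> l b \<bullet> f \<in> carrier B \<rightarrow>\<^sub>E carrier B" by (simp add: C_simps(1))
  fix x assume "x \<in> carrier B"
  then show "xop b x = (e \<bullet> l b \<bullet> f) x"
    using b by (simp add: xop_apply C_apply f_apply l_apply e_apply N_mult_left)
qed

lemma xop_closed: "b \<in> N \<Longrightarrow> xop b \<in> carrier C"
  by (simp add: xop_corner C_closed e_closed l_closed f_closed)

lemma corner_xop:
  assumes T: "T \<in> carrier C"
  shows "\<exists>b\<in>N. e \<bullet> T \<bullet> f = xop b"
proof
  \<comment> \<open>The functional sending \<open>y\<close> to \<open>E (T y)\<close> is represented
    by \<open>c\<close>: move \<open>T\<close> to the unit by adjointness. Only the odd part of
    \<open>c\<close> survives against the arguments \<open>ker_part y\<close>.\<close>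
  define c where "c = (star C T \<one>\<^bsub>B\<^esub>)\<star>"
  have c: "c \<in> carrier B" using op_closed[OF star_C_closed[OF T]] by (simp add: c_def)
  show "ker_part c \<in> N" using c by simp
  show "e \<bullet> T \<bullet> f = xop (ker_part c)"
  proof (rule op_eqI)
    fix y assume y: "y \<in> carrier B"
    have "E (T (ker_part y)) = E (c \<cdot> ker_part y)"
      using inner_op'[OF T, of "\<one>\<^bsub>B\<^esub>" "ker_part y"] y op_closed[OF T] by (simp add: B.star_one c_def)
    then show "(e \<bullet> T \<bullet> f) y = xop (ker_part c) y"
      using c y T by (simp add: xop_apply C_apply f_apply e_apply op_closed N_mult_left N_mult_right)
  qed (use c T in \<open>auto simp: xop_closed C_closed e_closed f_closed\<close>)
qed

lemma carrier_X: "carrier X = xop ` N"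
proof -
  have "carrier X = {e \<bullet> T \<bullet> f |T. T \<in> carrier C}"
    by (simp only: bimodule_of_def basic_construction_eq Let_def partial_object.select_convs)
  also have "\<dots> = xop ` N"
  proof (intro equalityI subsetI)
    fix x assume "x \<in> {e \<bullet> T \<bullet> f |T. T \<in> carrier C}"
    then obtain T where T: "T \<in> carrier C" "x = e \<bullet> T \<bullet> f" by blast
    from corner_xop[OF T(1)] show "x \<in> xop ` N" by (auto simp only: T(2))
  next
    fix x assume "x \<in> xop ` N"
    then obtain b where b: "b \<in> N" "x = xop b" by blast
    have "l b \<in> carrier C" by (rule l_closed[OF N_closed[OF b(1)]])
    then show "x \<in> {e \<bullet> T \<bullet> f |T. T \<in> carrier C}"
      unfolding b(2) xop_corner[OF b(1)] by blast
  qed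
  finally show ?thesis .
qed

lemma xop_eqI: "b \<in> carrier B \<Longrightarrow> (\<And>y. y \<in> carrier B \<Longrightarrow> T y = F (b \<cdot> y)) \<Longrightarrow> T \<in> carrier C \<Longrightarrow> T = xop b"
  unfolding xop_def C_simps(1) by (auto intro!: ext simp: PiE_def extensional_def)

lemma xop_inj: "inj_on xop N"
proof (rule inj_onI)
  fix b c assume b: "b \<in> N" and c: "c \<in> N" and eq: "xop b = xop c"
  show "b = c"
  proof (rule N_cancel)
    fix d assume d: "d \<in> N"
    from fun_cong[OF eq, of d] show "b \<cdot> d = c \<cdot> d" using b c d by (simp add: xop_apply N_mult)
  qed (use b c in auto)
qed

lemma star_xop:
  assumes b: "b \<in> N"
  shows "star C (xop b) = l (b\<star>) \<bullet> e"
proof -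
  have "star C (xop b) y = (l (b\<star>) \<bullet> e) y" if y: "y \<in> carrier B" for y
  proof (rule inner_eqI')
    fix w assume w: "w \<in> carrier B"
    have "E (w\<star> \<cdot> star C (xop b) y) = E ((F (b \<cdot> w))\<star> \<cdot> y)"
      using inner_op[OF xop_closed[OF b] w y] w by (simp add: xop_apply)
    also have "\<dots> = E (w\<star> \<cdot> (b\<star> \<cdot> F y))"
      using b w y by (simp add: F_star E_left E_right B.star_mult flip: B.m_assoc)
    finally show "E (w\<star> \<cdot> star C (xop b) y) = E (w\<star> \<cdot> (l (b\<star>) \<bullet> e) y)"
      using y by (simp add: C_apply l_apply e_apply)
  qed (use b y op_closed[OF star_C_closed[OF xop_closed]] in \<open>auto simp: C_apply l_apply e_apply\<close>)
  then show ?thesis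
    using b by (intro op_eqI) (auto simp: C_closed xop_closed l_closed e_closed)
qed

lemma X_simps:
  "x \<oplus>\<^bsub>X\<^esub> y = x \<oplus>\<^bsub>C\<^esub> y" "c \<odot>\<^bsub>X\<^esub> x = c \<odot>\<^bsub>C\<^esub> x" "\<zero>\<^bsub>X\<^esub> = \<zero>\<^bsub>C\<^esub>"
  "ract X x a = x \<bullet> l (\<iota> a)" "lact X a x = l (\<iota> a) \<bullet> x"
  "rinner X x y = (THE c. c \<in> carrier A \<and> l (\<iota> c) \<bullet> f = star C x \<bullet> y)"
  "linner X x y = (THE c. c \<in> carrier A \<and> l (\<iota> c) \<bullet> e = x \<bullet> star C y)"
  "sharp X x = dual_auto A P (star C x)"
  by (simp_all add: bimodule_of_def basic_construction_eq Let_def)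

lemma xop_add: "b \<in> N \<Longrightarrow> c \<in> N \<Longrightarrow> xop b \<oplus>\<^bsub>X\<^esub> xop c = xop (b \<boxplus> c)"
  unfolding X_simps
  by (rule xop_eqI) (simp_all add: C_closed xop_closed C_apply xop_apply B.l_distr E_add incl_add)

lemma xop_smult: "b \<in> N \<Longrightarrow> k \<odot>\<^bsub>X\<^esub> xop b = xop (k \<odot>\<^bsub>B\<^esub> b)"
  unfolding X_simps
  by (rule xop_eqI) (simp_all add: C_closed xop_closed C_apply xop_apply B.smult_mult_left E_smult incl_smult)

lemma xop_zero: "\<zero>\<^bsub>X\<^esub> = xop \<zero>\<^bsub>B\<^esub>"
  unfolding X_simps
  by (rule xop_eqI) (simp_all add: C_closed C_apply)

lemma xop_lact: "a \<in> carrier A \<Longrightarrow> b \<in> N \<Longrightarrow> lact X a (xop b) = xop (\<iota> a \<cdot> b)"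
  unfolding X_simps
  by (rule xop_eqI) (simp_all add: C_closed xop_closed l_closed C_apply xop_apply l_apply B.m_assoc E_left incl_mult)

lemma xop_ract: "a \<in> carrier A \<Longrightarrow> b \<in> N \<Longrightarrow> ract X (xop b) a = xop (b \<cdot> \<iota> a)"
  unfolding X_simps
  by (rule xop_eqI) (simp_all add: C_closed xop_closed l_closed C_apply xop_apply l_apply B.m_assoc)

lemma xop_linner:
  assumes b: "b \<in> N" and c: "c \<in> N"
  shows "linner X (xop b) (xop c) = E (b \<cdot> c\<star>)"
  unfolding X_simps
proof (rule the_equality)
  show "E (b \<cdot> c\<star>) \<in> carrier A \<and> l (F (b \<cdot> c\<star>)) \<bullet> e = xop b \<bullet> star C (xop c)"
  proof
    show "l (F (b \<cdot> c\<star>)) \<bullet> e = xop b \<bullet> star C (xop c)"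
      unfolding star_xop[OF c]
      by (rule op_eqI) (use b c in \<open>simp_all add: C_closed xop_closed l_closed e_closed C_apply
          l_apply e_apply xop_apply E_right incl_mult flip: B.m_assoc\<close>)
  qed (use b c in auto)
  fix a assume "a \<in> carrier A \<and> l (\<iota> a) \<bullet> e = xop b \<bullet> star C (xop c)"
  then have a: "a \<in> carrier A" and eq: "l (\<iota> a) \<bullet> e = xop b \<bullet> (l (c\<star>) \<bullet> e)"
    by (simp_all add: star_xop[OF c])
  \<comment> \<open>The unit is fixed by \<open>e\<close>, so evaluation there isolates the
    coefficient.\<close>
  from fun_cong[OF eq, of "\<one>\<^bsub>B\<^esub>"] show "a = E (b \<cdot> c\<star>)"
    using a b c by (simp add: C_apply l_apply e_apply E_one incl_one xop_apply incl_eq_iff)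
qed

lemma xop_rinner:
  assumes b: "b \<in> N" and c: "c \<in> N"
  shows "rinner X (xop b) (xop c) = E (b\<star> \<cdot> c)"
  unfolding X_simps
proof (rule the_equality)
  have bc: "F (b\<star> \<cdot> c) = b\<star> \<cdot> c" using b c by (intro N_mult) auto
  have eq: "(star C (xop b) \<bullet> xop c) y = b\<star> \<cdot> c \<cdot> ker_part y" if "y \<in> carrier B" for y
    using b c that by (simp add: star_xop C_apply l_apply e_apply xop_apply N_mult_left N_mult B.m_assoc)
  show "E (b\<star> \<cdot> c) \<in> carrier A \<and> l (F (b\<star> \<cdot> c)) \<bullet> f = star C (xop b) \<bullet> xop c"
  proof
    show "l (F (b\<star> \<cdot> c)) \<bullet> f = star C (xop b) \<bullet> xop c"
      by (rule op_eqI) (use b c in \<open>simp_all add: eq bc C_closed xop_closed l_closed f_closed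
          l_apply f_apply\<close>, simp add: C_apply l_apply f_apply)
  qed (use b c in auto)
  fix a assume "a \<in> carrier A \<and> l (\<iota> a) \<bullet> f = star C (xop b) \<bullet> xop c"
  then have a: "a \<in> carrier A" and la: "l (\<iota> a) \<bullet> f = star C (xop b) \<bullet> xop c" by auto
  \<comment> \<open>Here evaluation at the unit is useless, as \<open>f\<close> kills it; instead
    the operators are tested on \<open>N\<close>, which \<open>f\<close> fixes pointwise.\<close>
  have "\<iota> a = b\<star> \<cdot> c"
  proof (rule N_cancel)
    fix d assume d: "d \<in> N"
    have "(l (\<iota> a) \<bullet> f) d = b\<star> \<cdot> c \<cdot> ker_part d" unfolding la using d by (intro eq) simp
    then show "\<iota> a \<cdot> d = b\<star> \<cdot> c \<cdot> d"
      using a d by (simp add: C_apply f_apply l_apply)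
  qed (use a b c in auto)
  then show "a = E (b\<star> \<cdot> c)" using E_incl[OF a] by simp
qed

text \<open>The adjoint of \<open>xop b\<close> is \<open>l (b\<star>) \<bullet> e\<close>.
  \<open>flip\<close> turns \<open>e\<close> into \<open>f\<close>, and
  \<open>l (b\<star>) \<bullet> f\<close> already has range in \<open>A\<close>, so it is the corner
  of the odd element \<open>b\<star>\<close>.\<close>

lemma xop_sharp:
  assumes b: "b \<in> N"
  shows "sharp X (xop b) = xop (b\<star>)"
proof -
  have "flip (star C (xop b)) = xop (b\<star>)"
    unfolding star_xop[OF b]
    by (rule flip_eqI) (use b in \<open>simp_all add: C_closed l_closed e_closed xop_closed C_apply
        l_apply e_apply xop_apply N_mult_left N_mult_right B.m_assoc\<close>)
  then show ?thesis using b by (simp add: X_simps dual_auto_eq star_C_closed xop_closed)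
qed

lemmas xop_simps = xop_add xop_smult xop_lact xop_ract xop_linner xop_rinner xop_sharp

lemma X_cases:
  assumes "x \<in> carrier X"
  obtains b where "b \<in> N" "x = xop b"
  using assms by (auto simp: carrier_X)

lemma xop_in_X [simp]: "b \<in> N \<Longrightarrow> xop b \<in> carrier X"
  by (simp add: carrier_X)

section \<open>Bimodule axioms, transported along \<open>xop\<close>\<close>

lemma abelian_group_X: "abelian_group X"
proof (rule abelian_groupI)
  fix x assume "x \<in> carrier X"
  then obtain b where "b \<in> N" "x = xop b" by (rule X_cases)
  then show "\<exists>y\<in>carrier X. y \<oplus>\<^bsub>X\<^esub> x = \<zero>\<^bsub>X\<^esub>"
    by (intro bexI[of _ "xop (\<ominus>\<^bsub>B\<^esub> b)"]) (simp_all add: xop_add xop_zero B.l_neg)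
qed (auto elim!: X_cases simp: xop_simps xop_zero B.a_ac)

lemma module_X: "module complex_ring X"
  by (rule moduleI[OF cring_complex_ring abelian_group_X])
    (auto elim!: X_cases simp: xop_simps B.V.smult_l_distr B.V.smult_r_distr B.V.smult_assoc1)

lemma xop_diff: "b \<in> N \<Longrightarrow> c \<in> N \<Longrightarrow> xop b \<ominus>\<^bsub>X\<^esub> xop c = xop (b \<boxminus> c)"
proof -
  interpret X: abelian_group X by (rule abelian_group_X)
  assume b: "b \<in> N" and c: "c \<in> N"
  have "\<ominus>\<^bsub>X\<^esub> xop c = xop (\<ominus>\<^bsub>B\<^esub> c)"
    by (rule X.minus_equality) (use c in \<open>simp_all add: xop_add xop_zero B.l_neg\<close>)
  then show ?thesis using b c by (simp add: a_minus_def xop_add)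
qed

text \<open>\<open>b \<cdot> b\<star>\<close> and \<open>b\<star> \<cdot> b\<close> lie in the
  isometric copy of \<open>A\<close>, so both Hilbert norms of \<open>xop b\<close> equal the norm
  of \<open>b\<close> in \<open>B\<close>.\<close>

lemma norm_E_mult_star: "b \<in> N \<Longrightarrow> cnorm A (E (b \<cdot> b\<star>)) = (cnorm B b)\<^sup>2"
  and norm_E_star_mult: "b \<in> N \<Longrightarrow> cnorm A (E (b\<star> \<cdot> b)) = (cnorm B b)\<^sup>2"
proof -
  assume b: "b \<in> N"
  have "cnorm A (E (b \<cdot> b\<star>)) = cnorm B (b \<cdot> b\<star>)"
    using b norm_incl[of "E (b \<cdot> b\<star>)"] by (simp add: N_mult)
  then show "cnorm A (E (b \<cdot> b\<star>)) = (cnorm B b)\<^sup>2"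
    using b B.norm_cstar[of "b\<star>"] by (simp add: B.star_star B.norm_star)
  have "cnorm A (E (b\<star> \<cdot> b)) = cnorm B (b\<star> \<cdot> b)"
    using b norm_incl[of "E (b\<star> \<cdot> b)"] by (simp add: N_mult)
  then show "cnorm A (E (b\<star> \<cdot> b)) = (cnorm B b)\<^sup>2"
    using b by (simp add: B.norm_cstar)
qed

text \<open>\<open>E\<close> is contractive, so its kernel is closed in the complete algebra
  \<open>B\<close>.\<close>

lemma N_complete: "cauchy_complete N (\<lambda>b c. cnorm B (b \<boxminus> c))"
  unfolding cauchy_complete_def
proof (intro allI impI, elim conjE)
  fix g :: "nat \<Rightarrow> 'b"
  assume g: "\<forall>n. g n \<in> N"
    and cau: "\<forall>\<epsilon>>0. \<exists>N. \<forall>m\<ge>N. \<forall>n\<ge>N. cnorm B (g m \<boxminus> g n) < \<epsilon>"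
  from B.complete[unfolded cauchy_complete_def, rule_format, of g] g cau
  obtain b where b: "b \<in> carrier B" and lim: "(\<lambda>n. cnorm B (g n \<boxminus> b)) \<longlonglongrightarrow> 0" by auto
  have "cnorm A (E b) \<le> cnorm B (g n \<boxminus> b)" for n
  proof -
    have "cnorm A (E b) = cnorm A (E (g n \<boxminus> b))"
      using b g by (simp add: E_diff a_minus_def[of A] A.norm_uminus)
    also have "\<dots> \<le> cnorm B (g n \<boxminus> b)" by (rule norm_E_le) (use b g in simp)
    finally show ?thesis .
  qed
  then have "cnorm A (E b) \<le> 0" using lim by (intro LIMSEQ_le_const) auto
  then have "E b = \<zero>\<^bsub>A\<^esub>" using b A.norm_nonneg[of "E b"] A.norm_eq_0[of "E b"] by simp
  then show "\<exists>l\<in>N. (\<lambda>n. cnorm B (g n \<boxminus> l)) \<longlonglongrightarrow> 0" using b lim N_I by blast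
qed

text \<open>The metric \<open>d\<close> is left open so that one argument serves both the left and
  the right Hilbert norm.\<close>

lemma X_complete:
  assumes d: "\<And>b c. b \<in> N \<Longrightarrow> c \<in> N \<Longrightarrow> d (xop b) (xop c) = cnorm B (b \<boxminus> c)"
  shows "cauchy_complete (carrier X) d"
  unfolding cauchy_complete_def
proof (intro allI impI, elim conjE)
  fix h :: "nat \<Rightarrow> 'b \<Rightarrow> 'b"
  assume h: "\<forall>n. h n \<in> carrier X" and cau: "\<forall>\<epsilon>>0. \<exists>N. \<forall>m\<ge>N. \<forall>n\<ge>N. d (h m) (h n) < \<epsilon>"
  obtain g where g: "\<And>n. g n \<in> N" "\<And>n. h n = xop (g n)"
    using h unfolding carrier_X image_iff by metis
  from N_complete[unfolded cauchy_complete_def, rule_format, of g] cau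
  obtain b where "b \<in> N" "(\<lambda>n. cnorm B (g n \<boxminus> b)) \<longlonglongrightarrow> 0" by (auto simp: g d)
  then show "\<exists>l\<in>carrier X. (\<lambda>n. d (h n) l) \<longlonglongrightarrow> 0"
    by (intro bexI[of _ "xop b"]) (auto simp: g d)
qed

lemma positive_E: "b \<in> N \<Longrightarrow> cpositive A (E (b \<cdot> b\<star>))" "b \<in> N \<Longrightarrow> cpositive A (E (b\<star> \<cdot> b))"
proof -
  assume b: "b \<in> N"
  show "cpositive A (E (b \<cdot> b\<star>))"
    by (rule E_positive) (use b in \<open>auto simp: cpositive_def B.star_star intro!: bexI[of _ "b\<star>"]\<close>)
  show "cpositive A (E (b\<star> \<cdot> b))"
    by (rule E_positive) (use b in \<open>auto simp: cpositive_def\<close>)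
qed

text \<open>Applying \<open>E\<close> to \<open>N_expand\<close> writes \<open>a\<close> exactly as
  a finite sum of elements of \<open>S\<close>; fullness thus holds without approximation.\<close>

lemma dense_spanI:
  assumes "\<And>a i. a \<in> carrier A \<Longrightarrow> i < n \<Longrightarrow> E (\<iota> a \<cdot> p i \<cdot> q i) \<in> S"
  shows "dense_span A S"
  unfolding dense_span_def
proof (intro ballI allI impI)
  fix a and r :: real assume a: "a \<in> carrier A" and r: "r > 0"
  have "E (\<Oplus>\<^bsub>B\<^esub>i\<in>{..<n}. \<iota> a \<cdot> p i \<cdot> q i) = (\<Oplus>\<^bsub>A\<^esub>i\<in>{..<n}. E (\<iota> a \<cdot> p i \<cdot> q i))"
    by (rule additive_B) (use a in \<open>auto simp: E_add\<close>)
  then have sum: "a = (\<Oplus>\<^bsub>A\<^esub>i\<in>{..<n}. E (\<iota> a \<cdot> p i \<cdot> q i))"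
    using a by (simp add: N_expand E_incl)
  have "a \<in> complex_span A S"
    unfolding complex_span_def
  proof (rule InterI, elim CollectE conjE)
    fix H assume "submodule H complex_ring A" "S \<subseteq> H"
    then have "(\<Oplus>\<^bsub>A\<^esub>i\<in>{..<n}. E (\<iota> a \<cdot> p i \<cdot> q i)) \<in> H"
      by (intro submodule_finsum[OF A.is_vector_space]) (use assms a in auto)
    then show "a \<in> H" using sum by simp
  qed
  then show "\<exists>s\<in>complex_span A S. cnorm A (a \<ominus>\<^bsub>A\<^esub> s) < r"
    using a r by (intro bexI[of _ a]) (simp_all add: a_minus_def A.r_neg A.norm_zero)
qed

lemma zero_of_norm: "b \<in> N \<Longrightarrow> (cnorm B b)\<^sup>2 = cnorm A \<zero>\<^bsub>A\<^esub> \<Longrightarrow> b = \<zero>\<^bsub>B\<^esub>"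
  using B.norm_eq_0[of b] by (simp add: A.norm_zero)

lemma N_left_star [simp]: "a \<in> carrier A \<Longrightarrow> b \<in> N \<Longrightarrow> (\<iota> a)\<star> \<cdot> b \<in> N"
  and N_right_star [simp]: "a \<in> carrier A \<Longrightarrow> b \<in> N \<Longrightarrow> b \<cdot> (\<iota> a)\<star> \<in> N"
  by (simp_all flip: incl_star)

text \<open>This puts \<open>X\<close> into its own class, so that the class formed by
  \<open>map_F\<close> is not empty. In the coordinate \<open>b\<close> of \<open>xop b\<close> the
  algebraic axioms are identities in \<open>B\<close>; imprimitivity is associativity combined with
  the grading.\<close>

lemma bimodule_of_involutive: "involutive_equivalence_bimodule A X"
proof -
  have left: "left_hilbert_module A X"
  proof (rule left_hilbert_module.intro)
    fix x assume "x \<in> carrier X"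
    then obtain b where b: "b \<in> N" "x = xop b" by (rule X_cases)
    show "cpositive A (linner X x x)" using b by (simp add: xop_simps positive_E)
    show "x = \<zero>\<^bsub>X\<^esub>" if "linner X x x = \<zero>\<^bsub>A\<^esub>"
      using zero_of_norm[of b] norm_E_mult_star[of b] that b by (simp add: xop_simps xop_zero)
    show "lact X \<one>\<^bsub>A\<^esub> x = x" using b by (simp add: xop_simps incl_one)
  next
    show "cauchy_complete (carrier X)
      (\<lambda>x y. sqrt (cnorm A (linner X (x \<ominus>\<^bsub>X\<^esub> y) (x \<ominus>\<^bsub>X\<^esub> y))))"
      by (rule X_complete) (simp add: xop_diff xop_linner norm_E_mult_star B.norm_nonneg)
  next
    show "module complex_ring X" by (rule module_X)
  next
    fix a x y assume "a \<in> carrier A" "x \<in> carrier X" "y \<in> carrier X"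
    then show "lact X a (x \<oplus>\<^bsub>X\<^esub> y) = lact X a x \<oplus>\<^bsub>X\<^esub> lact X a y"
      by (auto elim!: X_cases simp: xop_simps B.r_distr)
  qed (auto elim!: X_cases simp: xop_simps B.r_distr B.l_distr incl_add incl_mult incl_smult
      B.smult_mult_left B.smult_mult_right B.m_assoc E_add E_smult E_left B.star_add B.star_smult
      B.star_mult B.star_star simp flip: E_star)
  have right: "right_hilbert_module A X"
  proof (rule right_hilbert_module.intro)
    fix x assume "x \<in> carrier X"
    then obtain b where b: "b \<in> N" "x = xop b" by (rule X_cases)
    show "cpositive A (rinner X x x)" using b by (simp add: xop_simps positive_E)
    show "x = \<zero>\<^bsub>X\<^esub>" if "rinner X x x = \<zero>\<^bsub>A\<^esub>"
      using zero_of_norm[of b] norm_E_star_mult[of b] that b by (simp add: xop_simps xop_zero)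
    show "ract X x \<one>\<^bsub>A\<^esub> = x" using b by (simp add: xop_simps incl_one)
  next
    show "cauchy_complete (carrier X) (\<lambda>x y. hnorm A X (x \<ominus>\<^bsub>X\<^esub> y))"
      by (rule X_complete) (simp add: hnorm_def xop_diff xop_rinner norm_E_star_mult B.norm_nonneg)
  next
    show "module complex_ring X" by (rule module_X)
  qed (auto elim!: X_cases simp: xop_simps B.r_distr B.l_distr incl_add incl_mult incl_smult
      B.smult_mult_left B.smult_mult_right E_add E_smult E_right B.star_add B.star_smult
      B.star_mult B.star_star simp flip: E_star B.m_assoc)
  have eq: "equivalence_bimodule A X"
  proof (intro equivalence_bimodule.intro left right equivalence_bimodule_axioms.intro)
    show "dense_span A {linner X x y |x y. x \<in> carrier X \<and> y \<in> carrier X}"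
    proof (rule dense_spanI)
      fix a i assume "a \<in> carrier A" "i < n"
      then have "E (\<iota> a \<cdot> p i \<cdot> q i) = linner X (xop (\<iota> a \<cdot> p i)) (xop ((q i)\<star>))"
        by (simp add: xop_linner B.star_star)
      then show "E (\<iota> a \<cdot> p i \<cdot> q i) \<in> {linner X x y |x y. x \<in> carrier X \<and> y \<in> carrier X}"
        using \<open>a \<in> carrier A\<close> \<open>i < n\<close> by (auto intro!: exI xop_in_X)
    qed
    show "dense_span A {rinner X x y |x y. x \<in> carrier X \<and> y \<in> carrier X}"
    proof (rule dense_spanI)
      fix a i assume "a \<in> carrier A" "i < n"
      then have "E (\<iota> a \<cdot> p i \<cdot> q i) = rinner X (xop ((\<iota> a \<cdot> p i)\<star>)) (xop (q i))"
        by (simp add: xop_rinner B.star_star)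
      then show "E (\<iota> a \<cdot> p i \<cdot> q i) \<in> {rinner X x y |x y. x \<in> carrier X \<and> y \<in> carrier X}"
        using \<open>a \<in> carrier A\<close> \<open>i < n\<close> by (auto intro!: exI xop_in_X)
    qed
  qed (auto elim!: X_cases simp: xop_simps incl_star B.m_assoc B.star_mult B.star_star N_mult)
  show ?thesis
    by (intro involutive_equivalence_bimodule.intro eq involutive_equivalence_bimodule_axioms.intro)
      (auto elim!: X_cases simp: xop_simps incl_star B.m_assoc B.star_mult B.star_star B.star_add B.star_smult)
qed

end

section \<open>The extension of a bimodule\<close>

lemma extension_equiv_trans:
  "extension_equiv A P Q \<Longrightarrow> extension_equiv A Q R \<Longrightarrow> extension_equiv A P R"
proof -
  assume "extension_equiv A P Q" "extension_equiv A Q R"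
  then obtain f g where f: "star_iso (alg P) (alg Q) f" "\<forall>a\<in>carrier A. f (incl P a) = incl Q a"
      "\<forall>b\<in>carrier (alg P). expec Q (f b) = expec P b"
    and g: "star_iso (alg Q) (alg R) g" "\<forall>a\<in>carrier A. g (incl Q a) = incl R a"
      "\<forall>b\<in>carrier (alg Q). expec R (g b) = expec Q b"
    unfolding extension_equiv_def by blast
  have closed: "f b \<in> carrier (alg Q)" if "b \<in> carrier (alg P)" for b
    using f(1) that by (auto simp: star_iso_def bij_betw_def)
  have "star_iso (alg P) (alg R) (g \<circ> f)"
    using f(1) g(1) closed unfolding star_iso_def star_hom_def
    by (auto intro: ring_hom_trans bij_betw_trans)
  then show ?thesis
    unfolding extension_equiv_def using f g closed by (intro exI[of _ "g \<circ> f"]) auto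
qed

lemma extension_equiv_sym:
  assumes B: "unital_cstar_algebra (alg P)" and incl: "\<And>a. a \<in> carrier A \<Longrightarrow> incl P a \<in> carrier (alg P)"
    and PQ: "extension_equiv A P Q"
  shows "extension_equiv A Q P"
proof -
  interpret unital_cstar_algebra "alg P" by (rule B)
  obtain f where f: "star_iso (alg P) (alg Q) f" "\<forall>a\<in>carrier A. f (incl P a) = incl Q a"
      "\<forall>b\<in>carrier (alg P). expec Q (f b) = expec P b"
    using PQ unfolding extension_equiv_def by blast
  have hom: "f \<in> ring_hom (alg P) (alg Q)" and inj: "inj_on f (carrier (alg P))"
    and img: "carrier (alg Q) = f ` carrier (alg P)"
    and smult: "\<And>c x. x \<in> carrier (alg P) \<Longrightarrow> f (c \<odot>\<^bsub>alg P\<^esub> x) = c \<odot>\<^bsub>alg Q\<^esub> f x"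
    and star: "\<And>x. x \<in> carrier (alg P) \<Longrightarrow> f (star (alg P) x) = star (alg Q) (f x)"
    using f(1) by (auto simp: star_iso_def star_hom_def bij_betw_def)
  define g where "g = the_inv_into (carrier (alg P)) f"
  have gf: "g (f x) = x" if "x \<in> carrier (alg P)" for x
    using the_inv_into_f_f[OF inj that] by (simp add: g_def)
  have "star_iso (alg Q) (alg P) g"
    unfolding star_iso_def star_hom_def
  proof (intro conjI ballI allI)
    show "g \<in> ring_hom (alg Q) (alg P)"
    proof (rule ring_hom_memI)
      show "g \<one>\<^bsub>alg Q\<^esub> = \<one>\<^bsub>alg P\<^esub>"
        using gf[OF one_closed] ring_hom_one[OF hom] by simp
    qed (auto simp: img gf simp flip: ring_hom_mult[OF hom] ring_hom_add[OF hom])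
    show "bij_betw g (carrier (alg Q)) (carrier (alg P))"
      unfolding g_def by (rule bij_betw_the_inv_into) (simp add: bij_betw_def inj img)
  qed (auto simp: img gf V.smult_closed star_closed simp flip: smult star)
  moreover have "g (incl Q a) = incl P a" if "a \<in> carrier A" for a
    using gf[OF incl[OF that]] f(2) that by simp
  moreover have "expec P (g b) = expec Q b" if "b \<in> carrier (alg Q)" for b
    using that f(3) by (auto simp: img gf)
  ultimately show ?thesis unfolding extension_equiv_def by blast
qed

lemma bimodule_equiv_refl: "bimodule_equiv A X X"
  unfolding bimodule_equiv_def by (intro exI[of _ id]) auto

context index2_basis
begin

lemma ker_part_incl: "a \<in> carrier A \<Longrightarrow> ker_part (\<iota> a) = \<zero>\<^bsub>B\<^esub>"
  by (simp add: ker_part_def E_incl a_minus_def[of B] B.r_neg)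

lemma E_mult: "x \<in> carrier B \<Longrightarrow> y \<in> carrier B \<Longrightarrow>
    E (x \<cdot> y) = E x \<otimes>\<^bsub>A\<^esub> E y \<oplus>\<^bsub>A\<^esub> E (ker_part x \<cdot> ker_part y)"
  and ker_part_mult: "x \<in> carrier B \<Longrightarrow> y \<in> carrier B \<Longrightarrow>
    ker_part (x \<cdot> y) = F x \<cdot> ker_part y \<boxplus> ker_part x \<cdot> F y"
proof -
  assume x: "x \<in> carrier B" and y: "y \<in> carrier B"
  have k: "ker_part x \<in> N" "ker_part y \<in> N" using x y by auto
  have xy: "x \<cdot> y = F x \<cdot> F y \<boxplus> F x \<cdot> ker_part y \<boxplus> ker_part x \<cdot> F y \<boxplus> ker_part x \<cdot> ker_part y"
  proof -
    have "x \<cdot> y = (F x \<boxplus> ker_part x) \<cdot> (F y \<boxplus> ker_part y)"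
      using decompose[OF x] decompose[OF y] by (rule arg_cong2)
    then show ?thesis using x y k by (simp add: B.l_distr B.r_distr B.a_ac)
  qed
  show "E (x \<cdot> y) = E x \<otimes>\<^bsub>A\<^esub> E y \<oplus>\<^bsub>A\<^esub> E (ker_part x \<cdot> ker_part y)"
    unfolding xy using x y k by (simp add: E_add E_left E_right E_F)
  have "ker_part (F x \<cdot> F y) = \<zero>\<^bsub>B\<^esub>"
    using ker_part_incl[of "E x \<otimes>\<^bsub>A\<^esub> E y"] x y by (simp add: incl_mult)
  moreover have "ker_part (ker_part x \<cdot> ker_part y) = \<zero>\<^bsub>B\<^esub>"
    using ker_part_incl[of "E (ker_part x \<cdot> ker_part y)"] x y k by (simp add: N_mult)
  ultimately show "ker_part (x \<cdot> y) = F x \<cdot> ker_part y \<boxplus> ker_part x \<cdot> F y"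
    unfolding xy using x y k by (simp add: ker_part_add ker_part_left ker_part_right)
qed

text \<open>Stated for every \<open>Z\<close> equivalent to \<open>X\<close>, since
  \<open>map_F\<close> collects the whole class; the case \<open>Z = X\<close> gives the inverse
  relation on representatives.\<close>

lemma extension_of_equiv:
  fixes Z :: "('a, 'x) inv_bimodule"
  assumes Z: "involutive_equivalence_bimodule A Z" and XZ: "bimodule_equiv A X Z"
  shows "extension_equiv A P (extension_of A Z)"
proof -
  interpret Z: involutive_equivalence_bimodule A Z by (rule Z)
  interpret mZ: module complex_ring Z by (rule Z.is_vector_space)
  obtain \<rho> where \<rho>: "bij_betw \<rho> (carrier X) (carrier Z)"
    "\<forall>x\<in>carrier X. \<forall>y\<in>carrier X. \<rho> (x \<oplus>\<^bsub>X\<^esub> y) = \<rho> x \<oplus>\<^bsub>Z\<^esub> \<rho> y"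
    "\<forall>c. \<forall>x\<in>carrier X. \<rho> (c \<odot>\<^bsub>X\<^esub> x) = c \<odot>\<^bsub>Z\<^esub> \<rho> x"
    "\<forall>a\<in>carrier A. \<forall>x\<in>carrier X. \<rho> (lact X a x) = lact Z a (\<rho> x)"
    "\<forall>a\<in>carrier A. \<forall>x\<in>carrier X. \<rho> (ract X x a) = ract Z (\<rho> x) a"
    "\<forall>x\<in>carrier X. \<forall>y\<in>carrier X. linner Z (\<rho> x) (\<rho> y) = linner X x y"
    "\<forall>x\<in>carrier X. \<forall>y\<in>carrier X. rinner Z (\<rho> x) (\<rho> y) = rinner X x y"
    "\<forall>x\<in>carrier X. \<rho> (sharp X x) = sharp Z (\<rho> x)"
    using XZ unfolding bimodule_equiv_def by blast
  define \<sigma> where "\<sigma> b = \<rho> (xop b)" for b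
  have bij: "bij_betw \<sigma> N (carrier Z)"
  proof -
    have "bij_betw (\<rho> \<circ> xop) N (carrier Z)"
      by (rule bij_betw_trans[OF _ \<rho>(1)]) (simp add: bij_betw_def xop_inj carrier_X)
    moreover have "\<rho> \<circ> xop = \<sigma>" by (simp add: fun_eq_iff \<sigma>_def)
    ultimately show ?thesis by simp
  qed
  have \<sigma>_closed [simp]: "\<sigma> b \<in> carrier Z" if "b \<in> N" for b
    using bij that by (auto simp: bij_betw_def)
  have \<sigma>_add: "\<sigma> b \<oplus>\<^bsub>Z\<^esub> \<sigma> c = \<sigma> (b \<boxplus> c)" if "b \<in> N" "c \<in> N" for b c
    using \<rho>(2) that by (simp add: \<sigma>_def flip: xop_add)
  have \<sigma>_smult: "k \<odot>\<^bsub>Z\<^esub> \<sigma> b = \<sigma> (k \<odot>\<^bsub>B\<^esub> b)" if "b \<in> N" for k b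
    using \<rho>(3) that by (simp add: \<sigma>_def flip: xop_smult)
  have \<sigma>_lact: "lact Z a (\<sigma> b) = \<sigma> (\<iota> a \<cdot> b)" if "a \<in> carrier A" "b \<in> N" for a b
    using \<rho>(4) that by (simp add: \<sigma>_def flip: xop_lact)
  have \<sigma>_ract: "ract Z (\<sigma> b) a = \<sigma> (b \<cdot> \<iota> a)" if "a \<in> carrier A" "b \<in> N" for a b
    using \<rho>(5) that by (simp add: \<sigma>_def flip: xop_ract)
  have \<sigma>_linner: "linner Z (\<sigma> b) (\<sigma> c) = E (b \<cdot> c\<star>)" if "b \<in> N" "c \<in> N" for b c
    using \<rho>(6) that by (simp add: \<sigma>_def xop_linner)
  have \<sigma>_rinner: "rinner Z (\<sigma> b) (\<sigma> c) = E (b\<star> \<cdot> c)" if "b \<in> N" "c \<in> N" for b c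
    using \<rho>(7) that by (simp add: \<sigma>_def xop_rinner)
  have \<sigma>_sharp: "sharp Z (\<sigma> b) = \<sigma> (b\<star>)" if "b \<in> N" for b
    using \<rho>(8) that by (simp add: \<sigma>_def flip: xop_sharp)
  have "\<sigma> \<zero>\<^bsub>B\<^esub> \<oplus>\<^bsub>Z\<^esub> \<sigma> \<zero>\<^bsub>B\<^esub> = \<sigma> \<zero>\<^bsub>B\<^esub>" by (simp add: \<sigma>_add)
  then have \<sigma>_zero: "\<sigma> \<zero>\<^bsub>B\<^esub> = \<zero>\<^bsub>Z\<^esub>" by simp
  let ?Q = "extension_of A Z"
  \<comment> \<open>Through \<open>\<sigma>\<close> the involution of \<open>Z\<close> is the
    adjoint of \<open>B\<close>, so the lower corner is \<open>sharp\<close> of the upper one;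
    writing it with the adjoint keeps the computations inside \<open>N\<close>.\<close>
  define \<pi> where "\<pi> b = Link (E b) (\<sigma> (ker_part b)) (Tilde (\<sigma> ((ker_part b)\<star>))) (E b)" for b
  have Q: "carrier (alg ?Q) = {Link a x (Tilde (sharp Z x)) a |a x. a \<in> carrier A \<and> x \<in> carrier Z}"
    "mult (alg ?Q) = link_mult A Z" "\<one>\<^bsub>alg ?Q\<^esub> = Link \<one>\<^bsub>A\<^esub> \<zero>\<^bsub>Z\<^esub> (Tilde \<zero>\<^bsub>Z\<^esub>) \<one>\<^bsub>A\<^esub>"
    "add (alg ?Q) = link_add A Z" "smult (alg ?Q) = link_smult A Z" "star (alg ?Q) = link_star A"
    "incl ?Q a = Link a \<zero>\<^bsub>Z\<^esub> (Tilde \<zero>\<^bsub>Z\<^esub>) a" "expec ?Q = ent11" for a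
    by (simp_all add: extension_of_def linking_algebra_def)
  have "star_iso B (alg ?Q) \<pi>"
    unfolding star_iso_def star_hom_def
  proof (intro conjI ballI allI)
    show "\<pi> \<in> ring_hom B (alg ?Q)"
    proof (rule ring_hom_memI)
      fix x assume x: "x \<in> carrier B"
      show "\<pi> x \<in> carrier (alg ?Q)" using x by (auto simp: Q \<pi>_def \<sigma>_sharp)
      fix y assume y: "y \<in> carrier B"
      show "\<pi> (x \<oplus>\<^bsub>B\<^esub> y) = \<pi> x \<oplus>\<^bsub>alg ?Q\<^esub> \<pi> y"
        using x y by (simp add: Q \<pi>_def E_add ker_part_add B.star_add dual_add_def \<sigma>_add)
      define k m where "k = ker_part x" and "m = ker_part y"
      have km [simp]: "k \<in> N" "m \<in> N" using x y by (auto simp: k_def m_def)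
      have ab [simp]: "E x \<in> carrier A" "E y \<in> carrier A" using x y by auto
      have xy: "ker_part (x \<cdot> y) = F x \<cdot> m \<boxplus> k \<cdot> F y"
        using x y by (simp add: ker_part_mult k_def m_def)
      have Exy: "E (x \<cdot> y) = E x \<otimes>\<^bsub>A\<^esub> E y \<oplus>\<^bsub>A\<^esub> E (k \<cdot> m)"
        unfolding k_def m_def by (rule E_mult[OF x y])
      have e11: "E x \<otimes>\<^bsub>A\<^esub> E y \<oplus>\<^bsub>A\<^esub> linner Z (\<sigma> k) (\<sigma> (m\<star>)) = E (x \<cdot> y)"
        unfolding Exy by (simp add: \<sigma>_linner B.star_star)
      have e12: "lact Z (E x) (\<sigma> m) \<oplus>\<^bsub>Z\<^esub> ract Z (\<sigma> k) (E y) = \<sigma> (ker_part (x \<cdot> y))"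
        unfolding xy by (simp add: \<sigma>_lact \<sigma>_ract \<sigma>_add)
      \<comment> \<open>The dual actions involve adjoints, so this corner is the adjoint of the odd
        part of \<open>x \<cdot> y\<close>, with its summands in the opposite order.\<close>
      have e21: "lact Z (star A (E y)) (\<sigma> (k\<star>)) \<oplus>\<^bsub>Z\<^esub> ract Z (\<sigma> (m\<star>)) (star A (E x))
          = \<sigma> ((ker_part (x \<cdot> y))\<star>)"
      proof -
        have "(F x \<cdot> m \<boxplus> k \<cdot> F y)\<star> = m\<star> \<cdot> \<iota> (star A (E x)) \<boxplus> \<iota> (star A (E y)) \<cdot> k\<star>"
          by (simp add: B.star_add B.star_mult incl_star)
        also have "\<dots> = \<iota> (star A (E y)) \<cdot> k\<star> \<boxplus> m\<star> \<cdot> \<iota> (star A (E x))"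
          by (rule B.a_comm) simp_all
        finally show ?thesis unfolding xy by (simp add: \<sigma>_lact \<sigma>_ract \<sigma>_add)
      qed
      have e22: "rinner Z (\<sigma> (k\<star>)) (\<sigma> m) \<oplus>\<^bsub>A\<^esub> E x \<otimes>\<^bsub>A\<^esub> E y = E (x \<cdot> y)"
        unfolding Exy by (simp add: \<sigma>_rinner B.star_star A.a_comm)
      show "\<pi> (x \<otimes>\<^bsub>B\<^esub> y) = \<pi> x \<otimes>\<^bsub>alg ?Q\<^esub> \<pi> y"
        unfolding \<pi>_def Q k_def[symmetric] m_def[symmetric] link_mult.simps dual_add_def
          dual_ract_def dual_lact_def dual.sel e11 e12 e21 e22 ..
    next
      show "\<pi> \<one>\<^bsub>B\<^esub> = \<one>\<^bsub>alg ?Q\<^esub>"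
        using ker_part_incl[of "\<one>\<^bsub>A\<^esub>"] by (simp add: Q \<pi>_def E_one incl_one \<sigma>_zero)
    qed
    show "\<pi> (c \<odot>\<^bsub>B\<^esub> x) = c \<odot>\<^bsub>alg ?Q\<^esub> \<pi> x" if "x \<in> carrier B" for c x
      using that by (simp add: Q \<pi>_def E_smult ker_part_smult \<sigma>_smult B.star_smult dual_smult_def)
    show "\<pi> (x\<star>) = star (alg ?Q) (\<pi> x)" if "x \<in> carrier B" for x
      using that by (simp add: Q \<pi>_def E_star ker_part_star B.star_star)
    show "bij_betw \<pi> (carrier B) (carrier (alg ?Q))"
      unfolding bij_betw_def
    proof
      show "inj_on \<pi> (carrier B)"
      proof (rule inj_onI)
        fix x y assume x: "x \<in> carrier B" and y: "y \<in> carrier B" and "\<pi> x = \<pi> y"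
        then have "E x = E y" "\<sigma> (ker_part x) = \<sigma> (ker_part y)" by (simp_all add: \<pi>_def)
        moreover from this(2) have "ker_part x = ker_part y"
          using bij x y by (auto simp: bij_betw_def dest: inj_onD)
        ultimately have eq: "F x \<boxplus> ker_part x = F y \<boxplus> ker_part y" by simp
        show "x = y" using eq unfolding decompose[OF x, symmetric] decompose[OF y, symmetric] .
      qed
      show "\<pi> ` carrier B = carrier (alg ?Q)"
      proof (intro equalityI subsetI)
        fix M assume "M \<in> \<pi> ` carrier B"
        then show "M \<in> carrier (alg ?Q)" by (auto simp: Q \<pi>_def \<sigma>_sharp)
      next
        fix M assume "M \<in> carrier (alg ?Q)"
        then obtain a x where M: "M = Link a x (Tilde (sharp Z x)) a" "a \<in> carrier A" "x \<in> carrier Z"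
          by (auto simp: Q)
        then obtain b where b: "b \<in> N" "x = \<sigma> b" using bij by (auto simp: bij_betw_def)
        have "\<pi> (\<iota> a \<boxplus> b) = M"
          using M b by (simp add: \<pi>_def E_add E_incl ker_part_add ker_part_incl \<sigma>_sharp)
        moreover have "\<iota> a \<boxplus> b \<in> carrier B" using M b by simp
        ultimately show "M \<in> \<pi> ` carrier B" by blast
      qed
    qed
  qed
  moreover have "\<forall>a\<in>carrier A. \<pi> (incl P a) = incl ?Q a"
    by (simp add: Q \<pi>_def E_incl ker_part_incl \<sigma>_zero)
  moreover have "\<forall>b\<in>carrier B. expec ?Q (\<pi> b) = expec P b"
    by (simp add: Q \<pi>_def)
  ultimately show ?thesis unfolding extension_equiv_def by blast
qed

end

theorem lemma3p3p3:
  fixes A :: "'a cstar"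
  assumes "unital_cstar_algebra A"
  shows "\<forall>c \<in> (index2_extensions A :: ('a, 'b) extension set) // extension_rel A.
           (map_G A \<circ> map_F A) c = c"
proof
  fix c :: "('a, 'b) extension set"
  assume "c \<in> index2_extensions A // extension_rel A"
  then obtain P where P: "P \<in> index2_extensions A" and c: "c = extension_rel A `` {P}"
    by (auto simp: quotient_def)
  \<comment> \<open>The index condition is existential, so each representative brings its own
    quasi-basis.\<close>
  have basis: "\<exists>n u v. index2_basis A Q n u v" if "Q \<in> index2_extensions A" for Q :: "('a, 'b) extension"
  proof -
    interpret index2_extension A Q by (rule index2_extension.intro) (fact assms that)+
    obtain n u v where "quasi_basis Q n u v" "2 \<odot>\<^bsub>alg Q\<^esub> \<one>\<^bsub>alg Q\<^esub> = (\<Oplus>\<^bsub>alg Q\<^esub>i\<in>{..<n}. u i \<otimes>\<^bsub>alg Q\<^esub> v i)"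
      using quasi_basis by blast
    then have "index2_basis A Q n u v"
      by (intro index2_basis.intro index2_basis_axioms.intro index2_extension_axioms)
    then show ?thesis by blast
  qed
  have mem: "Q \<in> c \<longleftrightarrow> Q \<in> index2_extensions A \<and> extension_equiv A P Q" for Q
    using P by (auto simp: c extension_rel_def)
  show "(map_G A \<circ> map_F A) c = c"
  proof (intro equalityI subsetI)
    \<comment> \<open>\<open>R\<close> arises from some \<open>Q \<in> c\<close> and some
      \<open>X\<close> in the class of \<open>bimodule_of A Q\<close>; the chain of equivalences
      runs from \<open>P\<close> over \<open>Q\<close> and \<open>extension_of A X\<close> to
      \<open>R\<close>.\<close>
    fix R :: "('a, 'b) extension"
    assume "R \<in> (map_G A \<circ> map_F A) c"
    then obtain Q and X :: "('a, 'b \<Rightarrow> 'b) inv_bimodule" where Q: "Q \<in> c"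
      and X: "involutive_equivalence_bimodule A X" "bimodule_equiv A (bimodule_of A Q) X"
      and R: "R \<in> index2_extensions A" "extension_equiv A (extension_of A X) R"
      by (auto simp: map_G_def map_F_def bimodule_class_def extension_class_def inv_equiv_bimodules_def)
    have Q': "Q \<in> index2_extensions A" "extension_equiv A P Q" using Q by (auto simp: mem)
    obtain n u v where "index2_basis A Q n u v" using basis[OF Q'(1)] by blast
    then have "extension_equiv A Q (extension_of A X)"
      by (rule index2_basis.extension_of_equiv[OF _ X])
    then show "R \<in> c"
      using extension_equiv_trans[OF Q'(2) extension_equiv_trans[OF _ R(2)]] R(1) by (simp add: mem)
  next
    \<comment> \<open>\<open>Q\<close> is reached from itself, with \<open>bimodule_of A Q\<close>
      as the intermediate bimodule.\<close>
    fix Q assume Q: "Q \<in> c"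
    then have Q': "Q \<in> index2_extensions A" by (simp add: mem)
    obtain n u v where "index2_basis A Q n u v" using basis[OF Q'] by blast
    then interpret index2_basis A Q n u v .
    have "extension_equiv A (extension_of A (bimodule_of A Q)) Q"
      by (rule extension_equiv_sym[OF cstar_B incl_closed
            extension_of_equiv[OF bimodule_of_involutive bimodule_equiv_refl]])
    then show "Q \<in> (map_G A \<circ> map_F A) c"
      unfolding comp_apply map_G_def map_F_def bimodule_class_def extension_class_def inv_equiv_bimodules_def
      using Q Q' bimodule_of_involutive bimodule_equiv_refl[of A "bimodule_of A Q"] by blast
  qed
qed

end
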